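(* In $\mathrm{SMC}$, the following holds for any symmetric monoidal category $\mathcal A$. - The composite $\mathcal A\xrightarrow{R'_{\mathcal A}}\mathcal A\otimes\mathcal I\xrightarrow{R_{\mathcal A}}\mathcal A$ is the identity at $\mathcal A$. - There exists a 1-cell $F:\mathcal A\otimes\mathcal I\to\mathcal A\otimes\mathcal I$ with two 2-cells $F\to1:\mathcal A\otimes\mathcal I\to\mathcal A\otimes\mathcal I$ and $F\to R'_{\mathcal A}\circ R_{\mathcal A}$.
   Context: **Basics.** All symmetric monoidal categories are small, with tensor $\otimes$, unit $I$ and natural isomorphisms $ass_{a,b,c}:a\otimes(b\otimes c)\to(a\otimes b)\otimes c$, $r_a:a\otimes I\to a$, $l_a:I\otimes a\to a$, $s_{a,b}:a\otimes b\to b\otimes a$ satisfying the usual coherence axioms. A symmetric monoidal functor $F:\mathcal A\to\mathcal B$ is a lax one: a functor with an arrow $F^0:I\to F(I)$ and a natural family $F^2_{x,y}:Fx\otimes Fy\to F(x\otimes y)$ satisfying the usual associativity, unit and symmetry axioms; it is strict if $F^0$ and all $F^2_{x,y}$ are identities. $\mathrm{SMC}$ is the 2-category of symmetric monoidal categories, symmetric monoidal functors and monoidal natural transformations. **Internal hom.** $[\mathcal A,\mathcal B]$ is the category $\mathrm{SMC}(\mathcal A,\mathcal B)$ with the pointwise symmetric monoidal structure: $(F\Box G)(a)=Fa\otimes Ga$, $(F\Box G)^0$ is $I\cong I\otimes I\xrightarrow{F^0\otimes G^0}F(I)\otimes G(I)$, $(F\Box G)^2_{a,b}$ is the canonical interchange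 $(Fa\otimes Ga)\otimes(Fb\otimes Gb)\cong(Fa\otimes Fb)\otimes(Ga\otimes Gb)$ followed by $F^2_{a,b}\otimes G^2_{a,b}$; $(\sigma\Box\tau)_a=\sigma_a\otimes\tau_a$; the unit is the constant functor at $I_{\mathcal B}$ (with $I\to I$ the identity and $I\otimes I\to I$ the canonical arrow); $ass,r,l,s$ are pointwise. For an object $a$ of $\mathcal A$, $ev_a:[\mathcal A,\mathcal B]\to\mathcal B$ is the strict symmetric monoidal functor $F\mapsto Fa$, $\sigma\mapsto\sigma_a$. **Duality.** For $F:\mathcal A\to[\mathcal B,\mathcal C]$ in $\mathrm{SMC}$, its dual $F^*:\mathcal B\to[\mathcal A,\mathcal C]$ is given by $F^*(b)(a)=F(a)(b)$, $F^*(b)(f)=F(f)_b$, $(F^*b)^0=(F^0)_b$, $(F^*b)^2_{a,a'}=(F^2_{a,a'})_b$, $F^*(g)_a=F(a)(g)$, $((F^* )^0)_a=(Fa)^0$, $((F^* )^2_{b,b'})_a=(Fa)^2_{b,b'}$. **Tensor.** $\mathcal A\otimes\mathcal B$ is the following symmetric monoidal category. Its objects are the formal words freely generated from a constant $I$ and symbols $a\otimes b$ ($a$ in $\mathcal A$, $b$ in $\mathcal B$) under a formal binary operation $X\otimes Y$. Its arrows are freely generated, under composition and the operations $p\mapsto X\otimes p$, $p\mapsto p\otimes X$ for objects $X$, by formal arrows $ass,r,l$ (with formal inverses) and $s$ for all objects, and by arrows $\alpha_b:I\to I_{\mathcal A}\otimes b$; $\beta_a:I\to a\otimes I_{\mathcal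 B}$; $\gamma_{a,a',b}:(a\otimes b)\otimes(a'\otimes b)\to(a\otimes a')\otimes b$; $\delta_{a,b,b'}:(a\otimes b)\otimes(a\otimes b')\to a\otimes(b\otimes b')$; $a\otimes g:a\otimes b\to a\otimes b'$ for $g:b\to b'$ in $\mathcal B$; $f\otimes b:a\otimes b\to a'\otimes b$ for $f:a\to a'$ in $\mathcal A$; modulo the smallest congruence, compatible with all $X\otimes-$ and $-\otimes X$, such that: (i) $\otimes$ is a bifunctor and $\otimes,I,ass,r,l,s$ form a symmetric monoidal structure; (ii) for each $a$, $b\mapsto a\otimes b$, $g\mapsto a\otimes g$ with structure $\beta_a$, $\delta_{a,-,-}$ is a symmetric monoidal functor $\eta(a):\mathcal B\to\mathcal A\otimes\mathcal B$; (iii) for each $b$, $a\mapsto a\otimes b$, $f\mapsto f\otimes b$ with structure $\alpha_b$, $\gamma_{-,-,b}$ is a symmetric monoidal functor $\mathcal A\to\mathcal A\otimes\mathcal B$; (iv) for each $f:a\to a'$ the family $(f\otimes b)_b$, and for each $g:b\to b'$ the family $(a\otimes g)_a$, is a monoidal natural transformation between the corresponding functors of (ii), resp. (iii); (v) with $c:I\otimes I\to I$ canonical, $\alpha_{b\otimes b'}\circ c=\delta_{I_{\mathcal A},b,b'}\circ(\alpha_b\otimes\alpha_{b'})$, $\beta_{a\otimes a'}\circ c=\gamma_{a,a',I_{\mathcal B}}\circ(\beta_a\otimes\beta_{a'})$, and $\beta_{I_{\mathcal A}}=\alpha_{I_{\mathcal B}}$; (vi) $\gamma_{a,a',b\otimes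 b'}\circ(\delta_{a,b,b'}\otimes\delta_{a',b,b'})=\delta_{a\otimes a',b,b'}\circ(\gamma_{a,a',b}\otimes\gamma_{a,a',b'})\circ m$, where $m$ is the canonical isomorphism exchanging the two middle factors $a\otimes b'$ and $a'\otimes b$. The symmetric monoidal functor $\eta:\mathcal A\to[\mathcal B,\mathcal A\otimes\mathcal B]$ is $a\mapsto\eta(a)$, $\eta(f)_b=f\otimes b$, $(\eta^0)_b=\alpha_b$, $(\eta^2_{a,a'})_b=\gamma_{a,a',b}$. **$En$.** For $F:\mathcal A\to[\mathcal B,\mathcal C]$, $En(F):\mathcal A\otimes\mathcal B\to\mathcal C$ is the strict symmetric monoidal functor with $a\otimes b\mapsto F(a)(b)$, $\alpha_b\mapsto(F^0)_b$, $\beta_a\mapsto(Fa)^0$, $\gamma_{a,a',b}\mapsto(F^2_{a,a'})_b$, $\delta_{a,b,b'}\mapsto(Fa)^2_{b,b'}$, $f\otimes b\mapsto F(f)_b$, $a\otimes g\mapsto F(a)(g)$. **Unit and canonical arrows.** $\mathcal I$ is the free symmetric monoidal category on one generating object $\star$: for each symmetric monoidal category $\mathcal X$ and object $x$ there is a unique strict symmetric monoidal functor $\mathcal I\to\mathcal X$ sending $\star$ to $x$ (its objects are formal words in $I,\star,\otimes$; its arrows are generated by the canonical ones). $v:\mathcal I\to[\mathcal A,\mathcal A]$ is the strict symmetric monoidal functor with $v(\star)=1_{\mathcal A}$, and $v^*:\mathcal A\to[\mathcal I,\mathcal A]$ its dual. $R_{\mathcal A}=En(v^* ):\mathcal A\otimes\mathcal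 I\to\mathcal A$, and $R'_{\mathcal A}$ is $\mathcal A\xrightarrow{\eta}[\mathcal I,\mathcal A\otimes\mathcal I]\xrightarrow{ev_\star}\mathcal A\otimes\mathcal I$. *)

theory Defs
  imports "HOL-Library.FuncSet"
begin

section \<open>Symmetric monoidal categories\<close>

text \<open>
  \<^term>\<open>Cmp C g f\<close> is composition in the order \<open>g\<close> after \<open>f\<close>; \<open>OTen\<close> and \<open>ATen\<close> are the
  tensor on objects and on arrows. The inverses of \<open>Ass\<close>, \<open>Run\<close>, \<open>Lun\<close> are not part of the data.
\<close>

record ('o, 'a) smc =
  Obj :: "'o set"
  Arr :: "'a set"
  Src :: "'a \<Rightarrow> 'o"
  Trg :: "'a \<Rightarrow> 'o"
  Idn :: "'o \<Rightarrow> 'a"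
  Cmp :: "'a \<Rightarrow> 'a \<Rightarrow> 'a" (infixl "\<cdot>\<index>" 65)
  OTen :: "'o \<Rightarrow> 'o \<Rightarrow> 'o" (infixr "\<otimes>\<index>" 70)
  ATen :: "'a \<Rightarrow> 'a \<Rightarrow> 'a" (infixr "\<boxtimes>\<index>" 70)
  Unt :: "'o"
  Ass :: "'o \<Rightarrow> 'o \<Rightarrow> 'o \<Rightarrow> 'a"
  Run :: "'o \<Rightarrow> 'a"
  Lun :: "'o \<Rightarrow> 'a"
  Swp :: "'o \<Rightarrow> 'o \<Rightarrow> 'a"

definition hom_set :: "('o, 'a) smc \<Rightarrow> 'o \<Rightarrow> 'o \<Rightarrow> 'a set" where
  "hom_set C x y = {f \<in> Arr C. Src C f = x \<and> Trg C f = y}"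

definition inverse_arrows :: "('o, 'a) smc \<Rightarrow> 'a \<Rightarrow> 'a \<Rightarrow> bool" where
  "inverse_arrows C f g \<longleftrightarrow>
     f \<in> Arr C \<and> g \<in> hom_set C (Trg C f) (Src C f) \<and>
     Cmp C g f = Idn C (Src C f) \<and> Cmp C f g = Idn C (Trg C f)"

definition iso_arrow :: "('o, 'a) smc \<Rightarrow> 'a \<Rightarrow> bool" where
  "iso_arrow C f \<longleftrightarrow> (\<exists>g. inverse_arrows C f g)"

definition inv_arrow :: "('o, 'a) smc \<Rightarrow> 'a \<Rightarrow> 'a" where
  "inv_arrow C f = (THE g. inverse_arrows C f g)"

locale category =
  fixes C :: "('o, 'a) smc" (structure)
  assumes Src_obj: "f \<in> Arr C \<Longrightarrow> Src C f \<in> Obj C"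
    and Trg_obj: "f \<in> Arr C \<Longrightarrow> Trg C f \<in> Obj C"
    and Idn_hom: "x \<in> Obj C \<Longrightarrow> Idn C x \<in> hom_set C x x"
    and Cmp_hom: "f \<in> hom_set C x y \<Longrightarrow> g \<in> hom_set C y z \<Longrightarrow> g \<cdot> f \<in> hom_set C x z"
    and Cmp_Idn_left: "f \<in> hom_set C x y \<Longrightarrow> Idn C y \<cdot> f = f"
    and Cmp_Idn_right: "f \<in> hom_set C x y \<Longrightarrow> f \<cdot> Idn C x = f"
    and Cmp_assoc: "f \<in> hom_set C w x \<Longrightarrow> g \<in> hom_set C x y \<Longrightarrow> h \<in> hom_set C y z \<Longrightarrow>
        h \<cdot> (g \<cdot> f) = (h \<cdot> g) \<cdot> f"

locale sym_mon_cat = category +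
  assumes Unt_obj: "Unt C \<in> Obj C"
    and OTen_obj: "x \<in> Obj C \<Longrightarrow> y \<in> Obj C \<Longrightarrow> x \<otimes> y \<in> Obj C"
    and ATen_hom: "f \<in> hom_set C x x' \<Longrightarrow> g \<in> hom_set C y y' \<Longrightarrow>
        f \<boxtimes> g \<in> hom_set C (x \<otimes> y) (x' \<otimes> y')"
    and ATen_Idn: "x \<in> Obj C \<Longrightarrow> y \<in> Obj C \<Longrightarrow> Idn C x \<boxtimes> Idn C y = Idn C (x \<otimes> y)"
    and ATen_Cmp: "f \<in> hom_set C x y \<Longrightarrow> g \<in> hom_set C y z \<Longrightarrow>
        f' \<in> hom_set C x' y' \<Longrightarrow> g' \<in> hom_set C y' z' \<Longrightarrow>
        (g \<cdot> f) \<boxtimes> (g' \<cdot> f') = (g \<boxtimes> g') \<cdot> (f \<boxtimes> f')"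
    and Ass_hom: "x \<in> Obj C \<Longrightarrow> y \<in> Obj C \<Longrightarrow> z \<in> Obj C \<Longrightarrow>
        Ass C x y z \<in> hom_set C (x \<otimes> (y \<otimes> z)) ((x \<otimes> y) \<otimes> z)"
    and Run_hom: "x \<in> Obj C \<Longrightarrow> Run C x \<in> hom_set C (x \<otimes> Unt C) x"
    and Lun_hom: "x \<in> Obj C \<Longrightarrow> Lun C x \<in> hom_set C (Unt C \<otimes> x) x"
    and Swp_hom: "x \<in> Obj C \<Longrightarrow> y \<in> Obj C \<Longrightarrow> Swp C x y \<in> hom_set C (x \<otimes> y) (y \<otimes> x)"
    and Ass_iso: "x \<in> Obj C \<Longrightarrow> y \<in> Obj C \<Longrightarrow> z \<in> Obj C \<Longrightarrow> iso_arrow C (Ass C x y z)"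
    and Run_iso: "x \<in> Obj C \<Longrightarrow> iso_arrow C (Run C x)"
    and Lun_iso: "x \<in> Obj C \<Longrightarrow> iso_arrow C (Lun C x)"
    and Ass_natural: "f \<in> hom_set C x x' \<Longrightarrow> g \<in> hom_set C y y' \<Longrightarrow> h \<in> hom_set C z z' \<Longrightarrow>
        Ass C x' y' z' \<cdot> (f \<boxtimes> (g \<boxtimes> h)) = ((f \<boxtimes> g) \<boxtimes> h) \<cdot> Ass C x y z"
    and Run_natural: "f \<in> hom_set C x x' \<Longrightarrow> Run C x' \<cdot> (f \<boxtimes> Idn C (Unt C)) = f \<cdot> Run C x"
    and Lun_natural: "f \<in> hom_set C x x' \<Longrightarrow> Lun C x' \<cdot> (Idn C (Unt C) \<boxtimes> f) = f \<cdot> Lun C x"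
    and Swp_natural: "f \<in> hom_set C x x' \<Longrightarrow> g \<in> hom_set C y y' \<Longrightarrow>
        Swp C x' y' \<cdot> (f \<boxtimes> g) = (g \<boxtimes> f) \<cdot> Swp C x y"
    and pentagon: "w \<in> Obj C \<Longrightarrow> x \<in> Obj C \<Longrightarrow> y \<in> Obj C \<Longrightarrow> z \<in> Obj C \<Longrightarrow>
        Ass C (w \<otimes> x) y z \<cdot> Ass C w x (y \<otimes> z) =
        (Ass C w x y \<boxtimes> Idn C z) \<cdot> Ass C w (x \<otimes> y) z \<cdot> (Idn C w \<boxtimes> Ass C x y z)"
    and triangle: "x \<in> Obj C \<Longrightarrow> y \<in> Obj C \<Longrightarrow>
        (Run C x \<boxtimes> Idn C y) \<cdot> Ass C x (Unt C) y = Idn C x \<boxtimes> Lun C y"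
    and Swp_involution: "x \<in> Obj C \<Longrightarrow> y \<in> Obj C \<Longrightarrow> Swp C y x \<cdot> Swp C x y = Idn C (x \<otimes> y)"
    and Swp_unit: "x \<in> Obj C \<Longrightarrow> Lun C x \<cdot> Swp C x (Unt C) = Run C x"
    and hexagon: "x \<in> Obj C \<Longrightarrow> y \<in> Obj C \<Longrightarrow> z \<in> Obj C \<Longrightarrow>
        Ass C z x y \<cdot> Swp C (x \<otimes> y) z \<cdot> Ass C x y z =
        (Swp C x z \<boxtimes> Idn C y) \<cdot> Ass C x z y \<cdot> (Idn C x \<boxtimes> Swp C y z)"

text \<open>The canonical arrow \<open>(w \<otimes> x) \<otimes> (y \<otimes> z) \<rightarrow> (w \<otimes> y) \<otimes> (x \<otimes> z)\<close>.\<close>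

definition interchange :: "('o, 'a) smc \<Rightarrow> 'o \<Rightarrow> 'o \<Rightarrow> 'o \<Rightarrow> 'o \<Rightarrow> 'a" where
  "interchange C w x y z =
     inv_arrow C (Ass C (OTen C w y) x z) \<cdot>\<^bsub>C\<^esub>
     (Ass C w y x \<boxtimes>\<^bsub>C\<^esub> Idn C z) \<cdot>\<^bsub>C\<^esub>
     ((Idn C w \<boxtimes>\<^bsub>C\<^esub> Swp C x y) \<boxtimes>\<^bsub>C\<^esub> Idn C z) \<cdot>\<^bsub>C\<^esub>
     (inv_arrow C (Ass C w x y) \<boxtimes>\<^bsub>C\<^esub> Idn C z) \<cdot>\<^bsub>C\<^esub>
     Ass C (OTen C w x) y z"


section \<open>The 2-category of symmetric monoidal categories\<close>

text \<open>
  All components of a functor and of a transformation are required to be extensional (undefined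
  off the carriers), so that equality of functors and of transformations is equality in HOL.
\<close>

record ('o, 'a, 'p, 'b) smf =
  Fobj :: "'o \<Rightarrow> 'p"
  Farr :: "'a \<Rightarrow> 'b"
  Fzero :: "'b"
  Ftwo :: "'o \<Rightarrow> 'o \<Rightarrow> 'b"

locale sm_functor = A: sym_mon_cat A + B: sym_mon_cat B
  for A :: "('o, 'a) smc" and B :: "('p, 'b) smc" +
  fixes F :: "('o, 'a, 'p, 'b) smf"
  assumes Fobj_type: "Fobj F \<in> Obj A \<rightarrow>\<^sub>E Obj B"
    and Farr_type: "Farr F \<in> Arr A \<rightarrow>\<^sub>E Arr B"
    and Ftwo_type: "Ftwo F \<in> Obj A \<rightarrow>\<^sub>E Obj A \<rightarrow>\<^sub>E Arr B"
    and Farr_hom: "f \<in> hom_set A x y \<Longrightarrow> Farr F f \<in> hom_set B (Fobj F x) (Fobj F y)"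
    and Farr_Idn: "x \<in> Obj A \<Longrightarrow> Farr F (Idn A x) = Idn B (Fobj F x)"
    and Farr_Cmp: "f \<in> hom_set A x y \<Longrightarrow> g \<in> hom_set A y z \<Longrightarrow>
        Farr F (g \<cdot>\<^bsub>A\<^esub> f) = Farr F g \<cdot>\<^bsub>B\<^esub> Farr F f"
    and Fzero_hom: "Fzero F \<in> hom_set B (Unt B) (Fobj F (Unt A))"
    and Ftwo_hom: "x \<in> Obj A \<Longrightarrow> y \<in> Obj A \<Longrightarrow>
        Ftwo F x y \<in> hom_set B (Fobj F x \<otimes>\<^bsub>B\<^esub> Fobj F y) (Fobj F (x \<otimes>\<^bsub>A\<^esub> y))"
    and Ftwo_natural: "f \<in> hom_set A x x' \<Longrightarrow> g \<in> hom_set A y y' \<Longrightarrow>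
        Ftwo F x' y' \<cdot>\<^bsub>B\<^esub> (Farr F f \<boxtimes>\<^bsub>B\<^esub> Farr F g) =
        Farr F (f \<boxtimes>\<^bsub>A\<^esub> g) \<cdot>\<^bsub>B\<^esub> Ftwo F x y"
    and F_assoc: "x \<in> Obj A \<Longrightarrow> y \<in> Obj A \<Longrightarrow> z \<in> Obj A \<Longrightarrow>
        Farr F (Ass A x y z) \<cdot>\<^bsub>B\<^esub> Ftwo F x (y \<otimes>\<^bsub>A\<^esub> z) \<cdot>\<^bsub>B\<^esub>
          (Idn B (Fobj F x) \<boxtimes>\<^bsub>B\<^esub> Ftwo F y z) =
        Ftwo F (x \<otimes>\<^bsub>A\<^esub> y) z \<cdot>\<^bsub>B\<^esub> (Ftwo F x y \<boxtimes>\<^bsub>B\<^esub> Idn B (Fobj F z)) \<cdot>\<^bsub>B\<^esub>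
          Ass B (Fobj F x) (Fobj F y) (Fobj F z)"
    and F_right_unit: "x \<in> Obj A \<Longrightarrow>
        Farr F (Run A x) \<cdot>\<^bsub>B\<^esub> Ftwo F x (Unt A) \<cdot>\<^bsub>B\<^esub> (Idn B (Fobj F x) \<boxtimes>\<^bsub>B\<^esub> Fzero F) =
        Run B (Fobj F x)"
    and F_left_unit: "x \<in> Obj A \<Longrightarrow>
        Farr F (Lun A x) \<cdot>\<^bsub>B\<^esub> Ftwo F (Unt A) x \<cdot>\<^bsub>B\<^esub> (Fzero F \<boxtimes>\<^bsub>B\<^esub> Idn B (Fobj F x)) =
        Lun B (Fobj F x)"
    and F_sym: "x \<in> Obj A \<Longrightarrow> y \<in> Obj A \<Longrightarrow>
        Farr F (Swp A x y) \<cdot>\<^bsub>B\<^esub> Ftwo F x y =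
        Ftwo F y x \<cdot>\<^bsub>B\<^esub> Swp B (Fobj F x) (Fobj F y)"

definition smf_id :: "('o, 'a) smc \<Rightarrow> ('o, 'a, 'o, 'a) smf" where
  "smf_id A = \<lparr>
     Fobj = (\<lambda>x\<in>Obj A. x),
     Farr = (\<lambda>f\<in>Arr A. f),
     Fzero = Idn A (Unt A),
     Ftwo = (\<lambda>x\<in>Obj A. \<lambda>y\<in>Obj A. Idn A (x \<otimes>\<^bsub>A\<^esub> y))\<rparr>"

text \<open>\<open>smf_comp A C G F\<close> is \<open>G\<close> after \<open>F : A \<rightarrow> B\<close>, for \<open>G : B \<rightarrow> C\<close>.\<close>

definition smf_comp ::
  "('o, 'a) smc \<Rightarrow> ('q, 'c) smc \<Rightarrow> ('p, 'b, 'q, 'c) smf \<Rightarrow> ('o, 'a, 'p, 'b) smf \<Rightarrow>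
   ('o, 'a, 'q, 'c) smf" where
  "smf_comp A C G F = \<lparr>
     Fobj = (\<lambda>x\<in>Obj A. Fobj G (Fobj F x)),
     Farr = (\<lambda>f\<in>Arr A. Farr G (Farr F f)),
     Fzero = Farr G (Fzero F) \<cdot>\<^bsub>C\<^esub> Fzero G,
     Ftwo = (\<lambda>x\<in>Obj A. \<lambda>y\<in>Obj A.
       Farr G (Ftwo F x y) \<cdot>\<^bsub>C\<^esub> Ftwo G (Fobj F x) (Fobj F y))\<rparr>"

locale mon_nat = F: sm_functor A B F + G: sm_functor A B G
  for A :: "('o, 'a) smc" and B :: "('p, 'b) smc" and F G +
  fixes \<sigma> :: "'o \<Rightarrow> 'b"
  assumes comp_type: "\<sigma> \<in> Obj A \<rightarrow>\<^sub>E Arr B"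
    and comp_hom: "x \<in> Obj A \<Longrightarrow> \<sigma> x \<in> hom_set B (Fobj F x) (Fobj G x)"
    and natural: "f \<in> hom_set A x y \<Longrightarrow> \<sigma> y \<cdot>\<^bsub>B\<^esub> Farr F f = Farr G f \<cdot>\<^bsub>B\<^esub> \<sigma> x"
    and monoidal_zero: "\<sigma> (Unt A) \<cdot>\<^bsub>B\<^esub> Fzero F = Fzero G"
    and monoidal_two: "x \<in> Obj A \<Longrightarrow> y \<in> Obj A \<Longrightarrow>
        \<sigma> (x \<otimes>\<^bsub>A\<^esub> y) \<cdot>\<^bsub>B\<^esub> Ftwo F x y = Ftwo G x y \<cdot>\<^bsub>B\<^esub> (\<sigma> x \<boxtimes>\<^bsub>B\<^esub> \<sigma> y)"


section \<open>Internal hom\<close>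

record ('o, 'a, 'p, 'b) smt =
  Nsrc :: "('o, 'a, 'p, 'b) smf"
  Ntrg :: "('o, 'a, 'p, 'b) smf"
  Nmap :: "'o \<Rightarrow> 'b"

abbreviation mk_smt ::
  "('o, 'a, 'p, 'b) smf \<Rightarrow> ('o, 'a, 'p, 'b) smf \<Rightarrow> ('o \<Rightarrow> 'b) \<Rightarrow> ('o, 'a, 'p, 'b) smt" where
  "mk_smt F G \<sigma> \<equiv> \<lparr>Nsrc = F, Ntrg = G, Nmap = \<sigma>\<rparr>"

definition box ::
  "('o, 'a) smc \<Rightarrow> ('p, 'b) smc \<Rightarrow> ('o, 'a, 'p, 'b) smf \<Rightarrow> ('o, 'a, 'p, 'b) smf \<Rightarrow>
   ('o, 'a, 'p, 'b) smf" where
  "box A B F G = \<lparr>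
     Fobj = (\<lambda>x\<in>Obj A. Fobj F x \<otimes>\<^bsub>B\<^esub> Fobj G x),
     Farr = (\<lambda>f\<in>Arr A. Farr F f \<boxtimes>\<^bsub>B\<^esub> Farr G f),
     Fzero = (Fzero F \<boxtimes>\<^bsub>B\<^esub> Fzero G) \<cdot>\<^bsub>B\<^esub> inv_arrow B (Run B (Unt B)),
     Ftwo = (\<lambda>x\<in>Obj A. \<lambda>y\<in>Obj A. (Ftwo F x y \<boxtimes>\<^bsub>B\<^esub> Ftwo G x y) \<cdot>\<^bsub>B\<^esub>
       interchange B (Fobj F x) (Fobj G x) (Fobj F y) (Fobj G y))\<rparr>"

definition const_unit :: "('o, 'a) smc \<Rightarrow> ('p, 'b) smc \<Rightarrow> ('o, 'a, 'p, 'b) smf" where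
  "const_unit A B = \<lparr>
     Fobj = (\<lambda>x\<in>Obj A. Unt B),
     Farr = (\<lambda>f\<in>Arr A. Idn B (Unt B)),
     Fzero = Idn B (Unt B),
     Ftwo = (\<lambda>x\<in>Obj A. \<lambda>y\<in>Obj A. Run B (Unt B))\<rparr>"

definition hom_smc ::
  "('o, 'a) smc \<Rightarrow> ('p, 'b) smc \<Rightarrow> (('o, 'a, 'p, 'b) smf, ('o, 'a, 'p, 'b) smt) smc" where
  "hom_smc A B = \<lparr>
     Obj = {F. sm_functor A B F},
     Arr = {mk_smt F G \<sigma> | F G \<sigma>. mon_nat A B F G \<sigma>},
     Src = Nsrc,
     Trg = Ntrg,
     Idn = (\<lambda>F. mk_smt F F (\<lambda>x\<in>Obj A. Idn B (Fobj F x))),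
     Cmp = (\<lambda>\<tau> \<sigma>. mk_smt (Nsrc \<sigma>) (Ntrg \<tau>) (\<lambda>x\<in>Obj A. Nmap \<tau> x \<cdot>\<^bsub>B\<^esub> Nmap \<sigma> x)),
     OTen = box A B,
     ATen = (\<lambda>\<sigma> \<tau>. mk_smt (box A B (Nsrc \<sigma>) (Nsrc \<tau>)) (box A B (Ntrg \<sigma>) (Ntrg \<tau>))
       (\<lambda>x\<in>Obj A. Nmap \<sigma> x \<boxtimes>\<^bsub>B\<^esub> Nmap \<tau> x)),
     Unt = const_unit A B,
     Ass = (\<lambda>F G H. mk_smt (box A B F (box A B G H)) (box A B (box A B F G) H)
       (\<lambda>x\<in>Obj A. Ass B (Fobj F x) (Fobj G x) (Fobj H x))),
     Run = (\<lambda>F. mk_smt (box A B F (const_unit A B)) F (\<lambda>x\<in>Obj A. Run B (Fobj F x))),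
     Lun = (\<lambda>F. mk_smt (box A B (const_unit A B) F) F (\<lambda>x\<in>Obj A. Lun B (Fobj F x))),
     Swp = (\<lambda>F G. mk_smt (box A B F G) (box A B G F)
       (\<lambda>x\<in>Obj A. Swp B (Fobj F x) (Fobj G x)))\<rparr>"

definition ev_at ::
  "('o, 'a) smc \<Rightarrow> ('p, 'b) smc \<Rightarrow> 'o \<Rightarrow>
   (('o, 'a, 'p, 'b) smf, ('o, 'a, 'p, 'b) smt, 'p, 'b) smf" where
  "ev_at A B a = \<lparr>
     Fobj = (\<lambda>F\<in>Obj (hom_smc A B). Fobj F a),
     Farr = (\<lambda>\<sigma>\<in>Arr (hom_smc A B). Nmap \<sigma> a),
     Fzero = Idn B (Unt B),
     Ftwo = (\<lambda>F\<in>Obj (hom_smc A B). \<lambda>G\<in>Obj (hom_smc A B).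
       Idn B (Fobj F a \<otimes>\<^bsub>B\<^esub> Fobj G a))\<rparr>"

text \<open>\<open>dual_obj A B F b\<close> is the symmetric monoidal functor \<open>F\<^sup>*(b) : A \<rightarrow> C\<close>.\<close>

definition dual_obj ::
  "('o, 'a) smc \<Rightarrow> ('p, 'b) smc \<Rightarrow>
   ('o, 'a, ('p, 'b, 'q, 'c) smf, ('p, 'b, 'q, 'c) smt) smf \<Rightarrow> 'p \<Rightarrow> ('o, 'a, 'q, 'c) smf" where
  "dual_obj A B F b = \<lparr>
     Fobj = (\<lambda>a\<in>Obj A. Fobj (Fobj F a) b),
     Farr = (\<lambda>f\<in>Arr A. Nmap (Farr F f) b),
     Fzero = Nmap (Fzero F) b,
     Ftwo = (\<lambda>a\<in>Obj A. \<lambda>a'\<in>Obj A. Nmap (Ftwo F a a') b)\<rparr>"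

definition dual ::
  "('o, 'a) smc \<Rightarrow> ('p, 'b) smc \<Rightarrow> ('q, 'c) smc \<Rightarrow>
   ('o, 'a, ('p, 'b, 'q, 'c) smf, ('p, 'b, 'q, 'c) smt) smf \<Rightarrow>
   ('p, 'b, ('o, 'a, 'q, 'c) smf, ('o, 'a, 'q, 'c) smt) smf" where
  "dual A B C F = \<lparr>
     Fobj = (\<lambda>b\<in>Obj B. dual_obj A B F b),
     Farr = (\<lambda>g\<in>Arr B. mk_smt (dual_obj A B F (Src B g)) (dual_obj A B F (Trg B g))
       (\<lambda>a\<in>Obj A. Farr (Fobj F a) g)),
     Fzero = mk_smt (const_unit A C) (dual_obj A B F (Unt B))
       (\<lambda>a\<in>Obj A. Fzero (Fobj F a)),
     Ftwo = (\<lambda>b\<in>Obj B. \<lambda>b'\<in>Obj B.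
       mk_smt (box A C (dual_obj A B F b) (dual_obj A B F b')) (dual_obj A B F (b \<otimes>\<^bsub>B\<^esub> b'))
         (\<lambda>a\<in>Obj A. Ftwo (Fobj F a) b b'))\<rparr>"


section \<open>Symmetric monoidal categories presented by generators and relations\<close>

text \<open>
  Both the tensor product and the free symmetric monoidal category on one object are instances of
  the following: objects are the words freely generated by the letters in \<open>gobj\<close>, arrows are
  classes of terms freely generated by canonical arrows and the generators in \<open>garr\<close>, modulo the
  smallest congruence containing the laws of symmetric monoidal categories and given relations.
\<close>

datatype 'g word = WUnit | WGen 'g | WTen "'g word" "'g word"

record ('g, 'e) signature =
  gobj :: "'g set"
  garr :: "'e set"
  gsrc :: "'e \<Rightarrow> 'g word"
  gtrg :: "'e \<Rightarrow> 'g word"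

text \<open>\<open>TLeft X p\<close> is \<open>X \<otimes> p\<close> and \<open>TRight p X\<close> is \<open>p \<otimes> X\<close>; \<open>TCmp q p\<close> is \<open>q\<close> after \<open>p\<close>.\<close>

datatype ('g, 'e) trm =
    TGen 'e
  | TId "'g word"
  | TCmp "('g, 'e) trm" "('g, 'e) trm"
  | TLeft "'g word" "('g, 'e) trm"
  | TRight "('g, 'e) trm" "'g word"
  | TAss "'g word" "'g word" "'g word"
  | TAssInv "'g word" "'g word" "'g word"
  | TRun "'g word"
  | TRunInv "'g word"
  | TLun "'g word"
  | TLunInv "'g word"
  | TSwp "'g word" "'g word"

definition words :: "('g, 'e) signature \<Rightarrow> 'g word set" where
  "words S = {X. set_word X \<subseteq> gobj S}"

primrec tsrc :: "('g, 'e) signature \<Rightarrow> ('g, 'e) trm \<Rightarrow> 'g word" where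
  "tsrc S (TGen e) = gsrc S e"
| "tsrc S (TId X) = X"
| "tsrc S (TCmp q p) = tsrc S p"
| "tsrc S (TLeft X p) = WTen X (tsrc S p)"
| "tsrc S (TRight p X) = WTen (tsrc S p) X"
| "tsrc S (TAss X Y Z) = WTen X (WTen Y Z)"
| "tsrc S (TAssInv X Y Z) = WTen (WTen X Y) Z"
| "tsrc S (TRun X) = WTen X WUnit"
| "tsrc S (TRunInv X) = X"
| "tsrc S (TLun X) = WTen WUnit X"
| "tsrc S (TLunInv X) = X"
| "tsrc S (TSwp X Y) = WTen X Y"

primrec ttrg :: "('g, 'e) signature \<Rightarrow> ('g, 'e) trm \<Rightarrow> 'g word" where
  "ttrg S (TGen e) = gtrg S e"
| "ttrg S (TId X) = X"
| "ttrg S (TCmp q p) = ttrg S q"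
| "ttrg S (TLeft X p) = WTen X (ttrg S p)"
| "ttrg S (TRight p X) = WTen (ttrg S p) X"
| "ttrg S (TAss X Y Z) = WTen (WTen X Y) Z"
| "ttrg S (TAssInv X Y Z) = WTen X (WTen Y Z)"
| "ttrg S (TRun X) = X"
| "ttrg S (TRunInv X) = WTen X WUnit"
| "ttrg S (TLun X) = X"
| "ttrg S (TLunInv X) = WTen WUnit X"
| "ttrg S (TSwp X Y) = WTen Y X"

primrec wf_trm :: "('g, 'e) signature \<Rightarrow> ('g, 'e) trm \<Rightarrow> bool" where
  "wf_trm S (TGen e) \<longleftrightarrow> e \<in> garr S"
| "wf_trm S (TId X) \<longleftrightarrow> X \<in> words S"
| "wf_trm S (TCmp q p) \<longleftrightarrow> wf_trm S q \<and> wf_trm S p \<and> tsrc S q = ttrg S p"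
| "wf_trm S (TLeft X p) \<longleftrightarrow> X \<in> words S \<and> wf_trm S p"
| "wf_trm S (TRight p X) \<longleftrightarrow> wf_trm S p \<and> X \<in> words S"
| "wf_trm S (TAss X Y Z) \<longleftrightarrow> X \<in> words S \<and> Y \<in> words S \<and> Z \<in> words S"
| "wf_trm S (TAssInv X Y Z) \<longleftrightarrow> X \<in> words S \<and> Y \<in> words S \<and> Z \<in> words S"
| "wf_trm S (TRun X) \<longleftrightarrow> X \<in> words S"
| "wf_trm S (TRunInv X) \<longleftrightarrow> X \<in> words S"
| "wf_trm S (TLun X) \<longleftrightarrow> X \<in> words S"
| "wf_trm S (TLunInv X) \<longleftrightarrow> X \<in> words S"
| "wf_trm S (TSwp X Y) \<longleftrightarrow> X \<in> words S \<and> Y \<in> words S"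

text \<open>The tensor \<open>p \<otimes> q\<close> of two arrows, as \<open>(X' \<otimes> q) \<circ> (p \<otimes> Y)\<close> for \<open>p : X \<rightarrow> X'\<close>, \<open>q : Y \<rightarrow> Y'\<close>.\<close>

definition tten :: "('g, 'e) signature \<Rightarrow> ('g, 'e) trm \<Rightarrow> ('g, 'e) trm \<Rightarrow> ('g, 'e) trm" where
  "tten S p q = TCmp (TLeft (ttrg S p) q) (TRight p (tsrc S q))"

definition tinterchange :: "'g word \<Rightarrow> 'g word \<Rightarrow> 'g word \<Rightarrow> 'g word \<Rightarrow> ('g, 'e) trm" where
  "tinterchange W X Y Z =
     TCmp (TAssInv (WTen W Y) X Z)
       (TCmp (TRight (TAss W Y X) Z)
         (TCmp (TRight (TLeft W (TSwp X Y)) Z)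
           (TCmp (TRight (TAssInv W X Y) Z) (TAss (WTen W X) Y Z))))"

inductive cong ::
  "('g, 'e) signature \<Rightarrow> (('g, 'e) trm \<times> ('g, 'e) trm) set \<Rightarrow> ('g, 'e) trm \<Rightarrow> ('g, 'e) trm \<Rightarrow> bool"
  for S R where
  rel: "(p, q) \<in> R \<Longrightarrow> cong S R p q"
| refl: "wf_trm S p \<Longrightarrow> cong S R p p"
| sym: "cong S R p q \<Longrightarrow> cong S R q p"
| trans: "cong S R p q \<Longrightarrow> cong S R q r \<Longrightarrow> cong S R p r"
| comp: "cong S R p p' \<Longrightarrow> cong S R q q' \<Longrightarrow> wf_trm S (TCmp q p) \<Longrightarrow>
    cong S R (TCmp q p) (TCmp q' p')"
| left: "cong S R p p' \<Longrightarrow> X \<in> words S \<Longrightarrow> cong S R (TLeft X p) (TLeft X p')"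
| right: "cong S R p p' \<Longrightarrow> X \<in> words S \<Longrightarrow> cong S R (TRight p X) (TRight p' X)"
| id_left: "wf_trm S p \<Longrightarrow> cong S R (TCmp (TId (ttrg S p)) p) p"
| id_right: "wf_trm S p \<Longrightarrow> cong S R (TCmp p (TId (tsrc S p))) p"
| assoc: "wf_trm S (TCmp r (TCmp q p)) \<Longrightarrow> cong S R (TCmp r (TCmp q p)) (TCmp (TCmp r q) p)"
| left_id: "X \<in> words S \<Longrightarrow> Y \<in> words S \<Longrightarrow> cong S R (TLeft X (TId Y)) (TId (WTen X Y))"
| right_id: "X \<in> words S \<Longrightarrow> Y \<in> words S \<Longrightarrow> cong S R (TRight (TId X) Y) (TId (WTen X Y))"
| left_comp: "wf_trm S (TCmp q p) \<Longrightarrow> X \<in> words S \<Longrightarrow>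
    cong S R (TLeft X (TCmp q p)) (TCmp (TLeft X q) (TLeft X p))"
| right_comp: "wf_trm S (TCmp q p) \<Longrightarrow> X \<in> words S \<Longrightarrow>
    cong S R (TRight (TCmp q p) X) (TCmp (TRight q X) (TRight p X))"
| bifunctor: "wf_trm S p \<Longrightarrow> wf_trm S q \<Longrightarrow>
    cong S R (TCmp (TLeft (ttrg S p) q) (TRight p (tsrc S q)))
             (TCmp (TRight p (ttrg S q)) (TLeft (tsrc S p) q))"
| ass_inv_left: "X \<in> words S \<Longrightarrow> Y \<in> words S \<Longrightarrow> Z \<in> words S \<Longrightarrow>
    cong S R (TCmp (TAssInv X Y Z) (TAss X Y Z)) (TId (WTen X (WTen Y Z)))"
| ass_inv_right: "X \<in> words S \<Longrightarrow> Y \<in> words S \<Longrightarrow> Z \<in> words S \<Longrightarrow>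
    cong S R (TCmp (TAss X Y Z) (TAssInv X Y Z)) (TId (WTen (WTen X Y) Z))"
| run_inv_left: "X \<in> words S \<Longrightarrow> cong S R (TCmp (TRunInv X) (TRun X)) (TId (WTen X WUnit))"
| run_inv_right: "X \<in> words S \<Longrightarrow> cong S R (TCmp (TRun X) (TRunInv X)) (TId X)"
| lun_inv_left: "X \<in> words S \<Longrightarrow> cong S R (TCmp (TLunInv X) (TLun X)) (TId (WTen WUnit X))"
| lun_inv_right: "X \<in> words S \<Longrightarrow> cong S R (TCmp (TLun X) (TLunInv X)) (TId X)"
| ass_natural: "wf_trm S p \<Longrightarrow> wf_trm S q \<Longrightarrow> wf_trm S r \<Longrightarrow>
    cong S R (TCmp (TAss (ttrg S p) (ttrg S q) (ttrg S r)) (tten S p (tten S q r)))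
             (TCmp (tten S (tten S p q) r) (TAss (tsrc S p) (tsrc S q) (tsrc S r)))"
| run_natural: "wf_trm S p \<Longrightarrow>
    cong S R (TCmp (TRun (ttrg S p)) (TRight p WUnit)) (TCmp p (TRun (tsrc S p)))"
| lun_natural: "wf_trm S p \<Longrightarrow>
    cong S R (TCmp (TLun (ttrg S p)) (TLeft WUnit p)) (TCmp p (TLun (tsrc S p)))"
| swp_natural: "wf_trm S p \<Longrightarrow> wf_trm S q \<Longrightarrow>
    cong S R (TCmp (TSwp (ttrg S p) (ttrg S q)) (tten S p q))
             (TCmp (tten S q p) (TSwp (tsrc S p) (tsrc S q)))"
| pentagon: "W \<in> words S \<Longrightarrow> X \<in> words S \<Longrightarrow> Y \<in> words S \<Longrightarrow> Z \<in> words S \<Longrightarrow>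
    cong S R (TCmp (TAss (WTen W X) Y Z) (TAss W X (WTen Y Z)))
             (TCmp (TRight (TAss W X Y) Z)
               (TCmp (TAss W (WTen X Y) Z) (TLeft W (TAss X Y Z))))"
| triangle: "X \<in> words S \<Longrightarrow> Y \<in> words S \<Longrightarrow>
    cong S R (TCmp (TRight (TRun X) Y) (TAss X WUnit Y)) (TLeft X (TLun Y))"
| swp_involution: "X \<in> words S \<Longrightarrow> Y \<in> words S \<Longrightarrow>
    cong S R (TCmp (TSwp Y X) (TSwp X Y)) (TId (WTen X Y))"
| swp_unit: "X \<in> words S \<Longrightarrow> cong S R (TCmp (TLun X) (TSwp X WUnit)) (TRun X)"
| hexagon: "X \<in> words S \<Longrightarrow> Y \<in> words S \<Longrightarrow> Z \<in> words S \<Longrightarrow>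
    cong S R (TCmp (TAss Z X Y) (TCmp (TSwp (WTen X Y) Z) (TAss X Y Z)))
             (TCmp (TRight (TSwp X Z) Y) (TCmp (TAss X Z Y) (TLeft X (TSwp Y Z))))"

definition cls ::
  "('g, 'e) signature \<Rightarrow> (('g, 'e) trm \<times> ('g, 'e) trm) set \<Rightarrow> ('g, 'e) trm \<Rightarrow> ('g, 'e) trm set" where
  "cls S R p = {q. cong S R p q}"

definition presented ::
  "('g, 'e) signature \<Rightarrow> (('g, 'e) trm \<times> ('g, 'e) trm) set \<Rightarrow> ('g word, ('g, 'e) trm set) smc" where
  "presented S R = \<lparr>
     Obj = words S,
     Arr = cls S R ` {p. wf_trm S p},
     Src = (\<lambda>c. the_elem (tsrc S ` c)),
     Trg = (\<lambda>c. the_elem (ttrg S ` c)),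
     Idn = (\<lambda>X. cls S R (TId X)),
     Cmp = (\<lambda>d c. \<Union>q\<in>d. \<Union>p\<in>c. cls S R (TCmp q p)),
     OTen = WTen,
     ATen = (\<lambda>c d. \<Union>p\<in>c. \<Union>q\<in>d. cls S R (tten S p q)),
     Unt = WUnit,
     Ass = (\<lambda>X Y Z. cls S R (TAss X Y Z)),
     Run = (\<lambda>X. cls S R (TRun X)),
     Lun = (\<lambda>X. cls S R (TLun X)),
     Swp = (\<lambda>X Y. cls S R (TSwp X Y))\<rparr>"

text \<open>
  The strict symmetric monoidal functor \<open>presented S R \<rightarrow> C\<close> determined by the images \<open>go\<close> of the
  letters and \<open>ga\<close> of the generating arrows. The use of \<^term>\<open>the_elem\<close> is meaningful when \<open>ga\<close>
  respects the relations \<open>R\<close>: then all representatives of a class have the same value.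
\<close>

primrec word_val :: "('o, 'a) smc \<Rightarrow> ('g \<Rightarrow> 'o) \<Rightarrow> 'g word \<Rightarrow> 'o" where
  "word_val C go WUnit = Unt C"
| "word_val C go (WGen x) = go x"
| "word_val C go (WTen X Y) = OTen C (word_val C go X) (word_val C go Y)"

primrec trm_val ::
  "('o, 'a) smc \<Rightarrow> ('g \<Rightarrow> 'o) \<Rightarrow> ('e \<Rightarrow> 'a) \<Rightarrow> ('g, 'e) trm \<Rightarrow> 'a" where
  "trm_val C go ga (TGen e) = ga e"
| "trm_val C go ga (TId X) = Idn C (word_val C go X)"
| "trm_val C go ga (TCmp q p) = Cmp C (trm_val C go ga q) (trm_val C go ga p)"
| "trm_val C go ga (TLeft X p) = ATen C (Idn C (word_val C go X)) (trm_val C go ga p)"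
| "trm_val C go ga (TRight p X) = ATen C (trm_val C go ga p) (Idn C (word_val C go X))"
| "trm_val C go ga (TAss X Y Z) = Ass C (word_val C go X) (word_val C go Y) (word_val C go Z)"
| "trm_val C go ga (TAssInv X Y Z) =
     inv_arrow C (Ass C (word_val C go X) (word_val C go Y) (word_val C go Z))"
| "trm_val C go ga (TRun X) = Run C (word_val C go X)"
| "trm_val C go ga (TRunInv X) = inv_arrow C (Run C (word_val C go X))"
| "trm_val C go ga (TLun X) = Lun C (word_val C go X)"
| "trm_val C go ga (TLunInv X) = inv_arrow C (Lun C (word_val C go X))"
| "trm_val C go ga (TSwp X Y) = Swp C (word_val C go X) (word_val C go Y)"

definition strict_ext ::
  "('g, 'e) signature \<Rightarrow> (('g, 'e) trm \<times> ('g, 'e) trm) set \<Rightarrow> ('o, 'a) smc \<Rightarrow>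
   ('g \<Rightarrow> 'o) \<Rightarrow> ('e \<Rightarrow> 'a) \<Rightarrow> ('g word, ('g, 'e) trm set, 'o, 'a) smf" where
  "strict_ext S R C go ga = \<lparr>
     Fobj = (\<lambda>X\<in>words S. word_val C go X),
     Farr = (\<lambda>c\<in>Arr (presented S R). the_elem (trm_val C go ga ` c)),
     Fzero = Idn C (Unt C),
     Ftwo = (\<lambda>X\<in>words S. \<lambda>Y\<in>words S. Idn C (word_val C go X \<otimes>\<^bsub>C\<^esub> word_val C go Y))\<rparr>"

text \<open>
  \<open>functor_rels S D F\<close> are the equations between terms over \<open>S\<close> saying that the data \<open>F\<close>, whose
  arrow components are terms, is a symmetric monoidal functor on \<open>D\<close>; likewise \<open>nat_rels\<close> for
  monoidal natural transformations. They transcribe \<^const>\<open>sm_functor\<close> and \<^const>\<open>mon_nat\<close>.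
\<close>

definition functor_rels ::
  "('g, 'e) signature \<Rightarrow> ('o, 'a) smc \<Rightarrow> ('o, 'a, 'g word, ('g, 'e) trm) smf \<Rightarrow>
   (('g, 'e) trm \<times> ('g, 'e) trm) set" where
  "functor_rels S D F =
     {(Farr F (Idn D x), TId (Fobj F x)) | x. x \<in> Obj D}
   \<union> {(Farr F (g \<cdot>\<^bsub>D\<^esub> f), TCmp (Farr F g) (Farr F f)) | f g.
        f \<in> Arr D \<and> g \<in> Arr D \<and> Src D g = Trg D f}
   \<union> {(TCmp (Ftwo F (Trg D f) (Trg D g)) (tten S (Farr F f) (Farr F g)),
       TCmp (Farr F (f \<boxtimes>\<^bsub>D\<^esub> g)) (Ftwo F (Src D f) (Src D g))) | f g.
        f \<in> Arr D \<and> g \<in> Arr D}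
   \<union> {(TCmp (Farr F (Ass D x y z))
         (TCmp (Ftwo F x (y \<otimes>\<^bsub>D\<^esub> z)) (TLeft (Fobj F x) (Ftwo F y z))),
       TCmp (Ftwo F (x \<otimes>\<^bsub>D\<^esub> y) z)
         (TCmp (TRight (Ftwo F x y) (Fobj F z)) (TAss (Fobj F x) (Fobj F y) (Fobj F z)))) | x y z.
        x \<in> Obj D \<and> y \<in> Obj D \<and> z \<in> Obj D}
   \<union> {(TCmp (Farr F (Run D x)) (TCmp (Ftwo F x (Unt D)) (TLeft (Fobj F x) (Fzero F))),
       TRun (Fobj F x)) | x. x \<in> Obj D}
   \<union> {(TCmp (Farr F (Lun D x)) (TCmp (Ftwo F (Unt D) x) (TRight (Fzero F) (Fobj F x))),
       TLun (Fobj F x)) | x. x \<in> Obj D}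
   \<union> {(TCmp (Farr F (Swp D x y)) (Ftwo F x y),
       TCmp (Ftwo F y x) (TSwp (Fobj F x) (Fobj F y))) | x y. x \<in> Obj D \<and> y \<in> Obj D}"

definition nat_rels ::
  "('g, 'e) signature \<Rightarrow> ('o, 'a) smc \<Rightarrow> ('o, 'a, 'g word, ('g, 'e) trm) smf \<Rightarrow>
   ('o, 'a, 'g word, ('g, 'e) trm) smf \<Rightarrow> ('o \<Rightarrow> ('g, 'e) trm) \<Rightarrow>
   (('g, 'e) trm \<times> ('g, 'e) trm) set" where
  "nat_rels S D F G \<sigma> =
     {(TCmp (\<sigma> (Trg D f)) (Farr F f), TCmp (Farr G f) (\<sigma> (Src D f))) | f. f \<in> Arr D}
   \<union> {(TCmp (\<sigma> (Unt D)) (Fzero F), Fzero G)}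
   \<union> {(TCmp (\<sigma> (x \<otimes>\<^bsub>D\<^esub> y)) (Ftwo F x y), TCmp (Ftwo G x y) (tten S (\<sigma> x) (\<sigma> y))) | x y.
        x \<in> Obj D \<and> y \<in> Obj D}"


section \<open>Tensor product\<close>

text \<open>
  The letter \<open>a \<otimes> b\<close> is the pair \<open>(a, b)\<close>; the generating arrow \<open>f \<otimes> b\<close> is \<open>ArrL f b\<close>, and
  \<open>a \<otimes> g\<close> is \<open>ArrR a g\<close>.
\<close>

datatype ('o, 'a, 'p, 'b) tgen =
    Alpha 'p
  | Beta 'o
  | Gamma 'o 'o 'p
  | Delta 'o 'p 'p
  | ArrL 'a 'p
  | ArrR 'o 'b

primrec tgen_src :: "('o, 'a) smc \<Rightarrow> ('p, 'b) smc \<Rightarrow> ('o, 'a, 'p, 'b) tgen \<Rightarrow> ('o \<times> 'p) word" where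
  "tgen_src A B (Alpha b) = WUnit"
| "tgen_src A B (Beta a) = WUnit"
| "tgen_src A B (Gamma a a' b) = WTen (WGen (a, b)) (WGen (a', b))"
| "tgen_src A B (Delta a b b') = WTen (WGen (a, b)) (WGen (a, b'))"
| "tgen_src A B (ArrL f b) = WGen (Src A f, b)"
| "tgen_src A B (ArrR a g) = WGen (a, Src B g)"

primrec tgen_trg :: "('o, 'a) smc \<Rightarrow> ('p, 'b) smc \<Rightarrow> ('o, 'a, 'p, 'b) tgen \<Rightarrow> ('o \<times> 'p) word" where
  "tgen_trg A B (Alpha b) = WGen (Unt A, b)"
| "tgen_trg A B (Beta a) = WGen (a, Unt B)"
| "tgen_trg A B (Gamma a a' b) = WGen (a \<otimes>\<^bsub>A\<^esub> a', b)"
| "tgen_trg A B (Delta a b b') = WGen (a, b \<otimes>\<^bsub>B\<^esub> b')"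
| "tgen_trg A B (ArrL f b) = WGen (Trg A f, b)"
| "tgen_trg A B (ArrR a g) = WGen (a, Trg B g)"

definition tensor_sig ::
  "('o, 'a) smc \<Rightarrow> ('p, 'b) smc \<Rightarrow> ('o \<times> 'p, ('o, 'a, 'p, 'b) tgen) signature" where
  "tensor_sig A B = \<lparr>
     gobj = Obj A \<times> Obj B,
     garr = {Alpha b | b. b \<in> Obj B} \<union> {Beta a | a. a \<in> Obj A}
       \<union> {Gamma a a' b | a a' b. a \<in> Obj A \<and> a' \<in> Obj A \<and> b \<in> Obj B}
       \<union> {Delta a b b' | a b b'. a \<in> Obj A \<and> b \<in> Obj B \<and> b' \<in> Obj B}
       \<union> {ArrL f b | f b. f \<in> Arr A \<and> b \<in> Obj B}
       \<union> {ArrR a g | a g. a \<in> Obj A \<and> g \<in> Arr B},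
     gsrc = tgen_src A B,
     gtrg = tgen_trg A B\<rparr>"

text \<open>\<open>formal_left a\<close> is \<open>a \<otimes> -\<close> and \<open>formal_right b\<close> is \<open>- \<otimes> b\<close>.\<close>

definition formal_left :: "'o \<Rightarrow> ('p, 'b, ('o \<times> 'p) word, ('o \<times> 'p, ('o, 'a, 'p, 'b) tgen) trm) smf" where
  "formal_left a = \<lparr>
     Fobj = (\<lambda>b. WGen (a, b)),
     Farr = (\<lambda>g. TGen (ArrR a g)),
     Fzero = TGen (Beta a),
     Ftwo = (\<lambda>b b'. TGen (Delta a b b'))\<rparr>"

definition formal_right :: "'p \<Rightarrow> ('o, 'a, ('o \<times> 'p) word, ('o \<times> 'p, ('o, 'a, 'p, 'b) tgen) trm) smf" where
  "formal_right b = \<lparr>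
     Fobj = (\<lambda>a. WGen (a, b)),
     Farr = (\<lambda>f. TGen (ArrL f b)),
     Fzero = TGen (Alpha b),
     Ftwo = (\<lambda>a a'. TGen (Gamma a a' b))\<rparr>"

definition tensor_rels ::
  "('o, 'a) smc \<Rightarrow> ('p, 'b) smc \<Rightarrow>
   (('o \<times> 'p, ('o, 'a, 'p, 'b) tgen) trm \<times> ('o \<times> 'p, ('o, 'a, 'p, 'b) tgen) trm) set" where
  "tensor_rels A B = (let S = tensor_sig A B in
     (\<Union>a\<in>Obj A. functor_rels S B (formal_left a))
   \<union> (\<Union>b\<in>Obj B. functor_rels S A (formal_right b))
   \<union> (\<Union>f\<in>Arr A. nat_rels S B (formal_left (Src A f)) (formal_left (Trg A f))
        (\<lambda>b. TGen (ArrL f b)))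
   \<union> (\<Union>g\<in>Arr B. nat_rels S A (formal_right (Src B g)) (formal_right (Trg B g))
        (\<lambda>a. TGen (ArrR a g)))
   \<union> {(TCmp (TGen (Alpha (b \<otimes>\<^bsub>B\<^esub> b'))) (TRun WUnit),
       TCmp (TGen (Delta (Unt A) b b')) (tten S (TGen (Alpha b)) (TGen (Alpha b')))) | b b'.
        b \<in> Obj B \<and> b' \<in> Obj B}
   \<union> {(TCmp (TGen (Beta (a \<otimes>\<^bsub>A\<^esub> a'))) (TRun WUnit),
       TCmp (TGen (Gamma a a' (Unt B))) (tten S (TGen (Beta a)) (TGen (Beta a')))) | a a'.
        a \<in> Obj A \<and> a' \<in> Obj A}
   \<union> {(TGen (Beta (Unt A)), TGen (Alpha (Unt B)))}
   \<union> {(TCmp (TGen (Gamma a a' (b \<otimes>\<^bsub>B\<^esub> b')))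
         (tten S (TGen (Delta a b b')) (TGen (Delta a' b b'))),
       TCmp (TGen (Delta (a \<otimes>\<^bsub>A\<^esub> a') b b'))
         (TCmp (tten S (TGen (Gamma a a' b)) (TGen (Gamma a a' b')))
           (tinterchange (WGen (a, b)) (WGen (a, b')) (WGen (a', b)) (WGen (a', b'))))) | a a' b b'.
        a \<in> Obj A \<and> a' \<in> Obj A \<and> b \<in> Obj B \<and> b' \<in> Obj B})"

type_synonym ('o, 'a, 'p, 'b) tensor_arr = "('o \<times> 'p, ('o, 'a, 'p, 'b) tgen) trm set"

definition tensor_smc ::
  "('o, 'a) smc \<Rightarrow> ('p, 'b) smc \<Rightarrow> (('o \<times> 'p) word, ('o, 'a, 'p, 'b) tensor_arr) smc" where
  "tensor_smc A B = presented (tensor_sig A B) (tensor_rels A B)"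

abbreviation tensor_gen ::
  "('o, 'a) smc \<Rightarrow> ('p, 'b) smc \<Rightarrow> ('o, 'a, 'p, 'b) tgen \<Rightarrow> ('o, 'a, 'p, 'b) tensor_arr" where
  "tensor_gen A B e \<equiv> cls (tensor_sig A B) (tensor_rels A B) (TGen e)"

definition eta_obj ::
  "('o, 'a) smc \<Rightarrow> ('p, 'b) smc \<Rightarrow> 'o \<Rightarrow>
   ('p, 'b, ('o \<times> 'p) word, ('o, 'a, 'p, 'b) tensor_arr) smf" where
  "eta_obj A B a = \<lparr>
     Fobj = (\<lambda>b\<in>Obj B. WGen (a, b)),
     Farr = (\<lambda>g\<in>Arr B. tensor_gen A B (ArrR a g)),
     Fzero = tensor_gen A B (Beta a),
     Ftwo = (\<lambda>b\<in>Obj B. \<lambda>b'\<in>Obj B. tensor_gen A B (Delta a b b'))\<rparr>"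

definition eta ::
  "('o, 'a) smc \<Rightarrow> ('p, 'b) smc \<Rightarrow>
   ('o, 'a, ('p, 'b, ('o \<times> 'p) word, ('o, 'a, 'p, 'b) tensor_arr) smf,
            ('p, 'b, ('o \<times> 'p) word, ('o, 'a, 'p, 'b) tensor_arr) smt) smf" where
  "eta A B = \<lparr>
     Fobj = (\<lambda>a\<in>Obj A. eta_obj A B a),
     Farr = (\<lambda>f\<in>Arr A. mk_smt (eta_obj A B (Src A f)) (eta_obj A B (Trg A f))
       (\<lambda>b\<in>Obj B. tensor_gen A B (ArrL f b))),
     Fzero = mk_smt (const_unit B (tensor_smc A B)) (eta_obj A B (Unt A))
       (\<lambda>b\<in>Obj B. tensor_gen A B (Alpha b)),
     Ftwo = (\<lambda>a\<in>Obj A. \<lambda>a'\<in>Obj A.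
       mk_smt (box B (tensor_smc A B) (eta_obj A B a) (eta_obj A B a')) (eta_obj A B (a \<otimes>\<^bsub>A\<^esub> a'))
         (\<lambda>b\<in>Obj B. tensor_gen A B (Gamma a a' b)))\<rparr>"

primrec en_gen ::
  "('o, 'a, ('p, 'b, 'q, 'c) smf, ('p, 'b, 'q, 'c) smt) smf \<Rightarrow> ('o, 'a, 'p, 'b) tgen \<Rightarrow> 'c" where
  "en_gen F (Alpha b) = Nmap (Fzero F) b"
| "en_gen F (Beta a) = Fzero (Fobj F a)"
| "en_gen F (Gamma a a' b) = Nmap (Ftwo F a a') b"
| "en_gen F (Delta a b b') = Ftwo (Fobj F a) b b'"
| "en_gen F (ArrL f b) = Nmap (Farr F f) b"
| "en_gen F (ArrR a g) = Farr (Fobj F a) g"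

definition En ::
  "('o, 'a) smc \<Rightarrow> ('p, 'b) smc \<Rightarrow> ('q, 'c) smc \<Rightarrow>
   ('o, 'a, ('p, 'b, 'q, 'c) smf, ('p, 'b, 'q, 'c) smt) smf \<Rightarrow>
   (('o \<times> 'p) word, ('o, 'a, 'p, 'b) tensor_arr, 'q, 'c) smf" where
  "En A B C F =
     strict_ext (tensor_sig A B) (tensor_rels A B) C (\<lambda>(a, b). Fobj (Fobj F a) b) (en_gen F)"


section \<open>The unit and the canonical arrows\<close>

text \<open>One letter, no generating arrows (so the type of generators is immaterial), no relations.\<close>

definition unit_sig :: "(unit, unit) signature" where
  "unit_sig = \<lparr>gobj = {()}, garr = {}, gsrc = (\<lambda>_. WUnit), gtrg = (\<lambda>_. WUnit)\<rparr>"

type_synonym unit_arr = "(unit, unit) trm set"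

definition unit_smc :: "(unit word, unit_arr) smc" where
  "unit_smc = presented unit_sig {}"

definition star :: "unit word" where
  "star = WGen ()"

definition strict_at :: "('o, 'a) smc \<Rightarrow> 'o \<Rightarrow> (unit word, unit_arr, 'o, 'a) smf" where
  "strict_at X x = strict_ext unit_sig {} X (\<lambda>_. x) (\<lambda>_. undefined)"

definition v_can ::
  "('o, 'a) smc \<Rightarrow> (unit word, unit_arr, ('o, 'a, 'o, 'a) smf, ('o, 'a, 'o, 'a) smt) smf" where
  "v_can A = strict_at (hom_smc A A) (smf_id A)"

definition R_can ::
  "('o, 'a) smc \<Rightarrow> (('o \<times> unit word) word, ('o, 'a, unit word, unit_arr) tensor_arr, 'o, 'a) smf" where
  "R_can A = En A unit_smc A (dual unit_smc A A (v_can A))"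

definition R'_can ::
  "('o, 'a) smc \<Rightarrow> ('o, 'a, ('o \<times> unit word) word, ('o, 'a, unit word, unit_arr) tensor_arr) smf" where
  "R'_can A =
     smf_comp A (tensor_smc A unit_smc) (ev_at unit_smc (tensor_smc A unit_smc) star) (eta A unit_smc)"

end

theory Submission
  imports Defs
begin

text \<open>
  Write \<open>T\<close> for the tensor product of \<open>A\<close> with the unit and \<open>\<eta>\<^sup>*\<close> for the dual of \<open>\<eta>\<close>, so that
  \<open>R' = \<eta>\<^sup>*(\<star>)\<close>. The 1-cell \<open>F\<close> is \<open>En(w\<^sup>*)\<close>, where \<open>w\<close> is the strict functor from the unit to \<open>[A, T]\<close>
  with \<open>w(\<star>) = R'\<close>. Let \<open>H : T \<rightarrow> T\<close> be any symmetric monoidal functor with \<open>H \<circ> R' = R'\<close>. Then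
  \<open>X \<mapsto> H \<circ> \<eta>\<^sup>*(X)\<close> is a lax functor taking the same value as \<open>w\<close> at \<open>\<star>\<close>; as the unit is free on \<open>\<star>\<close>,
  there is a 2-cell from \<open>w\<close> to it, and its components define a 2-cell \<open>F \<rightarrow> H\<close> on the letters of \<open>T\<close>.
  Since \<open>R \<circ> R' = 1\<close>, both \<open>H = 1\<close> and \<open>H = R' \<circ> R\<close> qualify.

  That \<open>[A, B]\<close> is a symmetric monoidal category at all requires many equations between canonical
  arrows. They are instances of Mac Lane's coherence theorem: every word with distinct letters has a
  canonical isomorphism to a normal form that depends only on its letters, and all canonical arrows
  are compatible with these isomorphisms because merging of lists is associative and commutative.
\<close>

section \<open>Calculus of arrows\<close>

text \<open>Both 2-cells start at a strict functor. \<open>En\<close> produces strict functors,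
  whereas R' is lax; from a strict functor to a lax functor H with the same values on letters there
  is a comparison assembled from H^0 and H^2, and these need not be invertible. So the argument
  yields no 2-cell between 1 and R' o R, but a span whose apex is the strict F. Duality is needed
  because the two universal properties live on different sides: the unit I is free for functors I
  \<rightarrow> [A, T], while \<open>En\<close> takes functors A \<rightarrow> [I, T]. The
  naturality checks divide in the same way: of the six kinds of generating arrows of a tensor
  product, three are governed by monoidal naturality in the first variable and three by monoidal
  naturality in the second. Treating an arbitrary H settles 1 and R' o R at once. The price is that
  H o - must itself be a lax functor between internal homs; the main point there is that H^2 is
  compatible with the interchange of the two middle factors of a fourfold tensor.\<close>

lemma hom_set_iff: "f \<in> hom_set C x y \<longleftrightarrow> f \<in> Arr C \<and> Src C f = x \<and> Trg C f = y"
  by (simp add: hom_set_def)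

context category
begin

declare Src_obj [simp] Trg_obj [simp]

lemma Idn_simps [simp]:
  assumes "x \<in> Obj C"
  shows "Idn C x \<in> Arr C" "Src C (Idn C x) = x" "Trg C (Idn C x) = x"
  using Idn_hom[OF assms] by (auto simp: hom_set_iff)

lemma Cmp_simps [simp]:
  assumes "f \<in> Arr C" "g \<in> Arr C" "Src C g = Trg C f"
  shows "g \<cdot> f \<in> Arr C" "Src C (g \<cdot> f) = Src C f" "Trg C (g \<cdot> f) = Trg C g"
  using Cmp_hom[of f "Src C f" "Trg C f" g "Trg C g"] assms by (auto simp: hom_set_iff)

lemma Idn_Cmp [simp]: "f \<in> Arr C \<Longrightarrow> Trg C f = y \<Longrightarrow> Idn C y \<cdot> f = f"
  using Cmp_Idn_left by (auto simp: hom_set_iff)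

lemma Cmp_Idn [simp]: "f \<in> Arr C \<Longrightarrow> Src C f = x \<Longrightarrow> f \<cdot> Idn C x = f"
  using Cmp_Idn_right by (auto simp: hom_set_iff)

lemma comp_assoc:
  assumes "f \<in> Arr C" "g \<in> Arr C" "h \<in> Arr C" "Src C g = Trg C f" "Src C h = Trg C g"
  shows "(h \<cdot> g) \<cdot> f = h \<cdot> (g \<cdot> f)"
  using Cmp_assoc[of f "Src C f" "Trg C f" g "Trg C g" h "Trg C h"] assms
  by (auto simp: hom_set_iff)

text \<open>Composites are normalised to the right by \<open>comp_assoc\<close>, so a known equation
  for \<open>a \<cdot> b\<close> no longer matches inside a longer composite. This form applies it
  in front of a tail \<open>k\<close>.\<close>

lemma reassoc:
  assumes "a \<cdot> b = c" "k \<in> Arr C" "b \<in> Arr C" "a \<in> Arr C" "Src C b = Trg C k" "Src C a = Trg C b"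
  shows "a \<cdot> (b \<cdot> k) = c \<cdot> k"
  using comp_assoc[of k b a] assms by simp

lemma inverse_arrows_unique:
  assumes "inverse_arrows C f g" "inverse_arrows C f h"
  shows "g = h"
proof -
  have "g = (h \<cdot> f) \<cdot> g"
    using assms by (simp add: inverse_arrows_def hom_set_iff)
  also have "\<dots> = h \<cdot> (f \<cdot> g)"
    using assms by (subst comp_assoc) (auto simp: inverse_arrows_def hom_set_iff)
  also have "\<dots> = h"
    using assms by (simp add: inverse_arrows_def hom_set_iff)
  finally show ?thesis .
qed

lemma inv_arrowI: "inverse_arrows C f g \<Longrightarrow> inv_arrow C f = g"
  unfolding inv_arrow_def using inverse_arrows_unique by blast

lemma inverse_inv_arrow: "iso_arrow C f \<Longrightarrow> inverse_arrows C f (inv_arrow C f)"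
  using inv_arrowI by (auto simp: iso_arrow_def)

lemma iso_arrow_in_Arr: "iso_arrow C f \<Longrightarrow> f \<in> Arr C"
  by (auto simp: iso_arrow_def inverse_arrows_def)

lemma inv_arrow_simps [simp]:
  assumes "iso_arrow C f"
  shows "inv_arrow C f \<in> Arr C" "Src C (inv_arrow C f) = Trg C f" "Trg C (inv_arrow C f) = Src C f"
    "inv_arrow C f \<cdot> f = Idn C (Src C f)" "f \<cdot> inv_arrow C f = Idn C (Trg C f)"
  using inverse_inv_arrow[OF assms] by (auto simp: inverse_arrows_def hom_set_iff)

lemma inv_arrow_cancel [simp]:
  assumes "iso_arrow C f" "k \<in> Arr C"
  shows "Trg C k = Src C f \<Longrightarrow> inv_arrow C f \<cdot> (f \<cdot> k) = k"
    "Trg C k = Trg C f \<Longrightarrow> f \<cdot> (inv_arrow C f \<cdot> k) = k"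
  using assms by (simp_all add: iso_arrow_in_Arr flip: comp_assoc)

lemma iso_mono:
  assumes "a \<cdot> f = a \<cdot> g" "iso_arrow C a" "f \<in> Arr C" "g \<in> Arr C" "Trg C f = Src C a" "Trg C g = Src C a"
  shows "f = g"
  using arg_cong[OF assms(1), of "\<lambda>h. inv_arrow C a \<cdot> h"] assms(2-) by simp

lemma iso_epi:
  assumes "f \<cdot> a = g \<cdot> a" "iso_arrow C a" "f \<in> Arr C" "g \<in> Arr C" "Src C f = Trg C a" "Src C g = Trg C a"
  shows "f = g"
  using arg_cong[OF assms(1), of "\<lambda>h. h \<cdot> inv_arrow C a"] assms(2-)
  by (simp add: comp_assoc iso_arrow_in_Arr)

lemma iso_Idn [simp]: "x \<in> Obj C \<Longrightarrow> iso_arrow C (Idn C x)"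
  by (auto simp: iso_arrow_def inverse_arrows_def hom_set_iff intro!: exI[of _ "Idn C x"])

lemma iso_inv_arrow [simp]: "iso_arrow C f \<Longrightarrow> iso_arrow C (inv_arrow C f)"
  by (auto simp: iso_arrow_def[of C "inv_arrow C f"] inverse_arrows_def hom_set_iff iso_arrow_in_Arr
      intro!: exI[of _ f])

lemma inverse_Cmp:
  assumes "iso_arrow C f" "iso_arrow C g" "Src C g = Trg C f"
  shows "inverse_arrows C (g \<cdot> f) (inv_arrow C f \<cdot> inv_arrow C g)"
  using assms by (simp add: inverse_arrows_def hom_set_iff comp_assoc iso_arrow_in_Arr)

lemma iso_Cmp [simp]: "iso_arrow C f \<Longrightarrow> iso_arrow C g \<Longrightarrow> Src C g = Trg C f \<Longrightarrow> iso_arrow C (g \<cdot> f)"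
  using inverse_Cmp by (auto simp: iso_arrow_def)

text \<open>Two opposite sides of a commuting square are inverted; naturality of inverse arrows is
  obtained in this way.\<close>

lemma inv_conj:
  assumes "iso_arrow C a" "iso_arrow C b" "b \<cdot> f = g \<cdot> a" "f \<in> Arr C" "g \<in> Arr C"
    "Src C f = Src C a" "Trg C f = Src C b" "Src C g = Trg C a" "Trg C g = Trg C b"
  shows "inv_arrow C b \<cdot> g = f \<cdot> inv_arrow C a"
  by (rule iso_mono[of b])
    (use assms in \<open>simp_all add: iso_arrow_in_Arr reassoc[OF assms(3)] comp_assoc\<close>)

end

section \<open>Tensor of arrows, and the unit laws that follow from pentagon and triangle\<close>

context sym_mon_cat
begin

declare Unt_obj [simp] OTen_obj [simp] Ass_iso [simp] Run_iso [simp] Lun_iso [simp]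

lemma ATen_simps [simp]:
  assumes "f \<in> Arr C" "g \<in> Arr C"
  shows "f \<boxtimes> g \<in> Arr C" "Src C (f \<boxtimes> g) = Src C f \<otimes> Src C g" "Trg C (f \<boxtimes> g) = Trg C f \<otimes> Trg C g"
  using ATen_hom[of f "Src C f" "Trg C f" g "Src C g" "Trg C g"] assms by (auto simp: hom_set_iff)

lemma Ass_simps [simp]:
  assumes "x \<in> Obj C" "y \<in> Obj C" "z \<in> Obj C"
  shows "Ass C x y z \<in> Arr C" "Src C (Ass C x y z) = x \<otimes> (y \<otimes> z)"
    "Trg C (Ass C x y z) = (x \<otimes> y) \<otimes> z"
  using Ass_hom[OF assms] by (auto simp: hom_set_iff)

lemma Run_simps [simp]:
  assumes "x \<in> Obj C"
  shows "Run C x \<in> Arr C" "Src C (Run C x) = x \<otimes> Unt C" "Trg C (Run C x) = x"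
  using Run_hom[OF assms] by (auto simp: hom_set_iff)

lemma Lun_simps [simp]:
  assumes "x \<in> Obj C"
  shows "Lun C x \<in> Arr C" "Src C (Lun C x) = Unt C \<otimes> x" "Trg C (Lun C x) = x"
  using Lun_hom[OF assms] by (auto simp: hom_set_iff)

lemma Swp_simps [simp]:
  assumes "x \<in> Obj C" "y \<in> Obj C"
  shows "Swp C x y \<in> Arr C" "Src C (Swp C x y) = x \<otimes> y" "Trg C (Swp C x y) = y \<otimes> x"
  using Swp_hom[OF assms] by (auto simp: hom_set_iff)

declare ATen_Idn [simp] Swp_involution [simp]

lemma Swp_iso [simp]: "x \<in> Obj C \<Longrightarrow> y \<in> Obj C \<Longrightarrow> iso_arrow C (Swp C x y)"
  by (auto simp: iso_arrow_def inverse_arrows_def hom_set_iff intro!: exI[of _ "Swp C y x"])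

text \<open>Oriented against \<open>ATen_Cmp\<close>: simp collects composites inside the tensor
  factors, where each factor can then be rewritten separately.\<close>

lemma ten_comp:
  assumes "f \<in> Arr C" "g \<in> Arr C" "f' \<in> Arr C" "g' \<in> Arr C" "Src C g = Trg C f" "Src C g' = Trg C f'"
  shows "(g \<boxtimes> g') \<cdot> (f \<boxtimes> f') = (g \<cdot> f) \<boxtimes> (g' \<cdot> f')"
  using ATen_Cmp[of f "Src C f" "Trg C f" g "Trg C g" f' "Src C f'" "Trg C f'" g' "Trg C g'"] assms
  by (simp add: hom_set_iff)

lemma ten_comp2:
  assumes "f \<in> Arr C" "g \<in> Arr C" "f' \<in> Arr C" "g' \<in> Arr C" "Src C g = Trg C f" "Src C g' = Trg C f'"
    "k \<in> Arr C" "Trg C k = Src C f \<otimes> Src C f'"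
  shows "(g \<boxtimes> g') \<cdot> ((f \<boxtimes> f') \<cdot> k) = ((g \<cdot> f) \<boxtimes> (g' \<cdot> f')) \<cdot> k"
  by (rule reassoc[OF ten_comp]) (use assms in auto)

lemma inverse_ATen:
  assumes "iso_arrow C f" "iso_arrow C g"
  shows "inverse_arrows C (f \<boxtimes> g) (inv_arrow C f \<boxtimes> inv_arrow C g)"
  using assms by (simp add: inverse_arrows_def hom_set_iff ten_comp iso_arrow_in_Arr)

lemma iso_ATen [simp]: "iso_arrow C f \<Longrightarrow> iso_arrow C g \<Longrightarrow> iso_arrow C (f \<boxtimes> g)"
  using inverse_ATen by (auto simp: iso_arrow_def)

lemma inv_arrow_ATen [simp]:
  "iso_arrow C f \<Longrightarrow> iso_arrow C g \<Longrightarrow> inv_arrow C (f \<boxtimes> g) = inv_arrow C f \<boxtimes> inv_arrow C g"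
  using inverse_ATen by (auto intro: inv_arrowI)

lemma Ass_nat:
  assumes "f \<in> Arr C" "g \<in> Arr C" "h \<in> Arr C"
    "Trg C f = x" "Trg C g = y" "Trg C h = z"
  shows "Ass C x y z \<cdot> (f \<boxtimes> (g \<boxtimes> h)) = ((f \<boxtimes> g) \<boxtimes> h) \<cdot> Ass C (Src C f) (Src C g) (Src C h)"
  using Ass_natural[of f "Src C f" x g "Src C g" y h "Src C h" z] assms by (simp add: hom_set_iff)

lemma Ass_nat_inv:
  assumes "f \<in> Arr C" "g \<in> Arr C" "h \<in> Arr C"
    "Trg C f = x" "Trg C g = y" "Trg C h = z"
  shows "inv_arrow C (Ass C x y z) \<cdot> ((f \<boxtimes> g) \<boxtimes> h) =
    (f \<boxtimes> (g \<boxtimes> h)) \<cdot> inv_arrow C (Ass C (Src C f) (Src C g) (Src C h))"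
  by (rule inv_conj) (use assms in \<open>auto simp: Ass_nat\<close>)

lemma Run_nat:
  assumes "f \<in> Arr C" "Trg C f = x"
  shows "Run C x \<cdot> (f \<boxtimes> Idn C (Unt C)) = f \<cdot> Run C (Src C f)"
  using Run_natural[of f "Src C f" x] assms by (simp add: hom_set_iff)

lemma Lun_nat:
  assumes "f \<in> Arr C" "Trg C f = x"
  shows "Lun C x \<cdot> (Idn C (Unt C) \<boxtimes> f) = f \<cdot> Lun C (Src C f)"
  using Lun_natural[of f "Src C f" x] assms by (simp add: hom_set_iff)

lemma Swp_nat:
  assumes "f \<in> Arr C" "g \<in> Arr C" "Trg C f = x" "Trg C g = y"
  shows "Swp C x y \<cdot> (f \<boxtimes> g) = (g \<boxtimes> f) \<cdot> Swp C (Src C f) (Src C g)"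
  using Swp_natural[of f "Src C f" x g "Src C g" y] assms by (simp add: hom_set_iff)

text \<open>Tensoring with the unit is naturally isomorphic to the identity functor through
  \<open>Lun\<close>, so it loses nothing.\<close>

lemma unit_ten_faithful:
  assumes "Idn C (Unt C) \<boxtimes> f = Idn C (Unt C) \<boxtimes> g" "f \<in> Arr C" "g \<in> Arr C"
    "Src C f = Src C g" "Trg C f = Trg C g"
  shows "f = g"
  by (rule iso_epi[where a = "Lun C (Src C f)"])
    (use assms Lun_nat[of f "Trg C f"] Lun_nat[of g "Trg C g"] in auto)

lemma ten_unit_faithful:
  assumes "f \<boxtimes> Idn C (Unt C) = g \<boxtimes> Idn C (Unt C)" "f \<in> Arr C" "g \<in> Arr C"
    "Src C f = Src C g" "Trg C f = Trg C g"
  shows "f = g"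
  by (rule iso_epi[where a = "Run C (Src C f)"])
    (use assms Run_nat[of f "Trg C f"] Run_nat[of g "Trg C g"] in auto)

lemma pentagon_right:
  assumes "w \<in> Obj C" "x \<in> Obj C" "y \<in> Obj C" "z \<in> Obj C"
  shows "Ass C (w \<otimes> x) y z \<cdot> Ass C w x (y \<otimes> z) =
    (Ass C w x y \<boxtimes> Idn C z) \<cdot> (Ass C w (x \<otimes> y) z \<cdot> (Idn C w \<boxtimes> Ass C x y z))"
  using pentagon[OF assms] assms by (simp add: comp_assoc)

lemma hexagon_right:
  assumes "x \<in> Obj C" "y \<in> Obj C" "z \<in> Obj C"
  shows "Ass C z x y \<cdot> (Swp C (x \<otimes> y) z \<cdot> Ass C x y z) =
        (Swp C x z \<boxtimes> Idn C y) \<cdot> (Ass C x z y \<cdot> (Idn C x \<boxtimes> Swp C y z))"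
  using hexagon[OF assms] assms by (simp add: comp_assoc)

text \<open>Kelly's argument: it suffices to compare after tensoring with the unit on the left, and
  there the pentagon for two units, y and z, together with two instances of the triangle, forces the
  equation.\<close>

lemma Lun_ten:
  assumes y: "y \<in> Obj C" and z: "z \<in> Obj C"
  shows "(Lun C y \<boxtimes> Idn C z) \<cdot> Ass C (Unt C) y z = Lun C (y \<otimes> z)" (is "?l = ?r")
proof (rule unit_ten_faithful)
  let ?I = "Unt C"
  note [simp] = y z
  show "Idn C ?I \<boxtimes> ?l = Idn C ?I \<boxtimes> ?r"
  proof (rule iso_mono[of "Ass C ?I y z"])
    have "Ass C ?I y z \<cdot> (Idn C ?I \<boxtimes> ?l) =
        Ass C ?I y z \<cdot> ((Idn C ?I \<boxtimes> (Lun C y \<boxtimes> Idn C z)) \<cdot> (Idn C ?I \<boxtimes> Ass C ?I y z))"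
      by (simp add: ten_comp)
    also have "\<dots> = ((Idn C ?I \<boxtimes> Lun C y) \<boxtimes> Idn C z) \<cdot>
        (Ass C ?I (?I \<otimes> y) z \<cdot> (Idn C ?I \<boxtimes> Ass C ?I y z))"
      by (simp add: Ass_nat reassoc[OF Ass_nat] comp_assoc)
    also have "\<dots> = ((Run C ?I \<boxtimes> Idn C y) \<boxtimes> Idn C z) \<cdot> ((Ass C ?I ?I y \<boxtimes> Idn C z) \<cdot>
        (Ass C ?I (?I \<otimes> y) z \<cdot> (Idn C ?I \<boxtimes> Ass C ?I y z)))"
      by (simp add: ten_comp2 triangle)
    also have "\<dots> = ((Run C ?I \<boxtimes> Idn C y) \<boxtimes> Idn C z) \<cdot>
        (Ass C (?I \<otimes> ?I) y z \<cdot> Ass C ?I ?I (y \<otimes> z))"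
      by (simp add: pentagon_right)
    also have "\<dots> = Ass C ?I y z \<cdot> ((Run C ?I \<boxtimes> Idn C (y \<otimes> z)) \<cdot> Ass C ?I ?I (y \<otimes> z))"
      using Ass_nat[of "Run C ?I" "Idn C y" "Idn C z" ?I y z]
      by (simp flip: comp_assoc)
    also have "\<dots> = Ass C ?I y z \<cdot> (Idn C ?I \<boxtimes> ?r)"
      by (simp add: triangle)
    finally show "Ass C ?I y z \<cdot> (Idn C ?I \<boxtimes> ?l) = Ass C ?I y z \<cdot> (Idn C ?I \<boxtimes> ?r)" .
  qed simp_all
qed (use assms in simp_all)

text \<open>Mirror image of \<open>Lun_ten\<close>, with the pentagon for x, y and two
  units.\<close>

lemma Run_ten:
  assumes x: "x \<in> Obj C" and y: "y \<in> Obj C"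
  shows "Run C (x \<otimes> y) \<cdot> Ass C x y (Unt C) = Idn C x \<boxtimes> Run C y" (is "?l = ?r")
proof (rule ten_unit_faithful)
  let ?I = "Unt C"
  note [simp] = x y
  show "?l \<boxtimes> Idn C ?I = ?r \<boxtimes> Idn C ?I"
  proof (rule iso_epi[of _ "Ass C x (y \<otimes> ?I) ?I \<cdot> (Idn C x \<boxtimes> Ass C y ?I ?I)"])
    have "(?l \<boxtimes> Idn C ?I) \<cdot> (Ass C x (y \<otimes> ?I) ?I \<cdot> (Idn C x \<boxtimes> Ass C y ?I ?I)) =
      (Run C (x \<otimes> y) \<boxtimes> Idn C ?I) \<cdot> ((Ass C x y ?I \<boxtimes> Idn C ?I) \<cdot>
        (Ass C x (y \<otimes> ?I) ?I \<cdot> (Idn C x \<boxtimes> Ass C y ?I ?I)))"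
      by (simp add: ten_comp2)
    also have "\<dots> = (Run C (x \<otimes> y) \<boxtimes> Idn C ?I) \<cdot> (Ass C (x \<otimes> y) ?I ?I \<cdot> Ass C x y (?I \<otimes> ?I))"
      by (simp add: pentagon_right)
    also have "\<dots> = (Idn C (x \<otimes> y) \<boxtimes> Lun C ?I) \<cdot> Ass C x y (?I \<otimes> ?I)"
      by (simp add: triangle flip: comp_assoc)
    also have "\<dots> = Ass C x y ?I \<cdot> (Idn C x \<boxtimes> (Idn C y \<boxtimes> Lun C ?I))"
      using Ass_nat[of "Idn C x" "Idn C y" "Lun C ?I" x y ?I] by simp
    also have "\<dots> = Ass C x y ?I \<cdot> ((Idn C x \<boxtimes> (Run C y \<boxtimes> Idn C ?I)) \<cdot> (Idn C x \<boxtimes> Ass C y ?I ?I))"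
      by (simp add: ten_comp triangle)
    also have "\<dots> = (?r \<boxtimes> Idn C ?I) \<cdot> (Ass C x (y \<otimes> ?I) ?I \<cdot> (Idn C x \<boxtimes> Ass C y ?I ?I))"
      by (simp add: reassoc[OF Ass_nat] comp_assoc)
    finally show "(?l \<boxtimes> Idn C ?I) \<cdot> (Ass C x (y \<otimes> ?I) ?I \<cdot> (Idn C x \<boxtimes> Ass C y ?I ?I)) =
      (?r \<boxtimes> Idn C ?I) \<cdot> (Ass C x (y \<otimes> ?I) ?I \<cdot> (Idn C x \<boxtimes> Ass C y ?I ?I))" .
  qed simp_all
qed (use assms in simp_all)

text \<open>After tensoring with the unit and precomposing with the associator, one side is
  described by \<open>Lun_ten\<close> and the other by the triangle.\<close>

lemma Lun_Unt: "Lun C (Unt C) = Run C (Unt C)"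
proof (rule ten_unit_faithful)
  let ?I = "Unt C"
  \<comment> \<open>Naturality of \<open>Lun\<close> along \<open>Lun\<close> itself, with the outer
    copy cancelled.\<close>
  have "Lun C (?I \<otimes> ?I) = Idn C ?I \<boxtimes> Lun C ?I"
    by (rule iso_mono[of "Lun C ?I"]) (simp_all add: Lun_nat)
  then have "(Lun C ?I \<boxtimes> Idn C ?I) \<cdot> Ass C ?I ?I ?I = (Run C ?I \<boxtimes> Idn C ?I) \<cdot> Ass C ?I ?I ?I"
    by (simp add: Lun_ten triangle)
  then show "Lun C ?I \<boxtimes> Idn C ?I = Run C ?I \<boxtimes> Idn C ?I"
    by (rule iso_epi) simp_all
qed simp_all

lemma Run_Swp: "x \<in> Obj C \<Longrightarrow> Run C x \<cdot> Swp C (Unt C) x = Lun C x"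
  using reassoc[OF Swp_unit, of x "Swp C (Unt C) x"] by simp

end

section \<open>Coherence\<close>

text \<open>The canonical arrow a \<otimes> (y \<otimes> b) \<rightarrow> y \<otimes> (a \<otimes>
  b). It is one step of a merge whose next letter y heads the right-hand list: y is pulled in front
  of the value a of the whole left-hand list.\<close>

definition pull :: "('o, 'a) smc \<Rightarrow> 'o \<Rightarrow> 'o \<Rightarrow> 'o \<Rightarrow> 'a" where
  "pull C a y b =
     inv_arrow C (Ass C y a b) \<cdot>\<^bsub>C\<^esub> ((Swp C a y \<boxtimes>\<^bsub>C\<^esub> Idn C b) \<cdot>\<^bsub>C\<^esub> Ass C a y b)"

context sym_mon_cat
begin

lemma pull_simps [simp]:
  assumes "a \<in> Obj C" "y \<in> Obj C" "b \<in> Obj C"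
  shows "pull C a y b \<in> Arr C" "Src C (pull C a y b) = a \<otimes> (y \<otimes> b)"
    "Trg C (pull C a y b) = y \<otimes> (a \<otimes> b)" "iso_arrow C (pull C a y b)"
  using assms by (simp_all add: pull_def)

text \<open>The object y stays fixed because it will be a single letter, while a and b are values of
  lists that are rearranged further.\<close>

lemma pull_nat:
  assumes "f \<in> Arr C" "g \<in> Arr C" "Trg C f = a" "Trg C g = b" "y \<in> Obj C"
  shows "pull C a y b \<cdot> (f \<boxtimes> (Idn C y \<boxtimes> g)) = (Idn C y \<boxtimes> (f \<boxtimes> g)) \<cdot> pull C (Src C f) y (Src C g)"
proof -
  note [simp] = assms(1,2,5) assms(3,4)[symmetric]
  have "((Swp C a y \<boxtimes> Idn C b) \<cdot> Ass C a y b) \<cdot> (f \<boxtimes> (Idn C y \<boxtimes> g)) =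
      (Swp C a y \<boxtimes> Idn C b) \<cdot> (((f \<boxtimes> Idn C y) \<boxtimes> g) \<cdot> Ass C (Src C f) y (Src C g))"
    by (simp add: comp_assoc Ass_nat)
  also have "\<dots> = ((Idn C y \<boxtimes> f) \<boxtimes> g) \<cdot> ((Swp C (Src C f) y \<boxtimes> Idn C (Src C g)) \<cdot> Ass C (Src C f) y (Src C g))"
    by (simp add: ten_comp2 Swp_nat)
  finally have *: "((Swp C a y \<boxtimes> Idn C b) \<cdot> Ass C a y b) \<cdot> (f \<boxtimes> (Idn C y \<boxtimes> g)) = \<dots>" .
  have "pull C a y b \<cdot> (f \<boxtimes> (Idn C y \<boxtimes> g)) =
      inv_arrow C (Ass C y a b) \<cdot> (((Swp C a y \<boxtimes> Idn C b) \<cdot> Ass C a y b) \<cdot> (f \<boxtimes> (Idn C y \<boxtimes> g)))"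
    by (simp add: pull_def comp_assoc)
  also have "\<dots> = (Idn C y \<boxtimes> (f \<boxtimes> g)) \<cdot> pull C (Src C f) y (Src C g)"
    unfolding * by (simp add: pull_def comp_assoc reassoc[OF Ass_nat_inv])
  finally show ?thesis .
qed

lemma Ass_pull:
  assumes "a \<in> Obj C" "y \<in> Obj C" "b \<in> Obj C"
  shows "Ass C y a b \<cdot> pull C a y b = (Swp C a y \<boxtimes> Idn C b) \<cdot> Ass C a y b"
  using assms by (simp add: pull_def)

lemma pentagon_inv:
  assumes [simp]: "w \<in> Obj C" "x \<in> Obj C" "y \<in> Obj C" "z \<in> Obj C"
  shows "Ass C w (x \<otimes> y) z \<cdot> (Idn C w \<boxtimes> Ass C x y z) =
    (inv_arrow C (Ass C w x y) \<boxtimes> Idn C z) \<cdot> (Ass C (w \<otimes> x) y z \<cdot> Ass C w x (y \<otimes> z))"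
  by (simp add: pentagon_right ten_comp2)

text \<open>The coherence behind associativity of merging when the middle list supplies the first
  letter. After composing with an associator, both sides become the exchange of a and y next to b
  and c, by two uses of the pentagon.\<close>

lemma Ass_pull_middle:
  assumes [simp]: "a \<in> Obj C" "y \<in> Obj C" "b \<in> Obj C" "c \<in> Obj C"
  shows "inv_arrow C (Ass C y (a \<otimes> b) c) \<cdot> ((pull C a y b \<boxtimes> Idn C c) \<cdot> Ass C a (y \<otimes> b) c) =
    (Idn C y \<boxtimes> Ass C a b c) \<cdot> (pull C a y (b \<otimes> c) \<cdot> (Idn C a \<boxtimes> inv_arrow C (Ass C y b c)))"
    (is "?l = ?r")
proof (rule iso_mono[of "Ass C y (a \<otimes> b) c"])
  let ?i = "inv_arrow C (Ass C y a b) \<boxtimes> Idn C c" and ?j = "Idn C a \<boxtimes> inv_arrow C (Ass C y b c)"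
  have "Ass C y (a \<otimes> b) c \<cdot> ?r =
     ?i \<cdot> (Ass C (y \<otimes> a) b c \<cdot> (Ass C y a (b \<otimes> c) \<cdot> (pull C a y (b \<otimes> c) \<cdot> ?j)))"
    by (simp add: reassoc[OF pentagon_inv] comp_assoc)
  also have "\<dots> = ?i \<cdot> (Ass C (y \<otimes> a) b c \<cdot> ((Swp C a y \<boxtimes> Idn C (b \<otimes> c)) \<cdot> (Ass C a y (b \<otimes> c) \<cdot> ?j)))"
    by (simp add: reassoc[OF Ass_pull] comp_assoc)
  also have "\<dots> = ?i \<cdot> (((Swp C a y \<boxtimes> Idn C b) \<boxtimes> Idn C c) \<cdot> (Ass C (a \<otimes> y) b c \<cdot> (Ass C a y (b \<otimes> c) \<cdot> ?j)))"
    using Ass_nat[of "Swp C a y" "Idn C b" "Idn C c" "y \<otimes> a" b c, THEN reassoc]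
    by (simp add: comp_assoc)
  also have "\<dots> = ?i \<cdot> (((Swp C a y \<boxtimes> Idn C b) \<boxtimes> Idn C c) \<cdot> ((Ass C a y b \<boxtimes> Idn C c) \<cdot> Ass C a (y \<otimes> b) c))"
    by (simp add: reassoc[OF pentagon_right] comp_assoc ten_comp)
  also have "\<dots> = (pull C a y b \<boxtimes> Idn C c) \<cdot> Ass C a (y \<otimes> b) c"
    by (simp add: pull_def ten_comp2)
  finally show "Ass C y (a \<otimes> b) c \<cdot> ?l = Ass C y (a \<otimes> b) c \<cdot> ?r"
    by simp
qed simp_all

text \<open>The counterpart for a first letter supplied by the last list. Pulling z past a \<otimes>
  b is pulling it past b and then past a: this is the hexagon, surrounded by pentagons.\<close>

lemma Ass_pull_right:
  assumes [simp]: "a \<in> Obj C" "b \<in> Obj C" "z \<in> Obj C" "c \<in> Obj C"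
  shows "pull C (a \<otimes> b) z c \<cdot> Ass C a b (z \<otimes> c) =
    (Idn C z \<boxtimes> Ass C a b c) \<cdot> (pull C a z (b \<otimes> c) \<cdot> (Idn C a \<boxtimes> pull C b z c))"
    (is "?l = ?r")
proof (rule iso_mono[of "Ass C z (a \<otimes> b) c"])
  let ?i = "inv_arrow C (Ass C z a b) \<boxtimes> Idn C c" and ?j = "Idn C a \<boxtimes> pull C b z c"
  have "Ass C z (a \<otimes> b) c \<cdot> ?r =
     ?i \<cdot> (Ass C (z \<otimes> a) b c \<cdot> (Ass C z a (b \<otimes> c) \<cdot> (pull C a z (b \<otimes> c) \<cdot> ?j)))"
    by (simp add: reassoc[OF pentagon_inv] comp_assoc)
  also have "\<dots> = ?i \<cdot> (Ass C (z \<otimes> a) b c \<cdot> ((Swp C a z \<boxtimes> Idn C (b \<otimes> c)) \<cdot> (Ass C a z (b \<otimes> c) \<cdot> ?j)))"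
    by (simp add: reassoc[OF Ass_pull] comp_assoc)
  also have "\<dots> = ?i \<cdot> (((Swp C a z \<boxtimes> Idn C b) \<boxtimes> Idn C c) \<cdot> (Ass C (a \<otimes> z) b c \<cdot> (Ass C a z (b \<otimes> c) \<cdot> ?j)))"
    using Ass_nat[of "Swp C a z" "Idn C b" "Idn C c" "z \<otimes> a" b c, THEN reassoc]
    by (simp add: comp_assoc)
  also have "\<dots> = ?i \<cdot> (((Swp C a z \<boxtimes> Idn C b) \<boxtimes> Idn C c) \<cdot> ((Ass C a z b \<boxtimes> Idn C c) \<cdot>
      (Ass C a (z \<otimes> b) c \<cdot> (Idn C a \<boxtimes> (Ass C z b c \<cdot> pull C b z c)))))"
    by (simp add: reassoc[OF pentagon_right] comp_assoc ten_comp)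
  also have "\<dots> = ?i \<cdot> (((Swp C a z \<boxtimes> Idn C b) \<boxtimes> Idn C c) \<cdot> ((Ass C a z b \<boxtimes> Idn C c) \<cdot>
      (Ass C a (z \<otimes> b) c \<cdot> ((Idn C a \<boxtimes> (Swp C b z \<boxtimes> Idn C c)) \<cdot> (Idn C a \<boxtimes> Ass C b z c)))))"
    by (simp add: Ass_pull ten_comp)
  also have "\<dots> = ?i \<cdot> (((Swp C a z \<boxtimes> Idn C b) \<boxtimes> Idn C c) \<cdot> ((Ass C a z b \<boxtimes> Idn C c) \<cdot>
      (((Idn C a \<boxtimes> Swp C b z) \<boxtimes> Idn C c) \<cdot> (Ass C a (b \<otimes> z) c \<cdot> (Idn C a \<boxtimes> Ass C b z c)))))"
    by (simp add: reassoc[OF Ass_nat] comp_assoc)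
  also have "\<dots> = ((inv_arrow C (Ass C z a b) \<cdot> (Ass C z a b \<cdot> (Swp C (a \<otimes> b) z \<cdot> Ass C a b z))) \<boxtimes> Idn C c) \<cdot>
      (Ass C a (b \<otimes> z) c \<cdot> (Idn C a \<boxtimes> Ass C b z c))"
    by (simp add: ten_comp2 hexagon_right del: inv_arrow_cancel)
  also have "\<dots> = (Swp C (a \<otimes> b) z \<boxtimes> Idn C c) \<cdot>
      ((Ass C a b z \<boxtimes> Idn C c) \<cdot> (Ass C a (b \<otimes> z) c \<cdot> (Idn C a \<boxtimes> Ass C b z c)))"
    by (simp add: ten_comp2)
  also have "\<dots> = (Swp C (a \<otimes> b) z \<boxtimes> Idn C c) \<cdot> (Ass C (a \<otimes> b) z c \<cdot> Ass C a b (z \<otimes> c))"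
    by (simp add: pentagon_right)
  also have "\<dots> = Ass C z (a \<otimes> b) c \<cdot> ?l"
    by (simp add: reassoc[OF Ass_pull] comp_assoc)
  finally show "Ass C z (a \<otimes> b) c \<cdot> ?l = Ass C z (a \<otimes> b) c \<cdot> ?r"
    by simp
qed simp_all

text \<open>The hexagon in the form used for merging: once two lists are exchanged, pulling x out of
  the second one becomes taking x from the first one.\<close>

lemma pull_Swp:
  assumes [simp]: "x \<in> Obj C" "a \<in> Obj C" "b \<in> Obj C"
  shows "pull C b x a \<cdot> Swp C (x \<otimes> a) b = (Idn C x \<boxtimes> Swp C a b) \<cdot> inv_arrow C (Ass C x a b)"
proof (rule iso_epi[of _ "Ass C x a b"])
  show "(pull C b x a \<cdot> Swp C (x \<otimes> a) b) \<cdot> Ass C x a b =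
      ((Idn C x \<boxtimes> Swp C a b) \<cdot> inv_arrow C (Ass C x a b)) \<cdot> Ass C x a b"
    by (simp add: pull_def comp_assoc hexagon_right ten_comp2)
qed simp_all

end

text \<open>
  Sortedness plays no role: ties are broken so that merging is associative on arbitrary lists, and
  it is commutative on lists without common elements.
\<close>

fun merge :: "nat list \<Rightarrow> nat list \<Rightarrow> nat list" where
  "merge [] ys = ys"
| "merge (x # xs) [] = x # xs"
| "merge (x # xs) (y # ys) = (if x < y then x # merge xs (y # ys) else y # merge (x # xs) ys)"

lemma merge_Nil [simp]: "merge xs [] = xs"
  by (cases xs) auto

lemma set_merge [simp]: "set (merge xs ys) = set xs \<union> set ys"
  by (induction xs ys rule: merge.induct) auto

lemma merge_commute: "set xs \<inter> set ys = {} \<Longrightarrow> merge xs ys = merge ys xs"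
  by (induction xs ys rule: merge.induct) auto

text \<open>Each list is nested to the right and closed by the unit, so that the base cases of
  merging are the unit isomorphisms.\<close>

fun list_val :: "('o, 'a) smc \<Rightarrow> (nat \<Rightarrow> 'o) \<Rightarrow> nat list \<Rightarrow> 'o" where
  "list_val C v [] = Unt C"
| "list_val C v (x # xs) = v x \<otimes>\<^bsub>C\<^esub> list_val C v xs"

fun merge_arrow :: "('o, 'a) smc \<Rightarrow> (nat \<Rightarrow> 'o) \<Rightarrow> nat list \<Rightarrow> nat list \<Rightarrow> 'a" where
  "merge_arrow C v [] ys = Lun C (list_val C v ys)"
| "merge_arrow C v (x # xs) [] = Run C (list_val C v (x # xs))"
| "merge_arrow C v (x # xs) (y # ys) =
    (if x < y
     then (Idn C (v x) \<boxtimes>\<^bsub>C\<^esub> merge_arrow C v xs (y # ys)) \<cdot>\<^bsub>C\<^esub>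
       inv_arrow C (Ass C (v x) (list_val C v xs) (list_val C v (y # ys)))
     else (Idn C (v y) \<boxtimes>\<^bsub>C\<^esub> merge_arrow C v (x # xs) ys) \<cdot>\<^bsub>C\<^esub>
       pull C (list_val C v (x # xs)) (v y) (list_val C v ys))"

section \<open>Associativity and commutativity of merging as equations of arrows\<close>

locale valuation = sym_mon_cat +
  fixes v :: "nat \<Rightarrow> 'a"
  assumes v_Obj [simp]: "v i \<in> Obj C"
begin

abbreviation "N \<equiv> list_val C v"
abbreviation "mrg \<equiv> merge_arrow C v"

lemma list_val_Obj [simp]: "N xs \<in> Obj C"
  by (induction xs) auto

lemma merge_arrow_simps [simp]:
  "mrg xs ys \<in> Arr C" "Src C (mrg xs ys) = N xs \<otimes> N ys" "Trg C (mrg xs ys) = N (merge xs ys)"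
  by (induction xs ys rule: merge.induct) auto

lemma merge_arrow_iso [simp]: "iso_arrow C (mrg xs ys)"
  by (induction xs ys rule: merge.induct) auto

text \<open>On two empty lists the defining clause gives \<open>Lun\<close>, which agrees with
  \<open>Run\<close> at the unit object.\<close>

lemma merge_arrow_Nil [simp]: "mrg xs [] = Run C (N xs)"
  by (cases xs) (auto simp: Lun_Unt)

declare merge_arrow.simps(3) [simp del]

lemma merge_arrow_less:
  "x < y \<Longrightarrow> mrg (x # xs) (y # ys) =
    (Idn C (v x) \<boxtimes> mrg xs (y # ys)) \<cdot> inv_arrow C (Ass C (v x) (N xs) (N (y # ys)))"
  by (simp add: merge_arrow.simps(3))

lemma merge_arrow_ge:
  "\<not> x < y \<Longrightarrow> mrg (x # xs) (y # ys) =
    (Idn C (v y) \<boxtimes> mrg (x # xs) ys) \<cdot> pull C (N (x # xs)) (v y) (N ys)"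
  by (simp add: merge_arrow.simps(3))

text \<open>Both claims go through one induction, because the targets in the arrow equation match
  only by associativity of merging lists. The measure is the total length: the first letter of the
  result may come from any of the three lists. Each case peels it off with the matching coherence
  law and applies the induction hypothesis behind it.\<close>

lemma merge_arrow_assoc:
  "merge (merge xs ys) zs = merge xs (merge ys zs) \<and>
   mrg (merge xs ys) zs \<cdot> ((mrg xs ys \<boxtimes> Idn C (N zs)) \<cdot> Ass C (N xs) (N ys) (N zs)) =
   mrg xs (merge ys zs) \<cdot> (Idn C (N xs) \<boxtimes> mrg ys zs)" (is "?P xs ys zs")
proof (induction "length xs + length ys + length zs" arbitrary: xs ys zs rule: less_induct)
  case less
  show ?case
  proof (cases "xs = [] \<or> ys = [] \<or> zs = []")
    case True
    moreover have "?P xs ys zs" if "xs = []"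
      using that by (simp add: Lun_ten Lun_nat)
    moreover have "?P xs ys zs" if "ys = []"
      using that by (simp add: triangle)
    moreover have "?P xs ys zs" if "zs = []"
      using that by (simp add: Run_ten reassoc[OF Run_nat] comp_assoc)
    ultimately show ?thesis by blast
  next
    case False
    then obtain x xs' y ys' z zs' where
      l: "xs = x # xs'" "ys = y # ys'" "zs = z # zs'"
      by (meson list.exhaust)
    \<comment> \<open>The cases say which list supplies the first letter. A tie goes to the later
      list, in agreement with \<open>merge\<close>.\<close>
    consider (x) "x < y" "x < z" | (y) "\<not> x < y" "y < z" | (z) "\<not> x < z" "\<not> y < z"
      by linarith
    then show ?thesis
    proof cases
      case x
      define us where "us = merge ys zs"
      \<comment> \<open>The head of the merge of the two later lists still exceeds \<open>x\<close>,
        so that merging \<open>xs\<close> with it starts with \<open>x\<close>.\<close>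
      have "\<exists>w ws. us = w # ws \<and> x < w"
        using x by (simp add: us_def l)
      then obtain w ws where w: "us = w # ws" "x < w" by blast
      have IH: "merge (merge xs' ys) zs = merge xs' us"
        "mrg (merge xs' ys) zs \<cdot> ((mrg xs' ys \<boxtimes> Idn C (N zs)) \<cdot> Ass C (N xs') (N ys) (N zs)) =
         mrg xs' us \<cdot> (Idn C (N xs') \<boxtimes> mrg ys zs)"
        using less[of xs' ys zs] by (auto simp: l us_def)
      have m: "merge xs ys = x # merge xs' ys" "merge (x # merge xs' ys) zs = x # merge (merge xs' ys) zs"
        "mrg xs ys = (Idn C (v x) \<boxtimes> mrg xs' ys) \<cdot> inv_arrow C (Ass C (v x) (N xs') (N ys))"
        "mrg (x # merge xs' ys) zs = (Idn C (v x) \<boxtimes> mrg (merge xs' ys) zs) \<cdot>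
          inv_arrow C (Ass C (v x) (N (merge xs' ys)) (N zs))"
        "merge xs us = x # merge xs' us" "N xs = v x \<otimes> N xs'"
        "mrg xs us = (Idn C (v x) \<boxtimes> mrg xs' us) \<cdot> inv_arrow C (Ass C (v x) (N xs') (N us))"
        using x w by (simp_all add: l merge_arrow_less)
      have us: "N us = N (merge ys zs)"
        by (simp add: us_def)
      \<comment> \<open>The pentagon in the form that moves the associator of the three lists behind
        the letter \<open>v x\<close>.\<close>
      have p: "inv_arrow C (Ass C (v x) (N xs' \<otimes> N ys) (N zs)) \<cdot>
          ((inv_arrow C (Ass C (v x) (N xs') (N ys)) \<boxtimes> Idn C (N zs)) \<cdot>
           Ass C (v x \<otimes> N xs') (N ys) (N zs)) =
          (Idn C (v x) \<boxtimes> Ass C (N xs') (N ys) (N zs)) \<cdot> inv_arrow C (Ass C (v x) (N xs') (N ys \<otimes> N zs))"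
        by (rule iso_epi[of _ "Ass C (v x) (N xs') (N ys \<otimes> N zs)"])
          (simp_all add: comp_assoc pentagon_right ten_comp2)
      have "mrg (merge xs ys) zs \<cdot> ((mrg xs ys \<boxtimes> Idn C (N zs)) \<cdot> Ass C (N xs) (N ys) (N zs)) =
        (Idn C (v x) \<boxtimes> mrg (merge xs' ys) zs) \<cdot> (inv_arrow C (Ass C (v x) (N (merge xs' ys)) (N zs)) \<cdot>
        (((Idn C (v x) \<boxtimes> mrg xs' ys) \<boxtimes> Idn C (N zs)) \<cdot>
        ((inv_arrow C (Ass C (v x) (N xs') (N ys)) \<boxtimes> Idn C (N zs)) \<cdot> Ass C (v x \<otimes> N xs') (N ys) (N zs))))"
        by (simp add: m comp_assoc ten_comp2)
      also have "\<dots> = (Idn C (v x) \<boxtimes> mrg (merge xs' ys) zs) \<cdot> ((Idn C (v x) \<boxtimes> (mrg xs' ys \<boxtimes> Idn C (N zs))) \<cdot>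
        ((Idn C (v x) \<boxtimes> Ass C (N xs') (N ys) (N zs)) \<cdot> inv_arrow C (Ass C (v x) (N xs') (N ys \<otimes> N zs))))"
        by (simp add: reassoc[OF Ass_nat_inv] comp_assoc p)
      also have "\<dots> = (Idn C (v x) \<boxtimes> (mrg (merge xs' ys) zs \<cdot> ((mrg xs' ys \<boxtimes> Idn C (N zs)) \<cdot> Ass C (N xs') (N ys) (N zs)))) \<cdot>
        inv_arrow C (Ass C (v x) (N xs') (N ys \<otimes> N zs))"
        by (simp add: ten_comp ten_comp2)
      also have "\<dots> = mrg xs us \<cdot> (Idn C (N xs) \<boxtimes> mrg ys zs)"
        using Ass_nat_inv[of "Idn C (v x)" "Idn C (N xs')" "mrg ys zs" "v x" "N xs'" "N us"]
        by (simp add: IH m comp_assoc us ten_comp2)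
      finally show ?thesis
        by (simp add: m IH flip: us_def)
    next
      case y
      define us where "us = merge ys' zs"
      have IH: "merge (merge xs ys') zs = merge xs us"
        "mrg (merge xs ys') zs \<cdot> ((mrg xs ys' \<boxtimes> Idn C (N zs)) \<cdot> Ass C (N xs) (N ys') (N zs)) =
         mrg xs us \<cdot> (Idn C (N xs) \<boxtimes> mrg ys' zs)"
        using less[of xs ys' zs] by (auto simp: l us_def)
      have m: "merge xs ys = y # merge xs ys'" "merge (y # merge xs ys') zs = y # merge (merge xs ys') zs"
        "merge ys zs = y # us" "merge xs (y # us) = y # merge xs us" "N ys = v y \<otimes> N ys'"
        "mrg xs ys = (Idn C (v y) \<boxtimes> mrg xs ys') \<cdot> pull C (N xs) (v y) (N ys')"
        "mrg (y # merge xs ys') zs = (Idn C (v y) \<boxtimes> mrg (merge xs ys') zs) \<cdot>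
          inv_arrow C (Ass C (v y) (N (merge xs ys')) (N zs))"
        "mrg ys zs = (Idn C (v y) \<boxtimes> mrg ys' zs) \<cdot> inv_arrow C (Ass C (v y) (N ys') (N zs))"
        "mrg xs (y # us) = (Idn C (v y) \<boxtimes> mrg xs us) \<cdot> pull C (N xs) (v y) (N us)"
        using y by (simp_all add: l merge_arrow_less merge_arrow_ge us_def)
      have us: "N us = N (merge ys' zs)"
        by (simp add: us_def)
      have "mrg (merge xs ys) zs \<cdot> ((mrg xs ys \<boxtimes> Idn C (N zs)) \<cdot> Ass C (N xs) (N ys) (N zs)) =
        (Idn C (v y) \<boxtimes> mrg (merge xs ys') zs) \<cdot> (inv_arrow C (Ass C (v y) (N (merge xs ys')) (N zs)) \<cdot>
        (((Idn C (v y) \<boxtimes> mrg xs ys') \<boxtimes> Idn C (N zs)) \<cdot>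
        ((pull C (N xs) (v y) (N ys') \<boxtimes> Idn C (N zs)) \<cdot> Ass C (N xs) (v y \<otimes> N ys') (N zs))))"
        by (simp add: m comp_assoc ten_comp2)
      also have "\<dots> = (Idn C (v y) \<boxtimes> mrg (merge xs ys') zs) \<cdot> ((Idn C (v y) \<boxtimes> (mrg xs ys' \<boxtimes> Idn C (N zs))) \<cdot>
        ((Idn C (v y) \<boxtimes> Ass C (N xs) (N ys') (N zs)) \<cdot>
        (pull C (N xs) (v y) (N ys' \<otimes> N zs) \<cdot> (Idn C (N xs) \<boxtimes> inv_arrow C (Ass C (v y) (N ys') (N zs))))))"
        by (simp add: reassoc[OF Ass_nat_inv] comp_assoc Ass_pull_middle)
      also have "\<dots> = (Idn C (v y) \<boxtimes> (mrg (merge xs ys') zs \<cdot> ((mrg xs ys' \<boxtimes> Idn C (N zs)) \<cdot> Ass C (N xs) (N ys') (N zs)))) \<cdot>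
        (pull C (N xs) (v y) (N ys' \<otimes> N zs) \<cdot> (Idn C (N xs) \<boxtimes> inv_arrow C (Ass C (v y) (N ys') (N zs))))"
        by (simp add: ten_comp ten_comp2)
      also have "\<dots> = mrg xs (y # us) \<cdot> (Idn C (N xs) \<boxtimes> mrg ys zs)"
        using pull_nat[of "Idn C (N xs)" "mrg ys' zs" "N xs" "N us" "v y", THEN reassoc,
            of "Idn C (N xs) \<boxtimes> inv_arrow C (Ass C (v y) (N ys') (N zs))"]
        by (simp add: IH m comp_assoc us ten_comp ten_comp2)
      finally show ?thesis
        by (simp add: m IH)
    next
      case z
      define us where "us = merge xs ys"
      \<comment> \<open>Dually, the head of the merge of the first two lists is not below
        \<open>z\<close>, so \<open>z\<close> comes out first.\<close>
      have "\<exists>w ws. us = w # ws \<and> \<not> w < z"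
        using z by (simp add: us_def l)
      then obtain w ws where w: "us = w # ws" "\<not> w < z" by blast
      have IH: "merge us zs' = merge xs (merge ys zs')"
        "mrg us zs' \<cdot> ((mrg xs ys \<boxtimes> Idn C (N zs')) \<cdot> Ass C (N xs) (N ys) (N zs')) =
         mrg xs (merge ys zs') \<cdot> (Idn C (N xs) \<boxtimes> mrg ys zs')"
        using less[of xs ys zs'] by (auto simp: l us_def)
      have m: "merge us zs = z # merge us zs'" "merge ys zs = z # merge ys zs'"
        "merge xs (z # merge ys zs') = z # merge xs (merge ys zs')" "N zs = v z \<otimes> N zs'"
        "mrg us zs = (Idn C (v z) \<boxtimes> mrg us zs') \<cdot> pull C (N us) (v z) (N zs')"
        "mrg ys zs = (Idn C (v z) \<boxtimes> mrg ys zs') \<cdot> pull C (N ys) (v z) (N zs')"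
        "mrg xs (z # merge ys zs') = (Idn C (v z) \<boxtimes> mrg xs (merge ys zs')) \<cdot>
          pull C (N xs) (v z) (N (merge ys zs'))"
        using z w by (simp_all add: l merge_arrow_ge)
      have us: "N us = N (merge xs ys)"
        by (simp add: us_def)
      have "mrg us zs \<cdot> ((mrg xs ys \<boxtimes> Idn C (N zs)) \<cdot> Ass C (N xs) (N ys) (N zs)) =
        (Idn C (v z) \<boxtimes> (mrg us zs' \<cdot> ((mrg xs ys \<boxtimes> Idn C (N zs')) \<cdot> Ass C (N xs) (N ys) (N zs')))) \<cdot>
        (pull C (N xs) (v z) (N ys \<otimes> N zs') \<cdot> (Idn C (N xs) \<boxtimes> pull C (N ys) (v z) (N zs')))"
        using pull_nat[of "mrg xs ys" "Idn C (N zs')" "N us" "N zs'" "v z", THEN reassoc,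
            of "Ass C (N xs) (N ys) (N zs)"]
        by (simp add: m us comp_assoc Ass_pull_right ten_comp ten_comp2)
      also have "\<dots> = mrg xs (z # merge ys zs') \<cdot> (Idn C (N xs) \<boxtimes> mrg ys zs)"
        using pull_nat[of "Idn C (N xs)" "mrg ys zs'" "N xs" "N (merge ys zs')" "v z", THEN reassoc,
            of "Idn C (N xs) \<boxtimes> pull C (N ys) (v z) (N zs')"]
        by (simp add: IH m comp_assoc ten_comp ten_comp2)
      finally show ?thesis
        by (simp add: m IH flip: us_def)
    qed
  qed
qed

lemma Ass_Swp:
  assumes [simp]: "a \<in> Obj C" "y \<in> Obj C" "b \<in> Obj C"
  shows "inv_arrow C (Ass C y b a) \<cdot> Swp C a (y \<otimes> b) = (Idn C y \<boxtimes> Swp C a b) \<cdot> pull C a y b"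
  by (rule iso_epi[of _ "Swp C (y \<otimes> b) a"])
    (simp_all add: comp_assoc pull_Swp ten_comp2)

text \<open>A letter taken from the left in one order is pulled from the right in the other, and the
  hexagon (\<open>pull_Swp\<close> or \<open>Ass_Swp\<close>) matches the two steps. Disjointness
  rules out equal heads, where the tie rule would choose differently in the two orders.\<close>

lemma merge_arrow_Swp:
  "set xs \<inter> set ys = {} \<Longrightarrow> mrg ys xs \<cdot> Swp C (N xs) (N ys) = mrg xs ys"
proof (induction xs ys rule: merge.induct)
  case (1 ys)
  then show ?case by (simp add: Run_Swp)
next
  case (2 x xs)
  then show ?case by (simp add: Swp_unit)
next
  case (3 x xs y ys)
  then consider "x < y" | "y < x"
    by fastforce
  then show ?case
  proof cases
    case 1
    with 3 have IH: "mrg (y # ys) xs \<cdot> Swp C (N xs) (N (y # ys)) = mrg xs (y # ys)"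
      by auto
    show ?thesis
      using 1 IH by (simp add: merge_arrow_less merge_arrow_ge comp_assoc pull_Swp ten_comp2)
  next
    case 2
    with 3 have IH: "mrg ys (x # xs) \<cdot> Swp C (N (x # xs)) (N ys) = mrg (x # xs) ys"
      by auto
    show ?thesis
      using 2 IH by (simp add: merge_arrow_less merge_arrow_ge comp_assoc Ass_Swp ten_comp2)
  qed
qed

end

section \<open>Normal forms of words and uniqueness of canonical arrows\<close>

primrec normal_word :: "nat word \<Rightarrow> nat list" where
  "normal_word WUnit = []"
| "normal_word (WGen x) = [x]"
| "normal_word (WTen X Y) = merge (normal_word X) (normal_word Y)"

primrec linear :: "'g word \<Rightarrow> bool" where
  "linear WUnit \<longleftrightarrow> True"
| "linear (WGen x) \<longleftrightarrow> True"
| "linear (WTen X Y) \<longleftrightarrow> linear X \<and> linear Y \<and> set_word X \<inter> set_word Y = {}"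

text \<open>The normal form of a single letter x is v x \<otimes> I, hence the inverse of
  \<open>Run\<close>.\<close>

primrec normal_arrow :: "('o, 'a) smc \<Rightarrow> (nat \<Rightarrow> 'o) \<Rightarrow> nat word \<Rightarrow> 'a" where
  "normal_arrow C v WUnit = Idn C (Unt C)"
| "normal_arrow C v (WGen x) = inv_arrow C (Run C (v x))"
| "normal_arrow C v (WTen X Y) =
    merge_arrow C v (normal_word X) (normal_word Y) \<cdot>\<^bsub>C\<^esub> (normal_arrow C v X \<boxtimes>\<^bsub>C\<^esub> normal_arrow C v Y)"

text \<open>Without generating arrows, the well-formed terms are precisely the formal canonical
  arrows. Infinitely many letters allow any finite family of objects to be named by distinct
  ones.\<close>

definition free_sig :: "(nat, unit) signature" where
  "free_sig = \<lparr>gobj = UNIV, garr = {}, gsrc = (\<lambda>_. WUnit), gtrg = (\<lambda>_. WUnit)\<rparr>"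

lemma words_free_sig [simp]: "X \<in> words free_sig"
  by (simp add: words_def free_sig_def)

lemma set_normal_word [simp]: "set (normal_word X) = set_word X"
  by (induction X) auto

text \<open>Canonical arrows only permute letters. Hence linearity of the source passes to every
  word met along a composite.\<close>

lemma linear_trm:
  assumes "wf_trm free_sig p"
  shows "set_word (ttrg free_sig p) = set_word (tsrc free_sig p)"
    "linear (tsrc free_sig p) \<Longrightarrow> linear (ttrg free_sig p)"
proof -
  have *: "set_word (ttrg free_sig q) = set_word (tsrc free_sig q)" if "wf_trm free_sig q" for q
    using that by (induction q) (auto simp: free_sig_def)
  then show "set_word (ttrg free_sig p) = set_word (tsrc free_sig p)"
    using assms .
  show "linear (tsrc free_sig p) \<Longrightarrow> linear (ttrg free_sig p)"
    using assms by (induction p) (simp_all add: *, auto simp: free_sig_def)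
qed

context valuation
begin

abbreviation "V \<equiv> word_val C v"
abbreviation "nrm \<equiv> normal_arrow C v"
abbreviation "tv \<equiv> trm_val C v undefined"

lemma word_val_Obj [simp]: "V X \<in> Obj C"
  by (induction X) auto

lemma trm_val_free_simps [simp]:
  assumes "wf_trm free_sig p"
  shows "tv p \<in> Arr C" "Src C (tv p) = V (tsrc free_sig p)" "Trg C (tv p) = V (ttrg free_sig p)"
  using assms by (induction p) (auto simp: free_sig_def)

lemma normal_arrow_simps [simp]:
  "nrm X \<in> Arr C" "Src C (nrm X) = V X" "Trg C (nrm X) = N (normal_word X)" "iso_arrow C (nrm X)"
  by (induction X) auto

lemma normal_arrow_Ass:
  "nrm (WTen (WTen X Y) Z) \<cdot> Ass C (V X) (V Y) (V Z) = nrm (WTen X (WTen Y Z))"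
proof -
  let ?X = "normal_word X" and ?Y = "normal_word Y" and ?Z = "normal_word Z"
  have "nrm (WTen (WTen X Y) Z) \<cdot> Ass C (V X) (V Y) (V Z) =
      mrg (merge ?X ?Y) ?Z \<cdot> ((mrg ?X ?Y \<boxtimes> Idn C (N ?Z)) \<cdot>
      (((nrm X \<boxtimes> nrm Y) \<boxtimes> nrm Z) \<cdot> Ass C (V X) (V Y) (V Z)))"
    by (simp add: comp_assoc ten_comp2)
  also have "\<dots> = (mrg (merge ?X ?Y) ?Z \<cdot> ((mrg ?X ?Y \<boxtimes> Idn C (N ?Z)) \<cdot> Ass C (N ?X) (N ?Y) (N ?Z))) \<cdot>
      (nrm X \<boxtimes> (nrm Y \<boxtimes> nrm Z))"
    using Ass_nat[of "nrm X" "nrm Y" "nrm Z" "N ?X" "N ?Y" "N ?Z"]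
    by (simp add: comp_assoc)
  also have "\<dots> = nrm (WTen X (WTen Y Z))"
    by (simp add: merge_arrow_assoc comp_assoc ten_comp)
  finally show ?thesis .
qed

text \<open>By induction on the term, each canonical arrow becomes an identity after normalisation.
  Associators use associativity of merging; the symmetry uses its commutativity, which is where
  linearity enters.\<close>

lemma normal_arrow_natural:
  assumes "wf_trm free_sig p" "linear (tsrc free_sig p)"
  shows "normal_word (ttrg free_sig p) = normal_word (tsrc free_sig p) \<and>
    nrm (ttrg free_sig p) \<cdot> tv p = nrm (tsrc free_sig p)"
  using assms
proof (induction p)
  case (TGen e)
  then show ?case by (simp add: free_sig_def)
next
  case (TId X)
  then show ?case by simp
next
  case (TCmp q p)
  then show ?case
    using linear_trm[of p] by (auto simp flip: comp_assoc)
next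
  case (TLeft X p)
  then show ?case
    by (auto simp: comp_assoc ten_comp)
next
  case (TRight p X)
  then show ?case
    by (auto simp: comp_assoc ten_comp)
next
  case (TAss X Y Z)
  then show ?case
    using normal_arrow_Ass[of X Y Z] by (auto simp: merge_arrow_assoc)
next
  case (TAssInv X Y Z)
  have "nrm (WTen X (WTen Y Z)) \<cdot> inv_arrow C (Ass C (V X) (V Y) (V Z)) = nrm (WTen (WTen X Y) Z)"
    unfolding normal_arrow_Ass[symmetric] by (simp add: comp_assoc)
  then show ?case
    by (auto simp: merge_arrow_assoc)
next
  case (TRun X)
  then show ?case by (simp add: Run_nat)
next
  case (TRunInv X)
  have "Run C (N (normal_word X)) \<cdot> (nrm X \<boxtimes> Idn C (Unt C)) \<cdot> inv_arrow C (Run C (V X)) = nrm X"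
    by (simp add: Run_nat comp_assoc)
  then show ?case by simp
next
  case (TLun X)
  then show ?case by (simp add: Lun_nat)
next
  case (TLunInv X)
  have "Lun C (N (normal_word X)) \<cdot> (Idn C (Unt C) \<boxtimes> nrm X) \<cdot> inv_arrow C (Lun C (V X)) = nrm X"
    by (simp add: Lun_nat comp_assoc)
  then show ?case by simp
next
  case (TSwp X Y)
  then have d: "set (normal_word X) \<inter> set (normal_word Y) = {}"
    by simp
  have "nrm (WTen Y X) \<cdot> Swp C (V X) (V Y) =
      mrg (normal_word Y) (normal_word X) \<cdot> (Swp C (N (normal_word X)) (N (normal_word Y)) \<cdot> (nrm X \<boxtimes> nrm Y))"
    using Swp_nat[of "nrm X" "nrm Y" "N (normal_word X)" "N (normal_word Y)"]
    by (simp add: comp_assoc)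
  also have "\<dots> = nrm (WTen X Y)"
    by (simp add: reassoc[OF merge_arrow_Swp[OF d]])
  finally have "nrm (WTen Y X) \<cdot> Swp C (V X) (V Y) = nrm (WTen X Y)" .
  then show ?case
    by (simp add: merge_commute[OF d])
qed

text \<open>Linearity cannot be dropped: \<^const>\<open>TSwp\<close> and \<^const>\<open>TId\<close> are parallel on \<open>x \<otimes> x\<close>.\<close>

theorem coherence:
  assumes "wf_trm free_sig p" "wf_trm free_sig q" "linear (tsrc free_sig p)"
    "tsrc free_sig p = tsrc free_sig q" "ttrg free_sig p = ttrg free_sig q"
  shows "tv p = tv q"
proof (rule iso_mono[of "nrm (ttrg free_sig p)"])
  show "nrm (ttrg free_sig p) \<cdot> tv p = nrm (ttrg free_sig p) \<cdot> tv q"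
    using normal_arrow_natural[of p] normal_arrow_natural[of q] assms by metis
qed (use assms in simp_all)

end

text \<open>Objects are named by their position in a list, so a word can be linear even where two of
  the objects coincide. The unit fills all other positions because \<open>valuation\<close> asks for
  an object at every number.\<close>

definition word_letters :: "('o, 'a) smc \<Rightarrow> 'o list \<Rightarrow> nat \<Rightarrow> 'o" where
  "word_letters C os i = (if i < length os then os ! i else Unt C)"

lemma (in sym_mon_cat) coherence_letters:
  assumes "set os \<subseteq> Obj C"
    and "wf_trm free_sig p" "wf_trm free_sig q" "linear (tsrc free_sig p)"
    "tsrc free_sig p = tsrc free_sig q" "ttrg free_sig p = ttrg free_sig q"
  shows "trm_val C (word_letters C os) undefined p = trm_val C (word_letters C os) undefined q"
proof -
  interpret valuation C "word_letters C os"
    using assms(1) by unfold_locales (auto simp: word_letters_def)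
  show ?thesis
    using assms(2-) by (rule coherence)
qed

section \<open>Naturality of the interchange and its coherence equations\<close>

context sym_mon_cat
begin

lemma interchange_right:
  assumes [simp]: "w \<in> Obj C" "x \<in> Obj C" "y \<in> Obj C" "z \<in> Obj C"
  shows "interchange C w x y z =
    inv_arrow C (Ass C (w \<otimes> y) x z) \<cdot> ((Ass C w y x \<boxtimes> Idn C z) \<cdot>
     (((Idn C w \<boxtimes> Swp C x y) \<boxtimes> Idn C z) \<cdot>
     ((inv_arrow C (Ass C w x y) \<boxtimes> Idn C z) \<cdot> Ass C (w \<otimes> x) y z)))"
  by (simp add: interchange_def comp_assoc)

lemma interchange_simps [simp]:
  assumes "w \<in> Obj C" "x \<in> Obj C" "y \<in> Obj C" "z \<in> Obj C"
  shows "interchange C w x y z \<in> Arr C"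
    "Src C (interchange C w x y z) = (w \<otimes> x) \<otimes> (y \<otimes> z)"
    "Trg C (interchange C w x y z) = (w \<otimes> y) \<otimes> (x \<otimes> z)"
    "iso_arrow C (interchange C w x y z)"
  using assms by (simp_all add: interchange_right)

text \<open>Arbitrary arrows occur here, so coherence does not apply. The square is pasted from
  those of the two outer associators (\<open>a\<close>, \<open>b\<close>) and of the middle exchange
  (\<open>m\<close>).\<close>

lemma interchange_nat:
  assumes "f \<in> Arr C" "g \<in> Arr C" "h \<in> Arr C" "k \<in> Arr C"
    "Trg C f = w" "Trg C g = x" "Trg C h = y" "Trg C k = z"
  shows "interchange C w x y z \<cdot> ((f \<boxtimes> g) \<boxtimes> (h \<boxtimes> k)) =
    ((f \<boxtimes> h) \<boxtimes> (g \<boxtimes> k)) \<cdot> interchange C (Src C f) (Src C g) (Src C h) (Src C k)"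
proof -
  note [simp] = assms(1-4) assms(5-8)[symmetric]
  let ?a = "Ass C (w \<otimes> x) y z" and ?a' = "Ass C (Src C f \<otimes> Src C g) (Src C h) (Src C k)"
  let ?m = "(Ass C w y x \<cdot> ((Idn C w \<boxtimes> Swp C x y) \<cdot> inv_arrow C (Ass C w x y))) \<boxtimes> Idn C z"
  let ?m' = "(Ass C (Src C f) (Src C h) (Src C g) \<cdot> ((Idn C (Src C f) \<boxtimes> Swp C (Src C g) (Src C h)) \<cdot>
    inv_arrow C (Ass C (Src C f) (Src C g) (Src C h)))) \<boxtimes> Idn C (Src C k)"
  let ?b = "inv_arrow C (Ass C (w \<otimes> y) x z)"
  let ?b' = "inv_arrow C (Ass C (Src C f \<otimes> Src C h) (Src C g) (Src C k))"
  have i: "interchange C w x y z = ?b \<cdot> (?m \<cdot> ?a)"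
    "interchange C (Src C f) (Src C g) (Src C h) (Src C k) = ?b' \<cdot> (?m' \<cdot> ?a')"
    by (simp_all add: interchange_right ten_comp2 comp_assoc)
  have a: "?a \<cdot> ((f \<boxtimes> g) \<boxtimes> (h \<boxtimes> k)) = (((f \<boxtimes> g) \<boxtimes> h) \<boxtimes> k) \<cdot> ?a'"
    by (simp add: Ass_nat)
  have s: "(Idn C (Trg C f) \<boxtimes> Swp C (Trg C g) (Trg C h)) \<cdot> (f \<boxtimes> (g \<boxtimes> h)) =
      (f \<boxtimes> (h \<boxtimes> g)) \<cdot> (Idn C (Src C f) \<boxtimes> Swp C (Src C g) (Src C h))"
    by (simp add: ten_comp Swp_nat)
  have "(Ass C w y x \<cdot> ((Idn C w \<boxtimes> Swp C x y) \<cdot> inv_arrow C (Ass C w x y))) \<cdot> ((f \<boxtimes> g) \<boxtimes> h) =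
    ((f \<boxtimes> h) \<boxtimes> g) \<cdot> (Ass C (Src C f) (Src C h) (Src C g) \<cdot> ((Idn C (Src C f) \<boxtimes> Swp C (Src C g) (Src C h)) \<cdot>
    inv_arrow C (Ass C (Src C f) (Src C g) (Src C h))))"
    by (simp add: comp_assoc Ass_nat_inv reassoc[OF s] reassoc[OF Ass_nat])
  then have m: "?m \<cdot> (((f \<boxtimes> g) \<boxtimes> h) \<boxtimes> k) = (((f \<boxtimes> h) \<boxtimes> g) \<boxtimes> k) \<cdot> ?m'"
    by (simp add: ten_comp)
  have b: "?b \<cdot> (((f \<boxtimes> h) \<boxtimes> g) \<boxtimes> k) = ((f \<boxtimes> h) \<boxtimes> (g \<boxtimes> k)) \<cdot> ?b'"
    by (simp add: Ass_nat_inv)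
  have "interchange C w x y z \<cdot> ((f \<boxtimes> g) \<boxtimes> (h \<boxtimes> k)) = ?b \<cdot> (?m \<cdot> (?a \<cdot> ((f \<boxtimes> g) \<boxtimes> (h \<boxtimes> k))))"
    unfolding i by (simp add: comp_assoc)
  also have "\<dots> = ?b \<cdot> ((?m \<cdot> (((f \<boxtimes> g) \<boxtimes> h) \<boxtimes> k)) \<cdot> ?a')"
    unfolding a by (simp add: comp_assoc)
  also have "\<dots> = (?b \<cdot> (((f \<boxtimes> h) \<boxtimes> g) \<boxtimes> k)) \<cdot> (?m' \<cdot> ?a')"
    unfolding m by (simp add: comp_assoc)
  also have "\<dots> = ((f \<boxtimes> h) \<boxtimes> (g \<boxtimes> k)) \<cdot> (?b' \<cdot> (?m' \<cdot> ?a'))"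
    unfolding b by (simp add: comp_assoc)
  finally show ?thesis
    unfolding i .
qed

text \<open>Links the formal interchange to the actual one, for the coherence instances below and
  later for relation (vi) of the tensor product.\<close>

lemma trm_val_tinterchange:
  assumes "word_val C v W \<in> Obj C" "word_val C v X \<in> Obj C" "word_val C v Y \<in> Obj C" "word_val C v Z \<in> Obj C"
  shows "trm_val C v g (tinterchange W X Y Z) =
    interchange C (word_val C v W) (word_val C v X) (word_val C v Y) (word_val C v Z)"
  using assms by (simp add: tinterchange_def interchange_right)

lemma tinterchange_free:
  "wf_trm free_sig (tinterchange W X Y Z)"
  "tsrc free_sig (tinterchange W X Y Z) = WTen (WTen W X) (WTen Y Z)"
  "ttrg free_sig (tinterchange W X Y Z) = WTen (WTen W Y) (WTen X Z)"
  by (simp_all add: tinterchange_def)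

lemmas coherence_simps = trm_val_tinterchange tinterchange_free word_letters_def

text \<open>Needed for the associativity axiom of the pointwise tensor of two functors. The six
  objects are named by six letters, and two parallel formal arrows are evaluated.\<close>

lemma interchange_assoc:
  assumes "a \<in> Obj C" "b \<in> Obj C" "c \<in> Obj C" "a' \<in> Obj C" "b' \<in> Obj C" "c' \<in> Obj C"
  shows "(Ass C a b c \<boxtimes> Ass C a' b' c') \<cdot> (interchange C a a' (b \<otimes> c) (b' \<otimes> c') \<cdot>
      (Idn C (a \<otimes> a') \<boxtimes> interchange C b b' c c')) =
    interchange C (a \<otimes> b) (a' \<otimes> b') c c' \<cdot> ((interchange C a a' b b' \<boxtimes> Idn C (c \<otimes> c')) \<cdot>
      Ass C (a \<otimes> a') (b \<otimes> b') (c \<otimes> c'))"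
proof -
  let ?a = "WGen (0::nat)" and ?b = "WGen (1::nat)" and ?c = "WGen (2::nat)"
  let ?a' = "WGen (3::nat)" and ?b' = "WGen (4::nat)" and ?c' = "WGen (5::nat)"
  show ?thesis
    using coherence_letters[of "[a, b, c, a', b', c']"
      "TCmp (tten free_sig (TAss ?a ?b ?c) (TAss ?a' ?b' ?c'))
        (TCmp (tinterchange ?a ?a' (WTen ?b ?c) (WTen ?b' ?c')) (TLeft (WTen ?a ?a') (tinterchange ?b ?b' ?c ?c')))"
      "TCmp (tinterchange (WTen ?a ?b) (WTen ?a' ?b') ?c ?c') (TCmp (TRight (tinterchange ?a ?a' ?b ?b') (WTen ?c ?c'))
        (TAss (WTen ?a ?a') (WTen ?b ?b') (WTen ?c ?c')))"] assms
    by (simp add: coherence_simps tten_def ten_comp)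
qed

lemma interchange_Swp:
  assumes "a \<in> Obj C" "b \<in> Obj C" "a' \<in> Obj C" "b' \<in> Obj C"
  shows "(Swp C a a' \<boxtimes> Swp C b b') \<cdot> interchange C a b a' b' =
    interchange C a' b' a b \<cdot> Swp C (a \<otimes> b) (a' \<otimes> b')"
proof -
  let ?a = "WGen (0::nat)" and ?b = "WGen (1::nat)" and ?a' = "WGen (2::nat)" and ?b' = "WGen (3::nat)"
  show ?thesis
    using coherence_letters[of "[a, b, a', b']"
      "TCmp (tten free_sig (TSwp ?a ?a') (TSwp ?b ?b')) (tinterchange ?a ?b ?a' ?b')"
      "TCmp (tinterchange ?a' ?b' ?a ?b) (TSwp (WTen ?a ?b) (WTen ?a' ?b'))"] assms
    by (simp add: coherence_simps tten_def ten_comp)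
qed

text \<open>The first two equations serve the unit axioms of the pointwise tensor of functors, the
  last two the monoidality of the pointwise unit isomorphisms.\<close>

lemma interchange_units:
  assumes "a \<in> Obj C" "b \<in> Obj C"
  shows "(Run C a \<boxtimes> Run C b) \<cdot> (interchange C a b (Unt C) (Unt C) \<cdot>
      (Idn C (a \<otimes> b) \<boxtimes> inv_arrow C (Run C (Unt C)))) = Run C (a \<otimes> b)"
    "(Lun C a \<boxtimes> Lun C b) \<cdot> (interchange C (Unt C) (Unt C) a b \<cdot>
      (inv_arrow C (Run C (Unt C)) \<boxtimes> Idn C (a \<otimes> b))) = Lun C (a \<otimes> b)"
    "Run C (a \<otimes> b) \<cdot> ((Idn C (a \<otimes> b) \<boxtimes> Run C (Unt C)) \<cdot> interchange C a (Unt C) b (Unt C)) =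
      Run C a \<boxtimes> Run C b"
    "Lun C (a \<otimes> b) \<cdot> ((Run C (Unt C) \<boxtimes> Idn C (a \<otimes> b)) \<cdot> interchange C (Unt C) a (Unt C) b) =
      Lun C a \<boxtimes> Lun C b"
proof -
  let ?a = "WGen (0::nat)" and ?b = "WGen (1::nat)"
  note c = coherence_letters[of "[a, b]"]
  show "(Run C a \<boxtimes> Run C b) \<cdot> (interchange C a b (Unt C) (Unt C) \<cdot>
      (Idn C (a \<otimes> b) \<boxtimes> inv_arrow C (Run C (Unt C)))) = Run C (a \<otimes> b)"
    using c[of "TCmp (tten free_sig (TRun ?a) (TRun ?b)) (TCmp (tinterchange ?a ?b WUnit WUnit)
      (TLeft (WTen ?a ?b) (TRunInv WUnit)))" "TRun (WTen ?a ?b)"] assms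
    by (simp add: coherence_simps tten_def ten_comp)
  show "(Lun C a \<boxtimes> Lun C b) \<cdot> (interchange C (Unt C) (Unt C) a b \<cdot>
      (inv_arrow C (Run C (Unt C)) \<boxtimes> Idn C (a \<otimes> b))) = Lun C (a \<otimes> b)"
    using c[of "TCmp (tten free_sig (TLun ?a) (TLun ?b)) (TCmp (tinterchange WUnit WUnit ?a ?b)
      (TRight (TRunInv WUnit) (WTen ?a ?b)))" "TLun (WTen ?a ?b)"] assms
    by (simp add: coherence_simps tten_def ten_comp)
  show "Run C (a \<otimes> b) \<cdot> ((Idn C (a \<otimes> b) \<boxtimes> Run C (Unt C)) \<cdot> interchange C a (Unt C) b (Unt C)) =
      Run C a \<boxtimes> Run C b"
    using c[of "TCmp (TRun (WTen ?a ?b)) (TCmp (TLeft (WTen ?a ?b) (TRun WUnit)) (tinterchange ?a WUnit ?b WUnit))"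
      "tten free_sig (TRun ?a) (TRun ?b)"] assms
    by (simp add: coherence_simps tten_def ten_comp)
  show "Lun C (a \<otimes> b) \<cdot> ((Run C (Unt C) \<boxtimes> Idn C (a \<otimes> b)) \<cdot> interchange C (Unt C) a (Unt C) b) =
      Lun C a \<boxtimes> Lun C b"
    using c[of "TCmp (TLun (WTen ?a ?b)) (TCmp (TRight (TRun WUnit) (WTen ?a ?b)) (tinterchange WUnit ?a WUnit ?b))"
      "tten free_sig (TLun ?a) (TLun ?b)"] assms
    by (simp add: coherence_simps tten_def ten_comp)
qed

text \<open>Used in \<open>gamma_nat\<close> to carry the interchange of relation (vi) to the other
  side.\<close>

lemma interchange_involution:
  assumes "w \<in> Obj C" "x \<in> Obj C" "y \<in> Obj C" "z \<in> Obj C"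
  shows "interchange C w y x z \<cdot> interchange C w x y z = Idn C ((w \<otimes> x) \<otimes> (y \<otimes> z))"
proof -
  let ?w = "WGen (0::nat)" and ?x = "WGen (1::nat)" and ?y = "WGen (2::nat)" and ?z = "WGen (3::nat)"
  show ?thesis
    using coherence_letters[of "[w, x, y, z]"
      "TCmp (tinterchange ?w ?y ?x ?z) (tinterchange ?w ?x ?y ?z)" "TId (WTen (WTen ?w ?x) (WTen ?y ?z))"] assms
    by (simp add: coherence_simps)
qed

text \<open>For the monoidality of the pointwise associator, whereas
  \<open>interchange_assoc\<close> serves the associativity axiom of one tensored functor.\<close>

lemma interchange_Ass:
  assumes "a \<in> Obj C" "b \<in> Obj C" "c \<in> Obj C" "a' \<in> Obj C" "b' \<in> Obj C" "c' \<in> Obj C"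
  shows "Ass C (a \<otimes> a') (b \<otimes> b') (c \<otimes> c') \<cdot> ((Idn C (a \<otimes> a') \<boxtimes> interchange C b c b' c') \<cdot>
      interchange C a (b \<otimes> c) a' (b' \<otimes> c')) =
    (interchange C a b a' b' \<boxtimes> Idn C (c \<otimes> c')) \<cdot> (interchange C (a \<otimes> b) c (a' \<otimes> b') c' \<cdot>
      (Ass C a b c \<boxtimes> Ass C a' b' c'))"
proof -
  let ?a = "WGen (0::nat)" and ?b = "WGen (1::nat)" and ?c = "WGen (2::nat)"
  let ?a' = "WGen (3::nat)" and ?b' = "WGen (4::nat)" and ?c' = "WGen (5::nat)"
  show ?thesis
    using coherence_letters[of "[a, b, c, a', b', c']"
      "TCmp (TAss (WTen ?a ?a') (WTen ?b ?b') (WTen ?c ?c'))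
        (TCmp (TLeft (WTen ?a ?a') (tinterchange ?b ?c ?b' ?c')) (tinterchange ?a (WTen ?b ?c) ?a' (WTen ?b' ?c')))"
      "TCmp (TRight (tinterchange ?a ?b ?a' ?b') (WTen ?c ?c')) (TCmp (tinterchange (WTen ?a ?b) ?c (WTen ?a' ?b') ?c')
        (tten free_sig (TAss ?a ?b ?c) (TAss ?a' ?b' ?c')))"] assms
    by (simp add: coherence_simps tten_def ten_comp)
qed

lemma Swp_interchange:
  assumes "a \<in> Obj C" "b \<in> Obj C" "a' \<in> Obj C" "b' \<in> Obj C"
  shows "Swp C (a \<otimes> a') (b \<otimes> b') \<cdot> interchange C a b a' b' =
    interchange C b a b' a' \<cdot> (Swp C a b \<boxtimes> Swp C a' b')"
proof -
  let ?a = "WGen (0::nat)" and ?b = "WGen (1::nat)" and ?a' = "WGen (2::nat)" and ?b' = "WGen (3::nat)"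
  show ?thesis
    using coherence_letters[of "[a, b, a', b']"
      "TCmp (TSwp (WTen ?a ?a') (WTen ?b ?b')) (tinterchange ?a ?b ?a' ?b')"
      "TCmp (tinterchange ?b ?a ?b' ?a') (tten free_sig (TSwp ?a ?b) (TSwp ?a' ?b'))"] assms
    by (simp add: coherence_simps tten_def ten_comp)
qed

text \<open>In order: the unit conditions for the pointwise associator and the pointwise symmetry,
  then the associativity and symmetry axioms of the constant functor at the unit.\<close>

lemma unit_coherence:
  "Ass C (Unt C) (Unt C) (Unt C) \<cdot> ((Idn C (Unt C) \<boxtimes> inv_arrow C (Run C (Unt C))) \<cdot> inv_arrow C (Run C (Unt C))) =
    (inv_arrow C (Run C (Unt C)) \<boxtimes> Idn C (Unt C)) \<cdot> inv_arrow C (Run C (Unt C))"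
  "Swp C (Unt C) (Unt C) \<cdot> inv_arrow C (Run C (Unt C)) = inv_arrow C (Run C (Unt C))"
  "Run C (Unt C) \<cdot> (Idn C (Unt C) \<boxtimes> Run C (Unt C)) =
    Run C (Unt C) \<cdot> ((Run C (Unt C) \<boxtimes> Idn C (Unt C)) \<cdot> Ass C (Unt C) (Unt C) (Unt C))"
  "Run C (Unt C) \<cdot> Swp C (Unt C) (Unt C) = Run C (Unt C)"
  using coherence_letters[of "[]" "TCmp (TAss WUnit WUnit WUnit) (TCmp (TLeft WUnit (TRunInv WUnit)) (TRunInv WUnit))"
      "TCmp (TRight (TRunInv WUnit) WUnit) (TRunInv WUnit)"]
    coherence_letters[of "[]" "TCmp (TSwp WUnit WUnit) (TRunInv WUnit)" "TRunInv WUnit"]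
    coherence_letters[of "[]" "TCmp (TRun WUnit) (TLeft WUnit (TRun WUnit))"
      "TCmp (TRun WUnit) (TCmp (TRight (TRun WUnit) WUnit) (TAss WUnit WUnit WUnit))"]
    coherence_letters[of "[]" "TCmp (TRun WUnit) (TSwp WUnit WUnit)" "TRun WUnit"]
  by simp_all

end

section \<open>The internal hom\<close>

context sm_functor
begin

lemma Fobj_Obj [simp]: "x \<in> Obj A \<Longrightarrow> Fobj F x \<in> Obj B"
  using Fobj_type by auto

lemma Farr_simps [simp]:
  assumes "f \<in> Arr A"
  shows "Farr F f \<in> Arr B" "Src B (Farr F f) = Fobj F (Src A f)" "Trg B (Farr F f) = Fobj F (Trg A f)"
  using Farr_hom[of f "Src A f" "Trg A f"] assms by (auto simp: hom_set_iff)

lemma Fzero_simps [simp]: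
  "Fzero F \<in> Arr B" "Src B (Fzero F) = Unt B" "Trg B (Fzero F) = Fobj F (Unt A)"
  using Fzero_hom by (auto simp: hom_set_iff)

lemma Ftwo_simps [simp]:
  assumes "x \<in> Obj A" "y \<in> Obj A"
  shows "Ftwo F x y \<in> Arr B" "Src B (Ftwo F x y) = Fobj F x \<otimes>\<^bsub>B\<^esub> Fobj F y"
    "Trg B (Ftwo F x y) = Fobj F (x \<otimes>\<^bsub>A\<^esub> y)"
  using Ftwo_hom[OF assms] by (auto simp: hom_set_iff)

declare Farr_Idn [simp]

lemma Farr_comp:
  assumes "f \<in> Arr A" "g \<in> Arr A" "Src A g = Trg A f"
  shows "Farr F (g \<cdot>\<^bsub>A\<^esub> f) = Farr F g \<cdot>\<^bsub>B\<^esub> Farr F f"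
  using Farr_Cmp[of f "Src A f" "Trg A f" g "Trg A g"] assms by (auto simp: hom_set_iff)

lemma Ftwo_nat:
  assumes "f \<in> Arr A" "g \<in> Arr A" "Trg A f = x" "Trg A g = y"
  shows "Ftwo F x y \<cdot>\<^bsub>B\<^esub> (Farr F f \<boxtimes>\<^bsub>B\<^esub> Farr F g) =
        Farr F (f \<boxtimes>\<^bsub>A\<^esub> g) \<cdot>\<^bsub>B\<^esub> Ftwo F (Src A f) (Src A g)"
  using Ftwo_natural[of f "Src A f" x g "Src A g" y] assms by (auto simp: hom_set_iff)

lemma assoc_right:
  assumes [simp]: "x \<in> Obj A" "y \<in> Obj A" "z \<in> Obj A"
  shows "Farr F (Ass A x y z) \<cdot>\<^bsub>B\<^esub> (Ftwo F x (y \<otimes>\<^bsub>A\<^esub> z) \<cdot>\<^bsub>B\<^esub>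
          (Idn B (Fobj F x) \<boxtimes>\<^bsub>B\<^esub> Ftwo F y z)) =
        Ftwo F (x \<otimes>\<^bsub>A\<^esub> y) z \<cdot>\<^bsub>B\<^esub> ((Ftwo F x y \<boxtimes>\<^bsub>B\<^esub> Idn B (Fobj F z)) \<cdot>\<^bsub>B\<^esub>
          Ass B (Fobj F x) (Fobj F y) (Fobj F z))"
  using F_assoc[OF assms] by (simp add: B.comp_assoc)

lemma right_unit_right:
  assumes [simp]: "x \<in> Obj A"
  shows "Farr F (Run A x) \<cdot>\<^bsub>B\<^esub> (Ftwo F x (Unt A) \<cdot>\<^bsub>B\<^esub> (Idn B (Fobj F x) \<boxtimes>\<^bsub>B\<^esub> Fzero F)) =
        Run B (Fobj F x)"
  using F_right_unit[OF assms] by (simp add: B.comp_assoc)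

lemma left_unit_right:
  assumes [simp]: "x \<in> Obj A"
  shows "Farr F (Lun A x) \<cdot>\<^bsub>B\<^esub> (Ftwo F (Unt A) x \<cdot>\<^bsub>B\<^esub> (Fzero F \<boxtimes>\<^bsub>B\<^esub> Idn B (Fobj F x))) =
        Lun B (Fobj F x)"
  using F_left_unit[OF assms] by (simp add: B.comp_assoc)

lemma iso_Farr [simp]: "iso_arrow A f \<Longrightarrow> iso_arrow B (Farr F f)"
  unfolding iso_arrow_def[of B]
  by (rule exI[of _ "Farr F (inv_arrow A f)"])
    (simp add: inverse_arrows_def hom_set_iff A.iso_arrow_in_Arr flip: Farr_comp)

lemma Farr_inv: "iso_arrow A f \<Longrightarrow> Farr F (inv_arrow A f) = inv_arrow B (Farr F f)"
  by (rule B.inv_arrowI[symmetric])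
    (simp add: inverse_arrows_def hom_set_iff A.iso_arrow_in_Arr flip: Farr_comp)

end

text \<open>The axioms with composites nested to the right and typing by \<open>Src\<close> and
  \<open>Trg\<close>, the shape in which simp works.\<close>

lemma sm_functorI:
  assumes "sym_mon_cat A" "sym_mon_cat B"
    and types: "Fobj F \<in> Obj A \<rightarrow>\<^sub>E Obj B" "Farr F \<in> extensional (Arr A)"
      "Ftwo F \<in> extensional (Obj A)" "\<And>x. x \<in> Obj A \<Longrightarrow> Ftwo F x \<in> extensional (Obj A)"
    and Farr: "\<And>f. f \<in> Arr A \<Longrightarrow> Farr F f \<in> Arr B \<and> Src B (Farr F f) = Fobj F (Src A f) \<and>
      Trg B (Farr F f) = Fobj F (Trg A f)"
    and Idn: "\<And>x. x \<in> Obj A \<Longrightarrow> Farr F (Idn A x) = Idn B (Fobj F x)"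
    and Cmp: "\<And>f g. f \<in> Arr A \<Longrightarrow> g \<in> Arr A \<Longrightarrow> Src A g = Trg A f \<Longrightarrow>
        Farr F (g \<cdot>\<^bsub>A\<^esub> f) = Farr F g \<cdot>\<^bsub>B\<^esub> Farr F f"
    and Fzero: "Fzero F \<in> Arr B" "Src B (Fzero F) = Unt B" "Trg B (Fzero F) = Fobj F (Unt A)"
    and Ftwo: "\<And>x y. x \<in> Obj A \<Longrightarrow> y \<in> Obj A \<Longrightarrow> Ftwo F x y \<in> Arr B \<and>
        Src B (Ftwo F x y) = Fobj F x \<otimes>\<^bsub>B\<^esub> Fobj F y \<and> Trg B (Ftwo F x y) = Fobj F (x \<otimes>\<^bsub>A\<^esub> y)"
    and nat: "\<And>f g. f \<in> Arr A \<Longrightarrow> g \<in> Arr A \<Longrightarrow>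
        Ftwo F (Trg A f) (Trg A g) \<cdot>\<^bsub>B\<^esub> (Farr F f \<boxtimes>\<^bsub>B\<^esub> Farr F g) =
        Farr F (f \<boxtimes>\<^bsub>A\<^esub> g) \<cdot>\<^bsub>B\<^esub> Ftwo F (Src A f) (Src A g)"
    and assoc: "\<And>x y z. x \<in> Obj A \<Longrightarrow> y \<in> Obj A \<Longrightarrow> z \<in> Obj A \<Longrightarrow>
        Farr F (Ass A x y z) \<cdot>\<^bsub>B\<^esub> (Ftwo F x (y \<otimes>\<^bsub>A\<^esub> z) \<cdot>\<^bsub>B\<^esub>
          (Idn B (Fobj F x) \<boxtimes>\<^bsub>B\<^esub> Ftwo F y z)) =
        Ftwo F (x \<otimes>\<^bsub>A\<^esub> y) z \<cdot>\<^bsub>B\<^esub> ((Ftwo F x y \<boxtimes>\<^bsub>B\<^esub> Idn B (Fobj F z)) \<cdot>\<^bsub>B\<^esub>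
          Ass B (Fobj F x) (Fobj F y) (Fobj F z))"
    and run: "\<And>x. x \<in> Obj A \<Longrightarrow>
        Farr F (Run A x) \<cdot>\<^bsub>B\<^esub> (Ftwo F x (Unt A) \<cdot>\<^bsub>B\<^esub> (Idn B (Fobj F x) \<boxtimes>\<^bsub>B\<^esub> Fzero F)) =
        Run B (Fobj F x)"
    and lun: "\<And>x. x \<in> Obj A \<Longrightarrow>
        Farr F (Lun A x) \<cdot>\<^bsub>B\<^esub> (Ftwo F (Unt A) x \<cdot>\<^bsub>B\<^esub> (Fzero F \<boxtimes>\<^bsub>B\<^esub> Idn B (Fobj F x))) =
        Lun B (Fobj F x)"
    and swp: "\<And>x y. x \<in> Obj A \<Longrightarrow> y \<in> Obj A \<Longrightarrow>
        Farr F (Swp A x y) \<cdot>\<^bsub>B\<^esub> Ftwo F x y =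
        Ftwo F y x \<cdot>\<^bsub>B\<^esub> Swp B (Fobj F x) (Fobj F y)"
  shows "sm_functor A B F"
proof -
  interpret A: sym_mon_cat A by fact
  interpret B: sym_mon_cat B by fact
  have [simp]: "x \<in> Obj A \<Longrightarrow> Fobj F x \<in> Obj B" for x
    using types(1) by auto
  note [simp] = Farr Ftwo Fzero
  have "Farr F \<in> Arr A \<rightarrow>\<^sub>E Arr B"
    using types(2) by (auto simp: PiE_def)
  moreover have "Ftwo F x \<in> Obj A \<rightarrow>\<^sub>E Arr B" if "x \<in> Obj A" for x
    using types(4)[OF that] that by (auto simp: PiE_def)
  then have "Ftwo F \<in> Obj A \<rightarrow>\<^sub>E Obj A \<rightarrow>\<^sub>E Arr B"
    using types(3) unfolding PiE_def[of "Obj A" "\<lambda>_. Obj A \<rightarrow>\<^sub>E Arr B"] by auto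
  ultimately show ?thesis
    using types(1) nat assoc run lun swp
    by unfold_locales (auto simp: hom_set_iff Idn Cmp B.comp_assoc)
qed

context mon_nat
begin

lemma comp_simps [simp]:
  assumes "x \<in> Obj A"
  shows "\<sigma> x \<in> Arr B" "Src B (\<sigma> x) = Fobj F x" "Trg B (\<sigma> x) = Fobj G x"
  using comp_hom[OF assms] by (auto simp: hom_set_iff)

lemma naturality:
  assumes "f \<in> Arr A" "Trg A f = y"
  shows "\<sigma> y \<cdot>\<^bsub>B\<^esub> Farr F f = Farr G f \<cdot>\<^bsub>B\<^esub> \<sigma> (Src A f)"
  using natural[of f "Src A f" y] assms by (auto simp: hom_set_iff)

end

lemma mon_natI:
  assumes "sm_functor A B F" "sm_functor A B G" "\<sigma> \<in> extensional (Obj A)"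
    and hom: "\<And>x. x \<in> Obj A \<Longrightarrow> \<sigma> x \<in> Arr B \<and> Src B (\<sigma> x) = Fobj F x \<and> Trg B (\<sigma> x) = Fobj G x"
    and nat: "\<And>f. f \<in> Arr A \<Longrightarrow> \<sigma> (Trg A f) \<cdot>\<^bsub>B\<^esub> Farr F f = Farr G f \<cdot>\<^bsub>B\<^esub> \<sigma> (Src A f)"
    and zero: "\<sigma> (Unt A) \<cdot>\<^bsub>B\<^esub> Fzero F = Fzero G"
    and two: "\<And>x y. x \<in> Obj A \<Longrightarrow> y \<in> Obj A \<Longrightarrow>
        \<sigma> (x \<otimes>\<^bsub>A\<^esub> y) \<cdot>\<^bsub>B\<^esub> Ftwo F x y = Ftwo G x y \<cdot>\<^bsub>B\<^esub> (\<sigma> x \<boxtimes>\<^bsub>B\<^esub> \<sigma> y)"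
  shows "mon_nat A B F G \<sigma>"
proof -
  interpret F: sm_functor A B F by fact
  interpret G: sm_functor A B G by fact
  show ?thesis
    using assms(3) hom nat zero two by unfold_locales (auto simp: hom_set_iff PiE_def)
qed

lemma box_simps [simp]:
  "x \<in> Obj A \<Longrightarrow> Fobj (box A B F G) x = Fobj F x \<otimes>\<^bsub>B\<^esub> Fobj G x"
  "f \<in> Arr A \<Longrightarrow> Farr (box A B F G) f = Farr F f \<boxtimes>\<^bsub>B\<^esub> Farr G f"
  "Fzero (box A B F G) = (Fzero F \<boxtimes>\<^bsub>B\<^esub> Fzero G) \<cdot>\<^bsub>B\<^esub> inv_arrow B (Run B (Unt B))"
  "x \<in> Obj A \<Longrightarrow> y \<in> Obj A \<Longrightarrow> Ftwo (box A B F G) x y = (Ftwo F x y \<boxtimes>\<^bsub>B\<^esub> Ftwo G x y) \<cdot>\<^bsub>B\<^esub>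
     interchange B (Fobj F x) (Fobj G x) (Fobj F y) (Fobj G y)"
  by (simp_all add: box_def)

lemma const_unit_simps [simp]:
  "x \<in> Obj A \<Longrightarrow> Fobj (const_unit A B) x = Unt B"
  "f \<in> Arr A \<Longrightarrow> Farr (const_unit A B) f = Idn B (Unt B)"
  "Fzero (const_unit A B) = Idn B (Unt B)"
  "x \<in> Obj A \<Longrightarrow> y \<in> Obj A \<Longrightarrow> Ftwo (const_unit A B) x y = Run B (Unt B)"
  by (simp_all add: const_unit_def)

lemma hom_smc_simps [simp]:
  "Obj (hom_smc A B) = {F. sm_functor A B F}"
  "Src (hom_smc A B) = Nsrc" "Trg (hom_smc A B) = Ntrg"
  "Idn (hom_smc A B) F = mk_smt F F (\<lambda>x\<in>Obj A. Idn B (Fobj F x))"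
  "Cmp (hom_smc A B) \<tau> \<sigma> = mk_smt (Nsrc \<sigma>) (Ntrg \<tau>) (\<lambda>x\<in>Obj A. Nmap \<tau> x \<cdot>\<^bsub>B\<^esub> Nmap \<sigma> x)"
  "OTen (hom_smc A B) = box A B"
  "ATen (hom_smc A B) \<sigma> \<tau> = mk_smt (box A B (Nsrc \<sigma>) (Nsrc \<tau>)) (box A B (Ntrg \<sigma>) (Ntrg \<tau>))
       (\<lambda>x\<in>Obj A. Nmap \<sigma> x \<boxtimes>\<^bsub>B\<^esub> Nmap \<tau> x)"
  "Unt (hom_smc A B) = const_unit A B"
  "Ass (hom_smc A B) F G H = mk_smt (box A B F (box A B G H)) (box A B (box A B F G) H)
       (\<lambda>x\<in>Obj A. Ass B (Fobj F x) (Fobj G x) (Fobj H x))"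
  "Run (hom_smc A B) F = mk_smt (box A B F (const_unit A B)) F (\<lambda>x\<in>Obj A. Run B (Fobj F x))"
  "Lun (hom_smc A B) F = mk_smt (box A B (const_unit A B) F) F (\<lambda>x\<in>Obj A. Lun B (Fobj F x))"
  "Swp (hom_smc A B) F G = mk_smt (box A B F G) (box A B G F)
       (\<lambda>x\<in>Obj A. Swp B (Fobj F x) (Fobj G x))"
  by (simp_all add: hom_smc_def)

lemma hom_smc_Arr_iff: "\<sigma> \<in> Arr (hom_smc A B) \<longleftrightarrow> mon_nat A B (Nsrc \<sigma>) (Ntrg \<sigma>) (Nmap \<sigma>)"
proof
  assume "mon_nat A B (Nsrc \<sigma>) (Ntrg \<sigma>) (Nmap \<sigma>)"
  then show "\<sigma> \<in> Arr (hom_smc A B)"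
    by (cases \<sigma>) (auto simp: hom_smc_def)
qed (auto simp: hom_smc_def)

lemma mk_smt_in_Arr [simp]: "mk_smt F G \<sigma> \<in> Arr (hom_smc A B) \<longleftrightarrow> mon_nat A B F G \<sigma>"
  by (simp add: hom_smc_Arr_iff)

lemma hom_smc_ArrD:
  assumes "\<sigma> \<in> Arr (hom_smc A B)"
  shows "mon_nat A B (Nsrc \<sigma>) (Ntrg \<sigma>) (Nmap \<sigma>)" "sm_functor A B (Nsrc \<sigma>)" "sm_functor A B (Ntrg \<sigma>)"
    "Nmap \<sigma> \<in> extensional (Obj A)"
    "x \<in> Obj A \<Longrightarrow> Nmap \<sigma> x \<in> Arr B" "x \<in> Obj A \<Longrightarrow> Src B (Nmap \<sigma> x) = Fobj (Nsrc \<sigma>) x"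
    "x \<in> Obj A \<Longrightarrow> Trg B (Nmap \<sigma> x) = Fobj (Ntrg \<sigma>) x"
proof -
  show "mon_nat A B (Nsrc \<sigma>) (Ntrg \<sigma>) (Nmap \<sigma>)"
    using assms by (simp add: hom_smc_Arr_iff)
  then interpret mon_nat A B "Nsrc \<sigma>" "Ntrg \<sigma>" "Nmap \<sigma>" .
  show "sm_functor A B (Nsrc \<sigma>)" "sm_functor A B (Ntrg \<sigma>)" "Nmap \<sigma> \<in> extensional (Obj A)"
    using comp_type by (auto simp: PiE_def F.sm_functor_axioms G.sm_functor_axioms)
  show "x \<in> Obj A \<Longrightarrow> Nmap \<sigma> x \<in> Arr B" "x \<in> Obj A \<Longrightarrow> Src B (Nmap \<sigma> x) = Fobj (Nsrc \<sigma>) x"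
    "x \<in> Obj A \<Longrightarrow> Trg B (Nmap \<sigma> x) = Fobj (Ntrg \<sigma>) x"
    by simp_all
qed

lemma smt_eqI:
  fixes \<sigma> \<tau> :: "('o, 'a, 'p, 'b) smt"
  assumes "Nsrc \<sigma> = Nsrc \<tau>" "Ntrg \<sigma> = Ntrg \<tau>"
    "Nmap \<sigma> \<in> extensional X" "Nmap \<tau> \<in> extensional X" "\<And>x. x \<in> X \<Longrightarrow> Nmap \<sigma> x = Nmap \<tau> x"
  shows "\<sigma> = \<tau>"
  using assms extensionalityI[OF assms(3,4)] by (auto intro: smt.equality)

section \<open>The pointwise structure on functors and transformations between two fixed
  categories\<close>

locale smc_pair = A: sym_mon_cat A + B: sym_mon_cat B
  for A :: "('o, 'a) smc" and B :: "('p, 'b) smc" (structure)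
begin

text \<open>Naturality of the interchange brings the structure maps of each functor together, so
  every axiom splits into the axiom of \<open>F\<close> tensored with the axiom of \<open>G\<close>,
  up to a coherence equation for the interchange.\<close>

lemma box_functor:
  assumes "sm_functor A B F" "sm_functor A B G"
  shows "sm_functor A B (box A B F G)"
proof -
  interpret F: sm_functor A B F by fact
  interpret G: sm_functor A B G by fact
  show ?thesis
  proof (rule sm_functorI)
    show "sym_mon_cat A" "sym_mon_cat B" by unfold_locales
  next
    fix f g assume [simp]: "f \<in> Arr A" "g \<in> Arr A"
    show "Ftwo (box A B F G) (Trg A f) (Trg A g) \<cdot> (Farr (box A B F G) f \<boxtimes> Farr (box A B F G) g) =
      Farr (box A B F G) (f \<boxtimes>\<^bsub>A\<^esub> g) \<cdot> Ftwo (box A B F G) (Src A f) (Src A g)"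
      by (simp add: B.comp_assoc B.interchange_nat B.ten_comp2 F.Ftwo_nat G.Ftwo_nat)
  next
    fix x y z assume [simp]: "x \<in> Obj A" "y \<in> Obj A" "z \<in> Obj A"
    let ?H = "box A B F G"
    let ?Fxyz = "Ftwo F (x \<otimes>\<^bsub>A\<^esub> y) z \<cdot> ((Ftwo F x y \<boxtimes> Idn B (Fobj F z)) \<cdot> Ass B (Fobj F x) (Fobj F y) (Fobj F z))"
    let ?Gxyz = "Ftwo G (x \<otimes>\<^bsub>A\<^esub> y) z \<cdot> ((Ftwo G x y \<boxtimes> Idn B (Fobj G z)) \<cdot> Ass B (Fobj G x) (Fobj G y) (Fobj G z))"
    let ?ix = "interchange B (Fobj F x) (Fobj G x)" and ?iyz = "interchange B (Fobj F y) (Fobj G y) (Fobj F z) (Fobj G z)"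
    \<comment> \<open>The identity is split in two, so that the arrow in front of the inner
      interchange is a tensor of tensors, as \<open>interchange_nat\<close> requires.\<close>
    have "Idn B (Fobj F x \<otimes> Fobj G x) \<boxtimes> ((Ftwo F y z \<boxtimes> Ftwo G y z) \<cdot> ?iyz) =
        ((Idn B (Fobj F x) \<boxtimes> Idn B (Fobj G x)) \<boxtimes> (Ftwo F y z \<boxtimes> Ftwo G y z)) \<cdot> (Idn B (Fobj F x \<otimes> Fobj G x) \<boxtimes> ?iyz)"
      by (simp add: B.ten_comp)
    then have "Farr ?H (Ass A x y z) \<cdot> (Ftwo ?H x (y \<otimes>\<^bsub>A\<^esub> z) \<cdot> (Idn B (Fobj ?H x) \<boxtimes> Ftwo ?H y z)) =
       (?Fxyz \<boxtimes> ?Gxyz) \<cdot> (?ix (Fobj F y \<otimes> Fobj F z) (Fobj G y \<otimes> Fobj G z) \<cdot> (Idn B (Fobj F x \<otimes> Fobj G x) \<boxtimes> ?iyz))"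
      by (simp add: B.comp_assoc B.reassoc[OF B.interchange_nat] B.ten_comp2 F.assoc_right G.assoc_right del: B.ATen_Idn)
    also have "\<dots> = (Ftwo F (x \<otimes>\<^bsub>A\<^esub> y) z \<boxtimes> Ftwo G (x \<otimes>\<^bsub>A\<^esub> y) z) \<cdot>
        (((Ftwo F x y \<boxtimes> Idn B (Fobj F z)) \<boxtimes> (Ftwo G x y \<boxtimes> Idn B (Fobj G z))) \<cdot>
        ((Ass B (Fobj F x) (Fobj F y) (Fobj F z) \<boxtimes> Ass B (Fobj G x) (Fobj G y) (Fobj G z)) \<cdot>
        (?ix (Fobj F y \<otimes> Fobj F z) (Fobj G y \<otimes> Fobj G z) \<cdot> (Idn B (Fobj F x \<otimes> Fobj G x) \<boxtimes> ?iyz))))"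
      by (simp add: B.ten_comp2)
    also have "\<dots> = (Ftwo F (x \<otimes>\<^bsub>A\<^esub> y) z \<boxtimes> Ftwo G (x \<otimes>\<^bsub>A\<^esub> y) z) \<cdot>
        (((Ftwo F x y \<boxtimes> Idn B (Fobj F z)) \<boxtimes> (Ftwo G x y \<boxtimes> Idn B (Fobj G z))) \<cdot>
        (interchange B (Fobj F x \<otimes> Fobj F y) (Fobj G x \<otimes> Fobj G y) (Fobj F z) (Fobj G z) \<cdot>
        ((?ix (Fobj F y) (Fobj G y) \<boxtimes> Idn B (Fobj F z \<otimes> Fobj G z)) \<cdot>
        Ass B (Fobj F x \<otimes> Fobj G x) (Fobj F y \<otimes> Fobj G y) (Fobj F z \<otimes> Fobj G z))))"
      by (simp add: B.interchange_assoc)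
    also have "\<dots> = Ftwo ?H (x \<otimes>\<^bsub>A\<^esub> y) z \<cdot> ((Ftwo ?H x y \<boxtimes> Idn B (Fobj ?H z)) \<cdot>
          Ass B (Fobj ?H x) (Fobj ?H y) (Fobj ?H z))"
      using B.interchange_nat[of "Ftwo F x y" "Ftwo G x y" "Idn B (Fobj F z)" "Idn B (Fobj G z)"
          "Fobj F (x \<otimes>\<^bsub>A\<^esub> y)" "Fobj G (x \<otimes>\<^bsub>A\<^esub> y)" "Fobj F z" "Fobj G z", THEN B.reassoc,
          of "(?ix (Fobj F y) (Fobj G y) \<boxtimes> Idn B (Fobj F z \<otimes> Fobj G z)) \<cdot>
            Ass B (Fobj F x \<otimes> Fobj G x) (Fobj F y \<otimes> Fobj G y) (Fobj F z \<otimes> Fobj G z)"]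
      by (simp add: B.comp_assoc B.ten_comp2)
    finally show "Farr ?H (Ass A x y z) \<cdot> (Ftwo ?H x (y \<otimes>\<^bsub>A\<^esub> z) \<cdot> (Idn B (Fobj ?H x) \<boxtimes> Ftwo ?H y z)) =
        Ftwo ?H (x \<otimes>\<^bsub>A\<^esub> y) z \<cdot> ((Ftwo ?H x y \<boxtimes> Idn B (Fobj ?H z)) \<cdot>
          Ass B (Fobj ?H x) (Fobj ?H y) (Fobj ?H z))" .
  next
    fix x assume [simp]: "x \<in> Obj A"
    let ?H = "box A B F G"
    have "Idn B (Fobj ?H x) \<boxtimes> Fzero ?H =
      ((Idn B (Fobj F x) \<boxtimes> Idn B (Fobj G x)) \<boxtimes> (Fzero F \<boxtimes> Fzero G)) \<cdot>
      (Idn B (Fobj F x \<otimes> Fobj G x) \<boxtimes> inv_arrow B (Run B (Unt B)))"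
      by (simp add: B.ten_comp)
    then have "Farr ?H (Run A x) \<cdot> (Ftwo ?H x (Unt A) \<cdot> (Idn B (Fobj ?H x) \<boxtimes> Fzero ?H)) =
      (Run B (Fobj F x) \<boxtimes> Run B (Fobj G x)) \<cdot> (interchange B (Fobj F x) (Fobj G x) (Unt B) (Unt B) \<cdot>
      (Idn B (Fobj F x \<otimes> Fobj G x) \<boxtimes> inv_arrow B (Run B (Unt B))))"
      by (simp add: B.comp_assoc B.reassoc[OF B.interchange_nat] B.ten_comp2 F.right_unit_right G.right_unit_right del: B.ATen_Idn)
    then show "Farr ?H (Run A x) \<cdot> (Ftwo ?H x (Unt A) \<cdot> (Idn B (Fobj ?H x) \<boxtimes> Fzero ?H)) = Run B (Fobj ?H x)"
      by (simp add: B.interchange_units)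
    have "Fzero ?H \<boxtimes> Idn B (Fobj ?H x) =
      ((Fzero F \<boxtimes> Fzero G) \<boxtimes> (Idn B (Fobj F x) \<boxtimes> Idn B (Fobj G x))) \<cdot>
      (inv_arrow B (Run B (Unt B)) \<boxtimes> Idn B (Fobj F x \<otimes> Fobj G x))"
      by (simp add: B.ten_comp)
    then have "Farr ?H (Lun A x) \<cdot> (Ftwo ?H (Unt A) x \<cdot> (Fzero ?H \<boxtimes> Idn B (Fobj ?H x))) =
      (Lun B (Fobj F x) \<boxtimes> Lun B (Fobj G x)) \<cdot> (interchange B (Unt B) (Unt B) (Fobj F x) (Fobj G x) \<cdot>
      (inv_arrow B (Run B (Unt B)) \<boxtimes> Idn B (Fobj F x \<otimes> Fobj G x)))"
      by (simp add: B.comp_assoc B.reassoc[OF B.interchange_nat] B.ten_comp2 F.left_unit_right G.left_unit_right del: B.ATen_Idn)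
    then show "Farr ?H (Lun A x) \<cdot> (Ftwo ?H (Unt A) x \<cdot> (Fzero ?H \<boxtimes> Idn B (Fobj ?H x))) = Lun B (Fobj ?H x)"
      by (simp add: B.interchange_units)
  next
    fix x y assume [simp]: "x \<in> Obj A" "y \<in> Obj A"
    have "((Ftwo F y x \<cdot> Swp B (Fobj F x) (Fobj F y)) \<boxtimes> (Ftwo G y x \<cdot> Swp B (Fobj G x) (Fobj G y))) \<cdot>
        interchange B (Fobj F x) (Fobj G x) (Fobj F y) (Fobj G y) =
      (Ftwo F y x \<boxtimes> Ftwo G y x) \<cdot> ((Swp B (Fobj F x) (Fobj F y) \<boxtimes> Swp B (Fobj G x) (Fobj G y)) \<cdot>
        interchange B (Fobj F x) (Fobj G x) (Fobj F y) (Fobj G y))"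
      by (simp add: B.ten_comp2)
    then show "Farr (box A B F G) (Swp A x y) \<cdot> Ftwo (box A B F G) x y =
        Ftwo (box A B F G) y x \<cdot> Swp B (Fobj (box A B F G) x) (Fobj (box A B F G) y)"
      by (simp add: B.ten_comp2 F.F_sym G.F_sym B.interchange_Swp B.comp_assoc)
  qed (auto simp: box_def F.Farr_comp G.Farr_comp B.ten_comp)
qed

lemma const_functor: "sm_functor A B (const_unit A B)"
proof (rule sm_functorI)
  show "sym_mon_cat A" "sym_mon_cat B" by unfold_locales
qed (auto simp: B.unit_coherence B.Lun_Unt, auto simp: const_unit_def)

lemma mon_nat_Idn: "sm_functor A B F \<Longrightarrow> mon_nat A B F F (\<lambda>x\<in>Obj A. Idn B (Fobj F x))"
proof -
  assume "sm_functor A B F"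
  then interpret F: sm_functor A B F .
  show ?thesis
    by (rule mon_natI) (auto simp: F.sm_functor_axioms)
qed

lemma mon_nat_comp:
  assumes "mon_nat A B F G \<sigma>" "mon_nat A B G H \<tau>"
  shows "mon_nat A B F H (\<lambda>x\<in>Obj A. \<tau> x \<cdot> \<sigma> x)"
proof -
  let ?s = "\<lambda>x\<in>Obj A. \<tau> x \<cdot> \<sigma> x"
  interpret \<sigma>: mon_nat A B F G \<sigma> by fact
  interpret \<tau>: mon_nat A B G H \<tau> by fact
  show ?thesis
  proof (rule mon_natI)
    fix f assume "f \<in> Arr A"
    then show "?s (Trg A f) \<cdot> Farr F f = Farr H f \<cdot> ?s (Src A f)"
      by (simp add: B.comp_assoc \<sigma>.naturality B.reassoc[OF \<tau>.naturality])
  next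
    fix x y assume "x \<in> Obj A" "y \<in> Obj A"
    then show "?s (x \<otimes>\<^bsub>A\<^esub> y) \<cdot> Ftwo F x y =
        Ftwo H x y \<cdot> (?s x \<boxtimes> ?s y)"
      by (simp add: B.comp_assoc \<sigma>.monoidal_two B.reassoc[OF \<tau>.monoidal_two] B.ten_comp)
  qed (auto simp: B.comp_assoc \<sigma>.F.sm_functor_axioms \<tau>.G.sm_functor_axioms \<sigma>.monoidal_zero \<tau>.monoidal_zero)
qed

lemma mon_nat_comp_smt:
  assumes "\<sigma> \<in> Arr (hom_smc A B)" "\<tau> \<in> Arr (hom_smc A B)" "Nsrc \<tau> = Ntrg \<sigma>"
  shows "mon_nat A B (Nsrc \<sigma>) (Ntrg \<tau>) (\<lambda>x\<in>Obj A. Nmap \<tau> x \<cdot> Nmap \<sigma> x)"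
  by (rule mon_nat_comp[where G = "Ntrg \<sigma>"]) (use assms hom_smc_ArrD(1) in metis)+

lemma mon_nat_box:
  assumes "mon_nat A B F G \<sigma>" "mon_nat A B F' G' \<tau>"
  shows "mon_nat A B (box A B F F') (box A B G G') (\<lambda>x\<in>Obj A. \<sigma> x \<boxtimes> \<tau> x)"
proof -
  let ?s = "\<lambda>x\<in>Obj A. \<sigma> x \<boxtimes> \<tau> x"
  interpret \<sigma>: mon_nat A B F G \<sigma> by fact
  interpret \<tau>: mon_nat A B F' G' \<tau> by fact
  show ?thesis
  proof (rule mon_natI)
    show "sm_functor A B (box A B F F')" "sm_functor A B (box A B G G')"
      by (auto intro!: box_functor \<sigma>.F.sm_functor_axioms \<sigma>.G.sm_functor_axioms
        \<tau>.F.sm_functor_axioms \<tau>.G.sm_functor_axioms)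
  next
    fix x y assume [simp]: "x \<in> Obj A" "y \<in> Obj A"
    have "((Ftwo G x y \<cdot> (\<sigma> x \<boxtimes> \<sigma> y)) \<boxtimes> (Ftwo G' x y \<cdot> (\<tau> x \<boxtimes> \<tau> y))) \<cdot>
        interchange B (Fobj F x) (Fobj F' x) (Fobj F y) (Fobj F' y) =
      (Ftwo G x y \<boxtimes> Ftwo G' x y) \<cdot> (((\<sigma> x \<boxtimes> \<sigma> y) \<boxtimes> (\<tau> x \<boxtimes> \<tau> y)) \<cdot>
        interchange B (Fobj F x) (Fobj F' x) (Fobj F y) (Fobj F' y))"
      by (simp add: B.ten_comp2)
    then show "?s (x \<otimes>\<^bsub>A\<^esub> y) \<cdot> Ftwo (box A B F F') x y =
        Ftwo (box A B G G') x y \<cdot> (?s x \<boxtimes> ?s y)"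
      by (simp add: B.comp_assoc B.interchange_nat \<sigma>.monoidal_two \<tau>.monoidal_two B.ten_comp2)
  qed (auto simp: B.ten_comp B.ten_comp2 \<sigma>.naturality \<tau>.naturality \<sigma>.monoidal_zero \<tau>.monoidal_zero)
qed

text \<open>The naturality and monoidality squares are inverted. Pointwise invertible
  transformations thereby become invertible in the internal hom, as its associator and unit
  isomorphisms have to be.\<close>

lemma mon_nat_inv:
  assumes "mon_nat A B F G \<sigma>" and iso [simp]: "\<And>x. x \<in> Obj A \<Longrightarrow> iso_arrow B (\<sigma> x)"
  shows "mon_nat A B G F (\<lambda>x\<in>Obj A. inv_arrow B (\<sigma> x))"
proof -
  let ?s = "\<lambda>x\<in>Obj A. inv_arrow B (\<sigma> x)"
  interpret \<sigma>: mon_nat A B F G \<sigma> by fact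
  show ?thesis
  proof (rule mon_natI)
    fix f assume "f \<in> Arr A"
    then show "?s (Trg A f) \<cdot> Farr G f = Farr F f \<cdot> ?s (Src A f)"
      using B.inv_conj[of "\<sigma> (Src A f)" "\<sigma> (Trg A f)" "Farr F f" "Farr G f"] by (simp add: \<sigma>.naturality)
  next
    fix x y assume "x \<in> Obj A" "y \<in> Obj A"
    then show "?s (x \<otimes>\<^bsub>A\<^esub> y) \<cdot> Ftwo G x y =
        Ftwo F x y \<cdot> (?s x \<boxtimes> ?s y)"
      using B.inv_conj[of "\<sigma> x \<boxtimes> \<sigma> y" "\<sigma> (x \<otimes>\<^bsub>A\<^esub> y)" "Ftwo F x y" "Ftwo G x y"] by (simp add: \<sigma>.monoidal_two)
  next
    show "?s (Unt A) \<cdot> Fzero G = Fzero F"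
      by (simp flip: \<sigma>.monoidal_zero)
  qed (auto simp: \<sigma>.F.sm_functor_axioms \<sigma>.G.sm_functor_axioms)
qed

lemma mon_nat_Ass:
  assumes "sm_functor A B F" "sm_functor A B G" "sm_functor A B H"
  shows "mon_nat A B (box A B F (box A B G H)) (box A B (box A B F G) H)
       (\<lambda>x\<in>Obj A. Ass B (Fobj F x) (Fobj G x) (Fobj H x))"
proof -
  let ?s = "\<lambda>x\<in>Obj A. Ass B (Fobj F x) (Fobj G x) (Fobj H x)"
  let ?K = "box A B F (box A B G H)"
  let ?L = "box A B (box A B F G) H"
  interpret F: sm_functor A B F by fact
  interpret G: sm_functor A B G by fact
  interpret H: sm_functor A B H by fact
  show ?thesis
  proof (rule mon_natI)
    show "sm_functor A B (?K)" "sm_functor A B (?L)"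
      by (intro box_functor assms)+
  next
    show "?s (Unt A) \<cdot> Fzero (?K) =
        Fzero (?L)"
    proof -
      let ?r = "inv_arrow B (Run B (Unt B))"
      have "Fzero F \<boxtimes> ((Fzero G \<boxtimes> Fzero H) \<cdot> ?r) = (Fzero F \<boxtimes> (Fzero G \<boxtimes> Fzero H)) \<cdot> (Idn B (Unt B) \<boxtimes> ?r)"
        "((Fzero F \<boxtimes> Fzero G) \<cdot> ?r) \<boxtimes> Fzero H = ((Fzero F \<boxtimes> Fzero G) \<boxtimes> Fzero H) \<cdot> (?r \<boxtimes> Idn B (Unt B))"
        by (simp_all add: B.ten_comp)
      then show ?thesis
        by (simp add: B.comp_assoc B.reassoc[OF B.Ass_nat] B.unit_coherence)
    qed
  next
    fix x y assume [simp]: "x \<in> Obj A" "y \<in> Obj A"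
    let ?F = "Ftwo F x y" and ?G = "Ftwo G x y" and ?H = "Ftwo H x y"
    let ?i = "interchange B (Fobj G x) (Fobj H x) (Fobj G y) (Fobj H y)"
    let ?j = "interchange B (Fobj F x) (Fobj G x) (Fobj F y) (Fobj G y)"
    have "?F \<boxtimes> ((?G \<boxtimes> ?H) \<cdot> ?i) = (?F \<boxtimes> (?G \<boxtimes> ?H)) \<cdot> (Idn B (Fobj F x \<otimes> Fobj F y) \<boxtimes> ?i)"
      "((?F \<boxtimes> ?G) \<cdot> ?j) \<boxtimes> ?H = ((?F \<boxtimes> ?G) \<boxtimes> ?H) \<cdot> (?j \<boxtimes> Idn B (Fobj H x \<otimes> Fobj H y))"
      by (simp_all add: B.ten_comp)
    then show "?s (x \<otimes>\<^bsub>A\<^esub> y) \<cdot> Ftwo (?K) x y =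
      Ftwo (?L) x y \<cdot>
      (?s x \<boxtimes> ?s y)"
      by (simp add: B.comp_assoc B.reassoc[OF B.Ass_nat] B.interchange_Ass)
  qed (auto simp: B.Ass_nat)
qed

lemma mon_nat_Run:
  assumes "sm_functor A B F"
  shows "mon_nat A B (box A B F (const_unit A B)) F (\<lambda>x\<in>Obj A. Run B (Fobj F x))"
proof -
  let ?s = "\<lambda>x\<in>Obj A. Run B (Fobj F x)"
  interpret F: sm_functor A B F by fact
  show ?thesis
  proof (rule mon_natI)
    show "sm_functor A B (box A B F (const_unit A B))" "sm_functor A B F"
      by (intro box_functor assms const_functor)+
  next
    fix x y assume [simp]: "x \<in> Obj A" "y \<in> Obj A"
    have "Ftwo F x y \<boxtimes> Run B (Unt B) = (Ftwo F x y \<boxtimes> Idn B (Unt B)) \<cdot> (Idn B (Fobj F x \<otimes> Fobj F y) \<boxtimes> Run B (Unt B))"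
      by (simp add: B.ten_comp)
    then show "?s (x \<otimes>\<^bsub>A\<^esub> y) \<cdot> Ftwo (box A B F (const_unit A B)) x y =
       Ftwo F x y \<cdot> (?s x \<boxtimes> ?s y)"
      by (simp add: B.comp_assoc B.reassoc[OF B.Run_nat] B.interchange_units)
  qed (auto simp: B.Run_nat B.reassoc[OF B.Run_nat] B.comp_assoc)
qed

lemma mon_nat_Lun:
  assumes "sm_functor A B F"
  shows "mon_nat A B (box A B (const_unit A B) F) F (\<lambda>x\<in>Obj A. Lun B (Fobj F x))"
proof -
  let ?s = "\<lambda>x\<in>Obj A. Lun B (Fobj F x)"
  interpret F: sm_functor A B F by fact
  show ?thesis
  proof (rule mon_natI)
    show "sm_functor A B (box A B (const_unit A B) F)" "sm_functor A B F"
      by (intro box_functor assms const_functor)+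
  next
    fix x y assume [simp]: "x \<in> Obj A" "y \<in> Obj A"
    have "Run B (Unt B) \<boxtimes> Ftwo F x y = (Idn B (Unt B) \<boxtimes> Ftwo F x y) \<cdot> (Run B (Unt B) \<boxtimes> Idn B (Fobj F x \<otimes> Fobj F y))"
      by (simp add: B.ten_comp)
    then show "?s (x \<otimes>\<^bsub>A\<^esub> y) \<cdot> Ftwo (box A B (const_unit A B) F) x y =
       Ftwo F x y \<cdot> (?s x \<boxtimes> ?s y)"
      by (simp add: B.comp_assoc B.reassoc[OF B.Lun_nat] B.interchange_units)
  qed (auto simp: B.Lun_nat B.reassoc[OF B.Lun_nat] B.comp_assoc B.Lun_Unt)
qed

lemma mon_nat_Swp:
  assumes "sm_functor A B F" "sm_functor A B G"
  shows "mon_nat A B (box A B F G) (box A B G F) (\<lambda>x\<in>Obj A. Swp B (Fobj F x) (Fobj G x))"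
proof -
  interpret F: sm_functor A B F by fact
  interpret G: sm_functor A B G by fact
  show ?thesis
  proof (rule mon_natI)
    show "sm_functor A B (box A B F G)" "sm_functor A B (box A B G F)"
      by (intro box_functor assms)+
  qed (auto simp: B.Swp_nat B.reassoc[OF B.Swp_nat] B.comp_assoc B.unit_coherence B.Swp_interchange)
qed

lemma hom_smc_inverse:
  assumes "\<sigma> \<in> Arr (hom_smc A B)" "\<And>x. x \<in> Obj A \<Longrightarrow> iso_arrow B (Nmap \<sigma> x)"
  shows "inverse_arrows (hom_smc A B) \<sigma> (mk_smt (Ntrg \<sigma>) (Nsrc \<sigma>) (\<lambda>x\<in>Obj A. inv_arrow B (Nmap \<sigma> x)))"
  using assms mon_nat_inv[of "Nsrc \<sigma>" "Ntrg \<sigma>" "Nmap \<sigma>"]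
  by (auto simp: inverse_arrows_def hom_set_iff hom_smc_Arr_iff hom_smc_ArrD[OF assms(1)] intro!: restrict_ext)

lemma hom_smc_iso:
  "\<sigma> \<in> Arr (hom_smc A B) \<Longrightarrow> (\<And>x. x \<in> Obj A \<Longrightarrow> iso_arrow B (Nmap \<sigma> x)) \<Longrightarrow> iso_arrow (hom_smc A B) \<sigma>"
  using hom_smc_inverse by (auto simp: iso_arrow_def)

text \<open>Equality of transformations is pointwise, so every equation is the one of
  \<open>B\<close> at each object of \<open>A\<close>. The weight lies in the preceding lemmas, by
  which the structure arrows are monoidal transformations.\<close>

theorem hom_smc_sym_mon_cat: "sym_mon_cat (hom_smc A B)"
proof -
  note [simp] = hom_set_iff hom_smc_ArrD sm_functor.Fobj_Obj
  note [intro] = box_functor const_functor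
  note e = smt_eqI[of _ _ "Obj A"]
  interpret category "hom_smc A B"
    by unfold_locales
      (auto simp: B.comp_assoc intro!: e mon_nat_Idn mon_nat_comp_smt)
  show ?thesis
    by unfold_locales
      (auto simp: B.comp_assoc B.ten_comp B.Ass_nat B.Run_nat B.Lun_nat B.Swp_nat B.pentagon_right
        B.hexagon_right B.triangle B.Swp_unit
        intro!: e mon_nat_box mon_nat_Ass mon_nat_Run mon_nat_Lun mon_nat_Swp hom_smc_iso)
qed

end

section \<open>Composition of functors\<close>

lemma smf_comp_simps [simp]:
  "x \<in> Obj A \<Longrightarrow> Fobj (smf_comp A C G F) x = Fobj G (Fobj F x)"
  "f \<in> Arr A \<Longrightarrow> Farr (smf_comp A C G F) f = Farr G (Farr F f)"
  "Fzero (smf_comp A C G F) = Farr G (Fzero F) \<cdot>\<^bsub>C\<^esub> Fzero G"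
  "x \<in> Obj A \<Longrightarrow> y \<in> Obj A \<Longrightarrow> Ftwo (smf_comp A C G F) x y =
    Farr G (Ftwo F x y) \<cdot>\<^bsub>C\<^esub> Ftwo G (Fobj F x) (Fobj F y)"
  by (simp_all add: smf_comp_def)

lemma smf_id_simps [simp]:
  "x \<in> Obj A \<Longrightarrow> Fobj (smf_id A) x = x"
  "f \<in> Arr A \<Longrightarrow> Farr (smf_id A) f = f"
  "Fzero (smf_id A) = Idn A (Unt A)"
  "x \<in> Obj A \<Longrightarrow> y \<in> Obj A \<Longrightarrow> Ftwo (smf_id A) x y = Idn A (x \<otimes>\<^bsub>A\<^esub> y)"
  by (simp_all add: smf_id_def)

lemma smf_id_functor: "sym_mon_cat A \<Longrightarrow> sm_functor A A (smf_id A)"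
proof -
  assume "sym_mon_cat A"
  then interpret sym_mon_cat A .
  show ?thesis
    by (rule sm_functorI) (auto simp: sym_mon_cat_axioms, auto simp: smf_id_def)
qed

lemma smf_comp_functor:
  fixes A :: "('o, 'a) smc" and B :: "('p, 'b) smc" and C :: "('q, 'c) smc" (structure)
  assumes "sm_functor A B F" "sm_functor B C G"
  shows "sm_functor A C (smf_comp A C G F)"
proof -
  interpret F: sm_functor A B F by fact
  interpret G: sm_functor B C G by fact
  let ?H = "smf_comp A C G F"
  show ?thesis
  proof (rule sm_functorI)
    show "sym_mon_cat A" "sym_mon_cat C" by unfold_locales
  next
    fix f g assume [simp]: "f \<in> Arr A" "g \<in> Arr A"
    have "Farr G (Ftwo F (Trg A f) (Trg A g)) \<cdot> Farr G (Farr F f \<boxtimes>\<^bsub>B\<^esub> Farr F g) =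
        Farr G (Farr F (f \<boxtimes>\<^bsub>A\<^esub> g)) \<cdot> Farr G (Ftwo F (Src A f) (Src A g))"
      by (simp add: F.Ftwo_nat flip: G.Farr_comp)
    then show "Ftwo ?H (Trg A f) (Trg A g) \<cdot> (Farr ?H f \<boxtimes> Farr ?H g) =
      Farr ?H (f \<boxtimes>\<^bsub>A\<^esub> g) \<cdot> Ftwo ?H (Src A f) (Src A g)"
      by (simp add: G.B.comp_assoc G.Ftwo_nat G.B.reassoc[of "Farr G (Ftwo F (Trg A f) (Trg A g))"])
  next
    fix x y z assume [simp]: "x \<in> Obj A" "y \<in> Obj A" "z \<in> Obj A"
    let ?x = "Fobj F x" and ?y = "Fobj F y" and ?z = "Fobj F z"
    \<comment> \<open>The identity is written as the image of an identity, so that naturality of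
      \<open>Ftwo G\<close> applies to the pair.\<close>
    have "Idn C (Fobj G ?x) \<boxtimes> Ftwo ?H y z =
        (Farr G (Idn B ?x) \<boxtimes> Farr G (Ftwo F y z)) \<cdot> (Idn C (Fobj G ?x) \<boxtimes> Ftwo G ?y ?z)"
      by (simp add: G.B.ten_comp)
    then have "Farr ?H (Ass A x y z) \<cdot> (Ftwo ?H x (y \<otimes>\<^bsub>A\<^esub> z) \<cdot> (Idn C (Fobj ?H x) \<boxtimes> Ftwo ?H y z)) =
      Farr G (Farr F (Ass A x y z) \<cdot>\<^bsub>B\<^esub> (Ftwo F x (y \<otimes>\<^bsub>A\<^esub> z) \<cdot>\<^bsub>B\<^esub> (Idn B ?x \<boxtimes>\<^bsub>B\<^esub> Ftwo F y z))) \<cdot>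
      (Ftwo G ?x (?y \<otimes>\<^bsub>B\<^esub> ?z) \<cdot> (Idn C (Fobj G ?x) \<boxtimes> Ftwo G ?y ?z))"
      by (simp add: G.B.comp_assoc G.B.reassoc[OF G.Ftwo_nat] G.Farr_comp del: G.Farr_Idn)
    also have "\<dots> = Farr G (Ftwo F (x \<otimes>\<^bsub>A\<^esub> y) z) \<cdot> (Farr G (Ftwo F x y \<boxtimes>\<^bsub>B\<^esub> Idn B ?z) \<cdot>
      (Farr G (Ass B ?x ?y ?z) \<cdot> (Ftwo G ?x (?y \<otimes>\<^bsub>B\<^esub> ?z) \<cdot> (Idn C (Fobj G ?x) \<boxtimes> Ftwo G ?y ?z))))"
      by (simp add: F.assoc_right G.Farr_comp G.B.comp_assoc)
    also have "\<dots> = Farr G (Ftwo F (x \<otimes>\<^bsub>A\<^esub> y) z) \<cdot> ((Farr G (Ftwo F x y \<boxtimes>\<^bsub>B\<^esub> Idn B ?z) \<cdot>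
      Ftwo G (?x \<otimes>\<^bsub>B\<^esub> ?y) ?z) \<cdot> ((Ftwo G ?x ?y \<boxtimes> Idn C (Fobj G ?z)) \<cdot> Ass C (Fobj G ?x) (Fobj G ?y) (Fobj G ?z)))"
      by (simp add: G.assoc_right G.B.comp_assoc)
    also have "\<dots> = Ftwo ?H (x \<otimes>\<^bsub>A\<^esub> y) z \<cdot> ((Ftwo ?H x y \<boxtimes> Idn C (Fobj ?H z)) \<cdot>
          Ass C (Fobj ?H x) (Fobj ?H y) (Fobj ?H z))"
      using G.Ftwo_nat[of "Ftwo F x y" "Idn B ?z" "Fobj F (x \<otimes>\<^bsub>A\<^esub> y)" ?z, symmetric]
      by (simp add: G.B.comp_assoc G.B.ten_comp2)
    finally show "Farr ?H (Ass A x y z) \<cdot> (Ftwo ?H x (y \<otimes>\<^bsub>A\<^esub> z) \<cdot> (Idn C (Fobj ?H x) \<boxtimes> Ftwo ?H y z)) =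
        Ftwo ?H (x \<otimes>\<^bsub>A\<^esub> y) z \<cdot> ((Ftwo ?H x y \<boxtimes> Idn C (Fobj ?H z)) \<cdot>
          Ass C (Fobj ?H x) (Fobj ?H y) (Fobj ?H z))" .
  next
    fix x assume [simp]: "x \<in> Obj A"
    let ?x = "Fobj F x"
    have "Idn C (Fobj G ?x) \<boxtimes> Fzero ?H =
        (Farr G (Idn B ?x) \<boxtimes> Farr G (Fzero F)) \<cdot> (Idn C (Fobj G ?x) \<boxtimes> Fzero G)"
      by (simp add: G.B.ten_comp)
    then have "Farr ?H (Run A x) \<cdot> (Ftwo ?H x (Unt A) \<cdot> (Idn C (Fobj ?H x) \<boxtimes> Fzero ?H)) =
      Farr G (Farr F (Run A x) \<cdot>\<^bsub>B\<^esub> (Ftwo F x (Unt A) \<cdot>\<^bsub>B\<^esub> (Idn B ?x \<boxtimes>\<^bsub>B\<^esub> Fzero F))) \<cdot>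
      (Ftwo G ?x (Unt B) \<cdot> (Idn C (Fobj G ?x) \<boxtimes> Fzero G))"
      by (simp add: G.B.comp_assoc G.B.reassoc[OF G.Ftwo_nat] G.Farr_comp del: G.Farr_Idn)
    then show "Farr ?H (Run A x) \<cdot> (Ftwo ?H x (Unt A) \<cdot> (Idn C (Fobj ?H x) \<boxtimes> Fzero ?H)) = Run C (Fobj ?H x)"
      by (simp add: F.right_unit_right G.right_unit_right)
    have "Fzero ?H \<boxtimes> Idn C (Fobj G ?x) =
        (Farr G (Fzero F) \<boxtimes> Farr G (Idn B ?x)) \<cdot> (Fzero G \<boxtimes> Idn C (Fobj G ?x))"
      by (simp add: G.B.ten_comp)
    then have "Farr ?H (Lun A x) \<cdot> (Ftwo ?H (Unt A) x \<cdot> (Fzero ?H \<boxtimes> Idn C (Fobj ?H x))) =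
      Farr G (Farr F (Lun A x) \<cdot>\<^bsub>B\<^esub> (Ftwo F (Unt A) x \<cdot>\<^bsub>B\<^esub> (Fzero F \<boxtimes>\<^bsub>B\<^esub> Idn B ?x))) \<cdot>
      (Ftwo G (Unt B) ?x \<cdot> (Fzero G \<boxtimes> Idn C (Fobj G ?x)))"
      by (simp add: G.B.comp_assoc G.B.reassoc[OF G.Ftwo_nat] G.Farr_comp del: G.Farr_Idn)
    then show "Farr ?H (Lun A x) \<cdot> (Ftwo ?H (Unt A) x \<cdot> (Fzero ?H \<boxtimes> Idn C (Fobj ?H x))) = Lun C (Fobj ?H x)"
      by (simp add: F.left_unit_right G.left_unit_right)
  next
    fix x y assume [simp]: "x \<in> Obj A" "y \<in> Obj A"
    have "Farr G (Farr F (Swp A x y)) \<cdot> Farr G (Ftwo F x y) = Farr G (Ftwo F y x) \<cdot> Farr G (Swp B (Fobj F x) (Fobj F y))"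
      by (simp add: F.F_sym flip: G.Farr_comp)
    then show "Farr ?H (Swp A x y) \<cdot> Ftwo ?H x y = Ftwo ?H y x \<cdot> Swp C (Fobj ?H x) (Fobj ?H y)"
      by (simp add: G.B.comp_assoc G.F_sym G.B.reassoc[of "Farr G (Farr F (Swp A x y))"])
  qed (auto simp: smf_comp_def F.Farr_comp G.Farr_comp)
qed

section \<open>Presented symmetric monoidal categories\<close>

lemma words_simps [simp]:
  "WUnit \<in> words S" "WTen X Y \<in> words S \<longleftrightarrow> X \<in> words S \<and> Y \<in> words S" "WGen x \<in> words S \<longleftrightarrow> x \<in> gobj S"
  by (auto simp: words_def)

lemma tten_simps [simp]:
  "tsrc S (tten S p q) = WTen (tsrc S p) (tsrc S q)"
  "ttrg S (tten S p q) = WTen (ttrg S p) (ttrg S q)"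
  by (simp_all add: tten_def)

lemma tinterchange_simps [simp]:
  "wf_trm S (tinterchange W X Y Z) \<longleftrightarrow> W \<in> words S \<and> X \<in> words S \<and> Y \<in> words S \<and> Z \<in> words S"
  "tsrc S (tinterchange W X Y Z) = WTen (WTen W X) (WTen Y Z)"
  "ttrg S (tinterchange W X Y Z) = WTen (WTen W Y) (WTen X Z)"
  by (auto simp: tinterchange_def)

locale presentation =
  fixes S :: "('g, 'e) signature" and R :: "(('g, 'e) trm \<times> ('g, 'e) trm) set"
  assumes gen_words: "e \<in> garr S \<Longrightarrow> gsrc S e \<in> words S \<and> gtrg S e \<in> words S"
    and rel_typed: "(p, q) \<in> R \<Longrightarrow> wf_trm S p \<and> wf_trm S q \<and> tsrc S p = tsrc S q \<and> ttrg S p = ttrg S q"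
begin

lemma wf_words [simp]: "wf_trm S p \<Longrightarrow> tsrc S p \<in> words S" "wf_trm S p \<Longrightarrow> ttrg S p \<in> words S"
  by (induction p) (auto simp: gen_words)

lemma wf_tten [simp]: "wf_trm S (tten S p q) \<longleftrightarrow> wf_trm S p \<and> wf_trm S q"
  by (auto simp: tten_def)

lemma cong_typed:
  "cong S R p q \<Longrightarrow> wf_trm S p \<and> wf_trm S q \<and> tsrc S p = tsrc S q \<and> ttrg S p = ttrg S q"
proof (induction rule: cong.induct)
  case (rel p q)
  then show ?case by (rule rel_typed)
qed simp_all

abbreviation "P \<equiv> presented S R"
abbreviation "cl \<equiv> cls S R"

lemma cls_eq_iff: "wf_trm S q \<Longrightarrow> cl p = cl q \<longleftrightarrow> cong S R p q"
  by (auto simp: cls_def intro: cong.refl cong.sym cong.trans)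

lemma cls_eqI: "cong S R p q \<Longrightarrow> cl p = cl q"
  using cls_eq_iff cong_typed by blast

lemma in_cls: "wf_trm S p \<Longrightarrow> p \<in> cl p"
  by (auto simp: cls_def intro: cong.refl)

text \<open>Justifies \<open>the_elem\<close> in \<open>presented\<close> and
  \<open>strict_ext\<close>: a function that is constant on a class has one value there.\<close>

lemma cls_the_elem:
  assumes "wf_trm S p" "\<And>p'. cong S R p p' \<Longrightarrow> f p' = f p"
  shows "the_elem (f ` cl p) = f p"
proof -
  have "f q = f p" if "q \<in> cl p" for q
    by (rule assms(2)) (use that in \<open>simp add: cls_def\<close>)
  with in_cls[OF assms(1)] have "f ` cl p = {f p}"
    by blast
  then show ?thesis by simp
qed

lemma presented_simps [simp]:
  "Obj P = words S" "Idn P X = cl (TId X)" "OTen P X Y = WTen X Y" "Unt P = WUnit"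
  "Ass P X Y Z = cl (TAss X Y Z)" "Run P X = cl (TRun X)" "Lun P X = cl (TLun X)" "Swp P X Y = cl (TSwp X Y)"
  by (simp_all add: presented_def)

lemma cls_Arr [simp]: "wf_trm S p \<Longrightarrow> cl p \<in> Arr P"
  by (simp add: presented_def)

lemma Arr_cases: "f \<in> Arr P \<Longrightarrow> (\<And>p. wf_trm S p \<Longrightarrow> f = cl p \<Longrightarrow> thesis) \<Longrightarrow> thesis"
  by (auto simp: presented_def)

lemma cls_Src_Trg [simp]:
  assumes "wf_trm S p"
  shows "Src P (cl p) = tsrc S p" "Trg P (cl p) = ttrg S p"
proof -
  have "the_elem (tsrc S ` cl p) = tsrc S p" "the_elem (ttrg S ` cl p) = ttrg S p"
    by (rule cls_the_elem[OF assms]; drule cong_typed; simp)+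
  then show "Src P (cl p) = tsrc S p" "Trg P (cl p) = ttrg S p"
    by (simp_all add: presented_def)
qed

text \<open>Composition is defined as a union over all representatives; congruence makes the united
  classes equal, so the union is the class of any one composite.\<close>

lemma cls_Cmp:
  assumes "wf_trm S (TCmp q p)"
  shows "cl q \<cdot>\<^bsub>P\<^esub> cl p = cl (TCmp q p)"
proof -
  have "cl (TCmp q' p') = cl (TCmp q p)" if "cong S R q q'" "cong S R p p'" for p' q'
    using cong.comp[OF that(2,1) assms] cls_eqI by metis
  then have "(\<Union>q'\<in>cl q. \<Union>p'\<in>cl p. cl (TCmp q' p')) = (\<Union>q'\<in>cl q. \<Union>p'\<in>cl p. cl (TCmp q p))"
    by (auto simp: cls_def)
  also have "\<dots> = cl (TCmp q p)"
    using in_cls assms by auto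
  finally show ?thesis
    by (simp add: presented_def)
qed

lemma cong_tten:
  assumes "cong S R p p'" "cong S R q q'"
  shows "cong S R (tten S p q) (tten S p' q')"
  using assms cong_typed[OF assms(1)] cong_typed[OF assms(2)]
  by (auto simp: tten_def intro!: cong.comp cong.left cong.right)

lemma cls_ATen:
  assumes "wf_trm S p" "wf_trm S q"
  shows "cl p \<boxtimes>\<^bsub>P\<^esub> cl q = cl (tten S p q)"
proof -
  have "cl (tten S p' q') = cl (tten S p q)" if "cong S R q q'" "cong S R p p'" for p' q'
    using cong_tten[OF that(2,1)] cls_eqI by metis
  then have "(\<Union>p'\<in>cl p. \<Union>q'\<in>cl q. cl (tten S p' q')) = (\<Union>p'\<in>cl p. \<Union>q'\<in>cl q. cl (tten S p q))"
    by (auto simp: cls_def)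
  also have "\<dots> = cl (tten S p q)"
    using in_cls assms by auto
  finally show ?thesis
    by (simp add: presented_def)
qed

lemma presented_category: "category P"
proof
  fix f assume "f \<in> Arr P"
  then show "Src P f \<in> Obj P" "Trg P f \<in> Obj P"
    by (auto elim!: Arr_cases)
next
  fix X assume "X \<in> Obj P"
  then show "Idn P X \<in> hom_set P X X"
    by (auto simp: hom_set_iff)
next
  fix f g x y z assume "f \<in> hom_set P x y" "g \<in> hom_set P y z"
  then show "g \<cdot>\<^bsub>P\<^esub> f \<in> hom_set P x z"
    by (auto simp: hom_set_iff cls_Cmp elim!: Arr_cases)
next
  fix f x y assume "f \<in> hom_set P x y"
  then show "Idn P y \<cdot>\<^bsub>P\<^esub> f = f" "f \<cdot>\<^bsub>P\<^esub> Idn P x = f"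
    by (auto simp: hom_set_iff cls_Cmp cong.id_left[THEN cls_eqI] cong.id_right[THEN cls_eqI] elim!: Arr_cases)
next
  fix f g h w x y z assume "f \<in> hom_set P w x" "g \<in> hom_set P x y" "h \<in> hom_set P y z"
  then show "h \<cdot>\<^bsub>P\<^esub> (g \<cdot>\<^bsub>P\<^esub> f) = (h \<cdot>\<^bsub>P\<^esub> g) \<cdot>\<^bsub>P\<^esub> f"
    by (auto simp: hom_set_iff cls_Cmp cong.assoc[THEN cls_eqI] elim!: Arr_cases)
qed

sublocale P: category P
  by (rule presented_category)

lemma cls_tten: "wf_trm S p \<Longrightarrow> wf_trm S q \<Longrightarrow>
    cl (tten S p q) = cl (TLeft (ttrg S p) q) \<cdot>\<^bsub>P\<^esub> cl (TRight p (tsrc S q))"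
  by (simp add: cls_Cmp tten_def)

text \<open>The primitive operations on terms are one-sided whiskerings. They are tensors with
  identities, because the other factor of \<open>tten\<close> is an identity class.\<close>

lemma cls_tten_Id:
  assumes "wf_trm S p" "X \<in> words S"
  shows "cl (tten S p (TId X)) = cl (TRight p X)" "cl (tten S (TId X) p) = cl (TLeft X p)"
proof -
  have "cl (TLeft (ttrg S p) (TId X)) = cl (TId (WTen (ttrg S p) X))"
    "cl (TRight (TId X) (tsrc S p)) = cl (TId (WTen X (tsrc S p)))"
    using assms by (auto simp: cong.left_id[THEN cls_eqI] cong.right_id[THEN cls_eqI])
  then show "cl (tten S p (TId X)) = cl (TRight p X)" "cl (tten S (TId X) p) = cl (TLeft X p)"
    using assms P.Idn_Cmp[of "cl (TRight p X)"] P.Cmp_Idn[of "cl (TLeft X p)"] by (simp_all add: cls_tten)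
qed

lemma cls_bifunctor: "wf_trm S p \<Longrightarrow> wf_trm S q \<Longrightarrow>
    cl (TLeft (ttrg S p) q) \<cdot>\<^bsub>P\<^esub> cl (TRight p (tsrc S q)) = cl (TRight p (ttrg S q)) \<cdot>\<^bsub>P\<^esub> cl (TLeft (tsrc S p) q)"
  by (simp add: cls_Cmp cls_eqI cong.bifunctor)

text \<open>Functoriality of the two whiskerings leaves a composite of four arrows, whose middle two
  change places by bifunctoriality.\<close>

lemma cls_tten_TCmp:
  assumes "wf_trm S p" "wf_trm S q" "wf_trm S p'" "wf_trm S q'" "tsrc S q = ttrg S p" "tsrc S q' = ttrg S p'"
  shows "cl (tten S (TCmp q p) (TCmp q' p')) = cl (tten S q q') \<cdot>\<^bsub>P\<^esub> cl (tten S p p')"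
proof -
  let ?z = "ttrg S q" and ?x' = "tsrc S p'" and ?y = "ttrg S p" and ?y' = "ttrg S p'"
  have "cl (TLeft ?z (TCmp q' p')) = cl (TLeft ?z q') \<cdot>\<^bsub>P\<^esub> cl (TLeft ?z p')"
    "cl (TRight (TCmp q p) ?x') = cl (TRight q ?x') \<cdot>\<^bsub>P\<^esub> cl (TRight p ?x')"
    using assms by (auto simp: cls_Cmp cong.left_comp[THEN cls_eqI] cong.right_comp[THEN cls_eqI])
  then have "cl (tten S (TCmp q p) (TCmp q' p')) =
      cl (TLeft ?z q') \<cdot>\<^bsub>P\<^esub> ((cl (TLeft ?z p') \<cdot>\<^bsub>P\<^esub> cl (TRight q ?x')) \<cdot>\<^bsub>P\<^esub> cl (TRight p ?x'))"
    using assms by (simp add: cls_tten P.comp_assoc)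
  also have "\<dots> = cl (TLeft ?z q') \<cdot>\<^bsub>P\<^esub> ((cl (TRight q ?y') \<cdot>\<^bsub>P\<^esub> cl (TLeft ?y p')) \<cdot>\<^bsub>P\<^esub> cl (TRight p ?x'))"
    using assms cls_bifunctor[of q p'] by simp
  also have "\<dots> = cl (tten S q q') \<cdot>\<^bsub>P\<^esub> cl (tten S p p')"
    using assms by (simp add: cls_tten P.comp_assoc)
  finally show ?thesis .
qed

lemma cls_inverse:
  assumes "cong S R (TCmp q p) (TId (tsrc S p))" "cong S R (TCmp p q) (TId (ttrg S p))"
  shows "inverse_arrows P (cl p) (cl q)"
  using cong_typed[OF assms(1)] cong_typed[OF assms(2)] assms[THEN cls_eqI]
  by (auto simp: inverse_arrows_def hom_set_iff cls_Cmp)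

lemma cls_inverse_canonical:
  "X \<in> words S \<Longrightarrow> Y \<in> words S \<Longrightarrow> Z \<in> words S \<Longrightarrow> inverse_arrows P (cl (TAss X Y Z)) (cl (TAssInv X Y Z))"
  "X \<in> words S \<Longrightarrow> inverse_arrows P (cl (TRun X)) (cl (TRunInv X))"
  "X \<in> words S \<Longrightarrow> inverse_arrows P (cl (TLun X)) (cl (TLunInv X))"
  by (auto intro!: cls_inverse cong.ass_inv_left cong.ass_inv_right cong.run_inv_left cong.run_inv_right
      cong.lun_inv_left cong.lun_inv_right)

lemmas cls_inv_arrow [simp] = cls_inverse_canonical[THEN P.inv_arrowI]

theorem presented_sym_mon_cat: "sym_mon_cat P"
proof (intro sym_mon_cat.intro sym_mon_cat_axioms.intro)
  show "category P" by (rule presented_category)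
next
  fix f g x x' y y' assume "f \<in> hom_set P x x'" "g \<in> hom_set P y y'"
  then show "f \<boxtimes>\<^bsub>P\<^esub> g \<in> hom_set P (x \<otimes>\<^bsub>P\<^esub> y) (x' \<otimes>\<^bsub>P\<^esub> y')"
    "Swp P x' y' \<cdot>\<^bsub>P\<^esub> (f \<boxtimes>\<^bsub>P\<^esub> g) = (g \<boxtimes>\<^bsub>P\<^esub> f) \<cdot>\<^bsub>P\<^esub> Swp P x y"
    by (auto simp: hom_set_iff cls_ATen cls_Cmp cong.swp_natural[THEN cls_eqI] elim!: Arr_cases)
next
  fix x y assume "x \<in> Obj P" "y \<in> Obj P"
  then show "Idn P x \<boxtimes>\<^bsub>P\<^esub> Idn P y = Idn P (x \<otimes>\<^bsub>P\<^esub> y)"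
    by (auto simp: cls_ATen cls_tten_Id cong.left_id[THEN cls_eqI] cong.right_id[THEN cls_eqI])
next
  fix f g f' g' x y z x' y' z'
  assume "f \<in> hom_set P x y" "g \<in> hom_set P y z" "f' \<in> hom_set P x' y'" "g' \<in> hom_set P y' z'"
  then show "(g \<cdot>\<^bsub>P\<^esub> f) \<boxtimes>\<^bsub>P\<^esub> (g' \<cdot>\<^bsub>P\<^esub> f') = (g \<boxtimes>\<^bsub>P\<^esub> g') \<cdot>\<^bsub>P\<^esub> (f \<boxtimes>\<^bsub>P\<^esub> f')"
    by (auto simp: hom_set_iff cls_Cmp cls_ATen cls_tten_TCmp elim!: Arr_cases)
next
  fix f g h x x' y y' z z'
  assume "f \<in> hom_set P x x'" "g \<in> hom_set P y y'" "h \<in> hom_set P z z'"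
  then show "Ass P x' y' z' \<cdot>\<^bsub>P\<^esub> (f \<boxtimes>\<^bsub>P\<^esub> (g \<boxtimes>\<^bsub>P\<^esub> h)) = ((f \<boxtimes>\<^bsub>P\<^esub> g) \<boxtimes>\<^bsub>P\<^esub> h) \<cdot>\<^bsub>P\<^esub> Ass P x y z"
    by (auto simp: hom_set_iff cls_Cmp cls_ATen cong.ass_natural[THEN cls_eqI] elim!: Arr_cases)
next
  fix f x x' assume "f \<in> hom_set P x x'"
  then show "Run P x' \<cdot>\<^bsub>P\<^esub> (f \<boxtimes>\<^bsub>P\<^esub> Idn P (Unt P)) = f \<cdot>\<^bsub>P\<^esub> Run P x"
    "Lun P x' \<cdot>\<^bsub>P\<^esub> (Idn P (Unt P) \<boxtimes>\<^bsub>P\<^esub> f) = f \<cdot>\<^bsub>P\<^esub> Lun P x"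
    by (auto simp: hom_set_iff cls_Cmp cls_ATen cls_tten_Id cong.run_natural[THEN cls_eqI] cong.lun_natural[THEN cls_eqI] elim!: Arr_cases)
next
  fix w x y z assume [simp]: "w \<in> Obj P" "x \<in> Obj P" "y \<in> Obj P" "z \<in> Obj P"
  have [simp]: "w \<in> words S" "x \<in> words S" "y \<in> words S" "z \<in> words S"
    using \<open>w \<in> Obj P\<close> \<open>x \<in> Obj P\<close> \<open>y \<in> Obj P\<close> \<open>z \<in> Obj P\<close> by simp_all
  show "Ass P (w \<otimes>\<^bsub>P\<^esub> x) y z \<cdot>\<^bsub>P\<^esub> Ass P w x (y \<otimes>\<^bsub>P\<^esub> z) =
        (Ass P w x y \<boxtimes>\<^bsub>P\<^esub> Idn P z) \<cdot>\<^bsub>P\<^esub> Ass P w (x \<otimes>\<^bsub>P\<^esub> y) z \<cdot>\<^bsub>P\<^esub> (Idn P w \<boxtimes>\<^bsub>P\<^esub> Ass P x y z)"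
    by (simp add: P.comp_assoc cls_ATen cls_tten_Id) (simp add: cls_Cmp cls_eqI cong.pentagon)
next
  fix x y assume "x \<in> Obj P" "y \<in> Obj P"
  then show "(Run P x \<boxtimes>\<^bsub>P\<^esub> Idn P y) \<cdot>\<^bsub>P\<^esub> Ass P x (Unt P) y = Idn P x \<boxtimes>\<^bsub>P\<^esub> Lun P y"
    "Swp P y x \<cdot>\<^bsub>P\<^esub> Swp P x y = Idn P (x \<otimes>\<^bsub>P\<^esub> y)"
    by (auto simp: cls_ATen cls_tten_Id cls_Cmp cong.triangle[THEN cls_eqI] cong.swp_involution[THEN cls_eqI])
next
  fix x assume "x \<in> Obj P"
  then show "Lun P x \<cdot>\<^bsub>P\<^esub> Swp P x (Unt P) = Run P x"
    by (auto simp: cls_Cmp cong.swp_unit[THEN cls_eqI])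
next
  fix x y z assume "x \<in> Obj P" "y \<in> Obj P" "z \<in> Obj P"
  then have [simp]: "x \<in> words S" "y \<in> words S" "z \<in> words S"
    by simp_all
  show "Ass P z x y \<cdot>\<^bsub>P\<^esub> Swp P (x \<otimes>\<^bsub>P\<^esub> y) z \<cdot>\<^bsub>P\<^esub> Ass P x y z =
        (Swp P x z \<boxtimes>\<^bsub>P\<^esub> Idn P y) \<cdot>\<^bsub>P\<^esub> Ass P x z y \<cdot>\<^bsub>P\<^esub> (Idn P x \<boxtimes>\<^bsub>P\<^esub> Swp P y z)"
    by (simp add: P.comp_assoc cls_ATen cls_tten_Id) (simp add: cls_Cmp cls_eqI cong.hexagon)
qed (auto simp: hom_set_iff iso_arrow_def intro: cls_inverse_canonical)

end

context presentation
begin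

sublocale P: sym_mon_cat P
  by (rule presented_sym_mon_cat)

lemma cls_interchange:
  assumes "W \<in> words S" "X \<in> words S" "Y \<in> words S" "Z \<in> words S"
  shows "interchange P W X Y Z = cl (tinterchange W X Y Z)"
  using assms by (simp add: P.interchange_right cls_ATen cls_tten_Id) (simp add: cls_Cmp tinterchange_def)

end

section \<open>Models of a presentation: the strict functor out of it and its comparison with lax
  functors\<close>

locale presentation_model = presentation S R + C: sym_mon_cat C
  for S :: "('g, 'e) signature" and R and C :: "('o, 'a) smc" (structure) +
  fixes go :: "'g \<Rightarrow> 'o" and ga :: "'e \<Rightarrow> 'a"
  assumes go_Obj: "x \<in> gobj S \<Longrightarrow> go x \<in> Obj C"
    and ga_typed: "e \<in> garr S \<Longrightarrow> ga e \<in> Arr C \<and> Src C (ga e) = word_val C go (gsrc S e) \<and>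
      Trg C (ga e) = word_val C go (gtrg S e)"
    and rel_val: "(p, q) \<in> R \<Longrightarrow> trm_val C go ga p = trm_val C go ga q"
begin

abbreviation "wv \<equiv> word_val C go"
abbreviation "tv \<equiv> trm_val C go ga"

lemma word_val_Obj [simp]: "X \<in> words S \<Longrightarrow> wv X \<in> Obj C"
  by (induction X) (auto simp: go_Obj)

lemma trm_val_simps [simp]:
  assumes "wf_trm S p"
  shows "tv p \<in> Arr C" "Src C (tv p) = wv (tsrc S p)" "Trg C (tv p) = wv (ttrg S p)"
  using assms by (induction p) (auto simp: ga_typed)

lemma trm_val_tten [simp]:
  "wf_trm S p \<Longrightarrow> wf_trm S q \<Longrightarrow> tv (tten S p q) = tv p \<boxtimes> tv q"
  by (simp add: tten_def C.ten_comp)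

text \<open>Soundness: the congruence rules are laws of the target category, and the relations hold
  in a model. Hence the value of a class does not depend on the representative.\<close>

lemma cong_trm_val: "cong S R p q \<Longrightarrow> tv p = tv q"
proof (induction rule: cong.induct)
  case (rel p q)
  then show ?case by (rule rel_val)
next
  case (bifunctor p q)
  then show ?case by (simp add: C.ten_comp)
qed (simp_all add: C.comp_assoc C.ten_comp C.Ass_nat C.Run_nat C.Lun_nat C.Swp_nat C.pentagon_right
    C.triangle C.Swp_unit C.hexagon_right)

abbreviation "F \<equiv> strict_ext S R C go ga"

lemma strict_ext_simps [simp]:
  "X \<in> words S \<Longrightarrow> Fobj F X = wv X"
  "wf_trm S p \<Longrightarrow> Farr F (cl p) = tv p"
  "Fzero F = Idn C (Unt C)"
  "X \<in> words S \<Longrightarrow> Y \<in> words S \<Longrightarrow> Ftwo F X Y = Idn C (wv X \<otimes> wv Y)"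
  using cls_the_elem[of p tv] cong_trm_val by (auto simp: strict_ext_def)

theorem strict_ext_functor: "sm_functor P C F"
proof (rule sm_functorI)
  show "sym_mon_cat P" "sym_mon_cat C" by unfold_locales
  show "Fobj F \<in> Obj P \<rightarrow>\<^sub>E Obj C" "Farr F \<in> extensional (Arr P)" "Ftwo F \<in> extensional (Obj P)"
    by (auto simp: strict_ext_def)
  show "Ftwo F x \<in> extensional (Obj P)" if "x \<in> Obj P" for x
    using that by (simp add: strict_ext_def)
next
  fix f g assume "f \<in> Arr P" "g \<in> Arr P"
  then obtain p q where [simp]: "f = cl p" "g = cl q" "wf_trm S p" "wf_trm S q"
    by (auto elim!: Arr_cases)
  show "Ftwo F (Trg P f) (Trg P g) \<cdot> (Farr F f \<boxtimes> Farr F g) =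
      Farr F (f \<boxtimes>\<^bsub>P\<^esub> g) \<cdot> Ftwo F (Src P f) (Src P g)"
    by (simp add: cls_ATen)
qed (auto simp: cls_Cmp elim!: Arr_cases)

end

text \<open>The comparison from a strict functor to a lax functor \<open>G\<close>, extended from
  the letters: a word is taken apart by strictness and put together again by the structure maps of
  \<open>G\<close>.\<close>

primrec word_nat :: "('p, 'b) smc \<Rightarrow> ('g word, 'c, 'p, 'b) smf \<Rightarrow> ('g \<Rightarrow> 'b) \<Rightarrow> 'g word \<Rightarrow> 'b" where
  "word_nat C G s WUnit = Fzero G"
| "word_nat C G s (WGen x) = s x"
| "word_nat C G s (WTen X Y) = Ftwo G X Y \<cdot>\<^bsub>C\<^esub> (word_nat C G s X \<boxtimes>\<^bsub>C\<^esub> word_nat C G s Y)"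

context presentation_model
begin

text \<open>Naturality needs checking on generating arrows only. Terms with a commuting square are
  closed under composition and, by naturality of \<open>Ftwo G\<close>, under whiskering. They
  include the canonical arrows by the lax axioms of \<open>G\<close>, and the inverses of these by
  transposing squares with \<open>inv_conj\<close>.\<close>

theorem word_nat_mon_nat:
  assumes G: "sm_functor P C G"
    and s: "\<And>x. x \<in> gobj S \<Longrightarrow> s x \<in> Arr C \<and> Src C (s x) = go x \<and> Trg C (s x) = Fobj G (WGen x)"
    and gen: "\<And>e. e \<in> garr S \<Longrightarrow> word_nat C G s (gtrg S e) \<cdot> ga e = Farr G (cl (TGen e)) \<cdot> word_nat C G s (gsrc S e)"
  shows "mon_nat P C F G (\<lambda>X\<in>words S. word_nat C G s X)"
proof -
  interpret G: sm_functor P C G by (rule G)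
  let ?n = "word_nat C G s"
  have G_simps [simp]:
    "X \<in> words S \<Longrightarrow> Fobj G X \<in> Obj C" "Trg C (Fzero G) = Fobj G WUnit"
    "X \<in> words S \<Longrightarrow> Y \<in> words S \<Longrightarrow> Ftwo G X Y \<in> Arr C"
    "X \<in> words S \<Longrightarrow> Y \<in> words S \<Longrightarrow> Src C (Ftwo G X Y) = Fobj G X \<otimes> Fobj G Y"
    "X \<in> words S \<Longrightarrow> Y \<in> words S \<Longrightarrow> Trg C (Ftwo G X Y) = Fobj G (WTen X Y)"
    "X \<in> words S \<Longrightarrow> Farr G (cl (TId X)) = Idn C (Fobj G X)" for X Y
    using G.Fobj_Obj[of X] G.Fzero_simps G.Ftwo_simps[of X Y] G.Farr_Idn[of X] by simp_all
  have n [simp]: "?n X \<in> Arr C \<and> Src C (?n X) = wv X \<and> Trg C (?n X) = Fobj G X" if "X \<in> words S" for X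
    using that by (induction X) (auto simp: s)
  have Ass: "?n (WTen (WTen X Y) Z) \<cdot> Ass C (wv X) (wv Y) (wv Z) = Farr G (cl (TAss X Y Z)) \<cdot> ?n (WTen X (WTen Y Z))"
    if [simp]: "X \<in> words S" "Y \<in> words S" "Z \<in> words S" for X Y Z
  proof -
    have "(Ftwo G X Y \<cdot> (?n X \<boxtimes> ?n Y)) \<boxtimes> ?n Z = (Ftwo G X Y \<boxtimes> Idn C (Fobj G Z)) \<cdot> ((?n X \<boxtimes> ?n Y) \<boxtimes> ?n Z)"
      by (simp add: C.ten_comp)
    then have "?n (WTen (WTen X Y) Z) \<cdot> Ass C (wv X) (wv Y) (wv Z) =
        (Ftwo G (WTen X Y) Z \<cdot> ((Ftwo G X Y \<boxtimes> Idn C (Fobj G Z)) \<cdot> Ass C (Fobj G X) (Fobj G Y) (Fobj G Z))) \<cdot>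
        (?n X \<boxtimes> (?n Y \<boxtimes> ?n Z))"
      using C.Ass_nat[of "?n X" "?n Y" "?n Z" "Fobj G X" "Fobj G Y" "Fobj G Z"] by (simp add: C.comp_assoc)
    also have "\<dots> = (Farr G (cl (TAss X Y Z)) \<cdot> (Ftwo G X (WTen Y Z) \<cdot> (Idn C (Fobj G X) \<boxtimes> Ftwo G Y Z))) \<cdot>
        (?n X \<boxtimes> (?n Y \<boxtimes> ?n Z))"
      using G.assoc_right[of X Y Z] by simp
    also have "\<dots> = Farr G (cl (TAss X Y Z)) \<cdot> ?n (WTen X (WTen Y Z))"
      by (simp add: C.comp_assoc C.ten_comp)
    finally show ?thesis .
  qed
  have Run: "?n X \<cdot> Run C (wv X) = Farr G (cl (TRun X)) \<cdot> ?n (WTen X WUnit)"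
    and Lun: "?n X \<cdot> Lun C (wv X) = Farr G (cl (TLun X)) \<cdot> ?n (WTen WUnit X)"
    if [simp]: "X \<in> words S" for X
  proof -
    have "?n X \<cdot> Run C (wv X) = Run C (Fobj G X) \<cdot> (?n X \<boxtimes> Idn C (Unt C))"
      "?n X \<cdot> Lun C (wv X) = Lun C (Fobj G X) \<cdot> (Idn C (Unt C) \<boxtimes> ?n X)"
      by (simp_all add: C.Run_nat C.Lun_nat)
    then show "?n X \<cdot> Run C (wv X) = Farr G (cl (TRun X)) \<cdot> ?n (WTen X WUnit)"
      "?n X \<cdot> Lun C (wv X) = Farr G (cl (TLun X)) \<cdot> ?n (WTen WUnit X)"
      using G.right_unit_right[of X, symmetric] G.left_unit_right[of X, symmetric]
      by (simp_all add: C.comp_assoc C.ten_comp)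
  qed
  have natural: "?n (ttrg S p) \<cdot> tv p = Farr G (cl p) \<cdot> ?n (tsrc S p)" if "wf_trm S p" for p
    using that
  proof (induction p)
    case (TGen e)
    then show ?case by (simp add: gen)
  next
    case (TId X)
    then show ?case by simp
  next
    case (TCmp q p)
    then have "Farr G (cl (TCmp q p)) = Farr G (cl q) \<cdot> Farr G (cl p)"
      by (simp add: G.Farr_comp flip: cls_Cmp)
    with TCmp show ?case
      by (simp add: C.comp_assoc C.reassoc[of "?n (ttrg S q)" "tv q"])
  next
    case (TLeft X p)
    then have *: "Ftwo G X (ttrg S p) \<cdot> (Idn C (Fobj G X) \<boxtimes> Farr G (cl p)) = Farr G (cl (TLeft X p)) \<cdot> Ftwo G X (tsrc S p)"
      using G.Ftwo_nat[of "cl (TId X)" "cl p" X "ttrg S p"] by (simp add: cls_ATen cls_tten_Id)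
    have "Ftwo G X (ttrg S p) \<cdot> (?n X \<boxtimes> (Farr G (cl p) \<cdot> ?n (tsrc S p))) =
        (Ftwo G X (ttrg S p) \<cdot> (Idn C (Fobj G X) \<boxtimes> Farr G (cl p))) \<cdot> (?n X \<boxtimes> ?n (tsrc S p))"
      using TLeft by (simp add: C.comp_assoc C.ten_comp)
    then show ?case
      using TLeft by (simp add: C.comp_assoc C.ten_comp *)
  next
    case (TRight p X)
    then have *: "Ftwo G (ttrg S p) X \<cdot> (Farr G (cl p) \<boxtimes> Idn C (Fobj G X)) = Farr G (cl (TRight p X)) \<cdot> Ftwo G (tsrc S p) X"
      using G.Ftwo_nat[of "cl p" "cl (TId X)" "ttrg S p" X] by (simp add: cls_ATen cls_tten_Id)
    have "Ftwo G (ttrg S p) X \<cdot> ((Farr G (cl p) \<cdot> ?n (tsrc S p)) \<boxtimes> ?n X) =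
        (Ftwo G (ttrg S p) X \<cdot> (Farr G (cl p) \<boxtimes> Idn C (Fobj G X))) \<cdot> (?n (tsrc S p) \<boxtimes> ?n X)"
      using TRight by (simp add: C.comp_assoc C.ten_comp)
    then show ?case
      using TRight by (simp add: C.comp_assoc C.ten_comp *)
  next
    case (TAss X Y Z)
    then show ?case using Ass[of X Y Z] by simp
  next
    case (TAssInv X Y Z)
    then show ?case
      using G.Farr_inv[of "cl (TAss X Y Z)"] G.iso_Farr[of "cl (TAss X Y Z)"] P.Ass_iso[of X Y Z] Ass[of X Y Z]
        C.inv_conj[of "Ass C (wv X) (wv Y) (wv Z)" "Farr G (cl (TAss X Y Z))"
          "?n (WTen X (WTen Y Z))" "?n (WTen (WTen X Y) Z)"]
      by simp
  next
    case (TRun X)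
    then show ?case using Run[of X] by simp
  next
    case (TRunInv X)
    then show ?case
      using G.Farr_inv[of "cl (TRun X)"] G.iso_Farr[of "cl (TRun X)"] P.Run_iso[of X] Run[of X]
        C.inv_conj[of "Run C (wv X)" "Farr G (cl (TRun X))" "?n (WTen X WUnit)" "?n X"]
      by simp
  next
    case (TLun X)
    then show ?case using Lun[of X] by simp
  next
    case (TLunInv X)
    then show ?case
      using G.Farr_inv[of "cl (TLun X)"] G.iso_Farr[of "cl (TLun X)"] P.Lun_iso[of X] Lun[of X]
        C.inv_conj[of "Lun C (wv X)" "Farr G (cl (TLun X))" "?n (WTen WUnit X)" "?n X"]
      by simp
  next
    case (TSwp X Y)
    then show ?case
      using C.reassoc[OF G.F_sym[of X Y]] by (simp add: C.comp_assoc C.Swp_nat)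
  qed
  show ?thesis
  proof (rule mon_natI)
    show "sm_functor P C F" by (rule strict_ext_functor)
    show "sm_functor P C G" by (rule G)
  next
    fix f assume "f \<in> Arr P"
    then show "(\<lambda>X\<in>words S. ?n X) (Trg P f) \<cdot> Farr F f = Farr G f \<cdot> (\<lambda>X\<in>words S. ?n X) (Src P f)"
      by (auto simp: natural elim!: Arr_cases)
  \<comment> \<open>As the source functor is strict, the two monoidality conditions are the defining
    clauses of \<open>word_nat\<close>.\<close>
  qed auto
qed

end

section \<open>Functors and transformations given by relations\<close>

text \<open>The form shared by a \<otimes> - and - \<otimes> b, so that one proof from
  \<open>functor_rels\<close> covers conditions (ii) and (iii) of the tensor product.\<close>

definition cls_functor ::
  "('g, 'e) signature \<Rightarrow> (('g, 'e) trm \<times> ('g, 'e) trm) set \<Rightarrow> ('o, 'a) smc \<Rightarrow>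
   ('o, 'a, 'g word, ('g, 'e) trm) smf \<Rightarrow> ('o, 'a, 'g word, ('g, 'e) trm set) smf" where
  "cls_functor S R D \<Phi> = \<lparr>
     Fobj = (\<lambda>x\<in>Obj D. Fobj \<Phi> x),
     Farr = (\<lambda>f\<in>Arr D. cls S R (Farr \<Phi> f)),
     Fzero = cls S R (Fzero \<Phi>),
     Ftwo = (\<lambda>x\<in>Obj D. \<lambda>y\<in>Obj D. cls S R (Ftwo \<Phi> x y))\<rparr>"

lemma cls_functor_simps [simp]:
  "x \<in> Obj D \<Longrightarrow> Fobj (cls_functor S R D \<Phi>) x = Fobj \<Phi> x"
  "f \<in> Arr D \<Longrightarrow> Farr (cls_functor S R D \<Phi>) f = cls S R (Farr \<Phi> f)"
  "Fzero (cls_functor S R D \<Phi>) = cls S R (Fzero \<Phi>)"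
  "x \<in> Obj D \<Longrightarrow> y \<in> Obj D \<Longrightarrow> Ftwo (cls_functor S R D \<Phi>) x y = cls S R (Ftwo \<Phi> x y)"
  by (simp_all add: cls_functor_def)

definition formal_functor ::
  "('g, 'e) signature \<Rightarrow> ('o, 'a) smc \<Rightarrow> ('o, 'a, 'g word, ('g, 'e) trm) smf \<Rightarrow> bool" where
  "formal_functor S D \<Phi> \<longleftrightarrow>
    (\<forall>x\<in>Obj D. Fobj \<Phi> x \<in> words S) \<and>
    (\<forall>f\<in>Arr D. wf_trm S (Farr \<Phi> f) \<and> tsrc S (Farr \<Phi> f) = Fobj \<Phi> (Src D f) \<and>
      ttrg S (Farr \<Phi> f) = Fobj \<Phi> (Trg D f)) \<and>
    wf_trm S (Fzero \<Phi>) \<and> tsrc S (Fzero \<Phi>) = WUnit \<and> ttrg S (Fzero \<Phi>) = Fobj \<Phi> (Unt D) \<and>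
    (\<forall>x\<in>Obj D. \<forall>y\<in>Obj D. wf_trm S (Ftwo \<Phi> x y) \<and> tsrc S (Ftwo \<Phi> x y) = WTen (Fobj \<Phi> x) (Fobj \<Phi> y) \<and>
      ttrg S (Ftwo \<Phi> x y) = Fobj \<Phi> (x \<otimes>\<^bsub>D\<^esub> y))"

context presentation
begin

lemma cls_rel: "(p, q) \<in> R \<Longrightarrow> cl p = cl q"
  by (simp add: cls_eqI cong.rel)

lemma cls_functor_functor:
  assumes "sym_mon_cat D" and formal: "formal_functor S D \<Phi>" and rels: "functor_rels S D \<Phi> \<subseteq> R"
  shows "sm_functor D P (cls_functor S R D \<Phi>)"
proof -
  let ?F = "cls_functor S R D \<Phi>"
  interpret D: sym_mon_cat D by fact
  have [simp]: "x \<in> Obj D \<Longrightarrow> Fobj \<Phi> x \<in> words S"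
    "f \<in> Arr D \<Longrightarrow> wf_trm S (Farr \<Phi> f)" "f \<in> Arr D \<Longrightarrow> tsrc S (Farr \<Phi> f) = Fobj \<Phi> (Src D f)"
    "f \<in> Arr D \<Longrightarrow> ttrg S (Farr \<Phi> f) = Fobj \<Phi> (Trg D f)"
    "wf_trm S (Fzero \<Phi>)" "tsrc S (Fzero \<Phi>) = WUnit" "ttrg S (Fzero \<Phi>) = Fobj \<Phi> (Unt D)"
    "x \<in> Obj D \<Longrightarrow> y \<in> Obj D \<Longrightarrow> wf_trm S (Ftwo \<Phi> x y)"
    "x \<in> Obj D \<Longrightarrow> y \<in> Obj D \<Longrightarrow> tsrc S (Ftwo \<Phi> x y) = WTen (Fobj \<Phi> x) (Fobj \<Phi> y)"
    "x \<in> Obj D \<Longrightarrow> y \<in> Obj D \<Longrightarrow> ttrg S (Ftwo \<Phi> x y) = Fobj \<Phi> (x \<otimes>\<^bsub>D\<^esub> y)" for x y f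
    using formal by (auto simp: formal_functor_def)
  have r: "cl p = cl q" if "(p, q) \<in> functor_rels S D \<Phi>" for p q
    by (rule cls_rel) (use that rels in blast)
  show ?thesis
  proof (rule sm_functorI)
    show "sym_mon_cat D" "sym_mon_cat P" by unfold_locales
  next
    fix x assume "x \<in> Obj D"
    then have "cl (Farr \<Phi> (Idn D x)) = cl (TId (Fobj \<Phi> x))"
      by (intro r) (unfold functor_rels_def, blast)
    with \<open>x \<in> Obj D\<close> show "Farr (?F) (Idn D x) = Idn P (Fobj (?F) x)"
      by simp
  next
    fix f g assume "f \<in> Arr D" "g \<in> Arr D" "Src D g = Trg D f"
    moreover from this have "cl (Farr \<Phi> (g \<cdot>\<^bsub>D\<^esub> f)) = cl (TCmp (Farr \<Phi> g) (Farr \<Phi> f))"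
      by (intro r) (unfold functor_rels_def, blast)
    ultimately show "Farr (?F) (g \<cdot>\<^bsub>D\<^esub> f) =
        Farr (?F) g \<cdot>\<^bsub>P\<^esub> Farr (?F) f"
      by (simp add: cls_Cmp)
  next
    fix f g assume fg: "f \<in> Arr D" "g \<in> Arr D"
    then have "cl (TCmp (Ftwo \<Phi> (Trg D f) (Trg D g)) (tten S (Farr \<Phi> f) (Farr \<Phi> g))) =
       cl (TCmp (Farr \<Phi> (f \<boxtimes>\<^bsub>D\<^esub> g)) (Ftwo \<Phi> (Src D f) (Src D g)))"
      by (intro r) (unfold functor_rels_def, blast)
    with fg show "Ftwo (?F) (Trg D f) (Trg D g) \<cdot>\<^bsub>P\<^esub>
        (Farr (?F) f \<boxtimes>\<^bsub>P\<^esub> Farr (?F) g) =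
      Farr (?F) (f \<boxtimes>\<^bsub>D\<^esub> g) \<cdot>\<^bsub>P\<^esub> Ftwo (?F) (Src D f) (Src D g)"
      by (simp add: cls_Cmp cls_ATen)
  next
    fix x y z assume xyz: "x \<in> Obj D" "y \<in> Obj D" "z \<in> Obj D"
    then have "cl (TCmp (Farr \<Phi> (Ass D x y z))
         (TCmp (Ftwo \<Phi> x (y \<otimes>\<^bsub>D\<^esub> z)) (TLeft (Fobj \<Phi> x) (Ftwo \<Phi> y z)))) =
       cl (TCmp (Ftwo \<Phi> (x \<otimes>\<^bsub>D\<^esub> y) z)
         (TCmp (TRight (Ftwo \<Phi> x y) (Fobj \<Phi> z)) (TAss (Fobj \<Phi> x) (Fobj \<Phi> y) (Fobj \<Phi> z))))"
      by (intro r) (unfold functor_rels_def, blast)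
    with xyz show "Farr (?F) (Ass D x y z) \<cdot>\<^bsub>P\<^esub> (Ftwo (?F) x (y \<otimes>\<^bsub>D\<^esub> z) \<cdot>\<^bsub>P\<^esub>
        (Idn P (Fobj (?F) x) \<boxtimes>\<^bsub>P\<^esub> Ftwo (?F) y z)) =
      Ftwo (?F) (x \<otimes>\<^bsub>D\<^esub> y) z \<cdot>\<^bsub>P\<^esub>
        ((Ftwo (?F) x y \<boxtimes>\<^bsub>P\<^esub> Idn P (Fobj (?F) z)) \<cdot>\<^bsub>P\<^esub>
        Ass P (Fobj (?F) x) (Fobj (?F) y) (Fobj (?F) z))"
      by (simp add: cls_ATen cls_tten_Id) (simp add: cls_Cmp)
  next
    fix x assume x: "x \<in> Obj D"
    have "cl (TCmp (Farr \<Phi> (Run D x)) (TCmp (Ftwo \<Phi> x (Unt D)) (TLeft (Fobj \<Phi> x) (Fzero \<Phi>)))) = cl (TRun (Fobj \<Phi> x))"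
      "cl (TCmp (Farr \<Phi> (Lun D x)) (TCmp (Ftwo \<Phi> (Unt D) x) (TRight (Fzero \<Phi>) (Fobj \<Phi> x)))) = cl (TLun (Fobj \<Phi> x))"
      using x by (intro r; unfold functor_rels_def; blast)+
    with x show "Farr (?F) (Run D x) \<cdot>\<^bsub>P\<^esub> (Ftwo (?F) x (Unt D) \<cdot>\<^bsub>P\<^esub>
        (Idn P (Fobj (?F) x) \<boxtimes>\<^bsub>P\<^esub> Fzero (?F))) =
        Run P (Fobj (?F) x)"
      "Farr (?F) (Lun D x) \<cdot>\<^bsub>P\<^esub> (Ftwo (?F) (Unt D) x \<cdot>\<^bsub>P\<^esub>
        (Fzero (?F) \<boxtimes>\<^bsub>P\<^esub> Idn P (Fobj (?F) x))) =
        Lun P (Fobj (?F) x)"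
      by (simp_all add: cls_ATen cls_tten_Id) (simp_all add: cls_Cmp)
  next
    fix x y assume xy: "x \<in> Obj D" "y \<in> Obj D"
    then have "cl (TCmp (Farr \<Phi> (Swp D x y)) (Ftwo \<Phi> x y)) = cl (TCmp (Ftwo \<Phi> y x) (TSwp (Fobj \<Phi> x) (Fobj \<Phi> y)))"
      by (intro r) (unfold functor_rels_def, blast)
    with xy show "Farr (?F) (Swp D x y) \<cdot>\<^bsub>P\<^esub> Ftwo (?F) x y =
      Ftwo (?F) y x \<cdot>\<^bsub>P\<^esub> Swp P (Fobj (?F) x) (Fobj (?F) y)"
      by (simp add: cls_Cmp)
  qed (auto simp: cls_functor_def)
qed

lemma cls_functor_nat:
  assumes D: "sym_mon_cat D" and \<Phi>: "formal_functor S D \<Phi>" "functor_rels S D \<Phi> \<subseteq> R"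
    and \<Psi>: "formal_functor S D \<Psi>" "functor_rels S D \<Psi> \<subseteq> R"
    and \<sigma>: "\<And>x. x \<in> Obj D \<Longrightarrow> wf_trm S (\<sigma> x) \<and> tsrc S (\<sigma> x) = Fobj \<Phi> x \<and> ttrg S (\<sigma> x) = Fobj \<Psi> x"
    and rels: "nat_rels S D \<Phi> \<Psi> \<sigma> \<subseteq> R"
  shows "mon_nat D P (cls_functor S R D \<Phi>) (cls_functor S R D \<Psi>) (\<lambda>x\<in>Obj D. cl (\<sigma> x))"
proof -
  let ?F = "cls_functor S R D \<Phi>"
  let ?G = "cls_functor S R D \<Psi>"
  let ?s = "\<lambda>x\<in>Obj D. cl (\<sigma> x)"
  interpret D: sym_mon_cat D by fact
  have r: "cl p = cl q" if "(p, q) \<in> nat_rels S D \<Phi> \<Psi> \<sigma>" for p q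
    by (rule cls_rel) (use that rels in blast)
  note [simp] = \<sigma>
  show ?thesis
  proof (rule mon_natI)
    show "sm_functor D P (?F)" "sm_functor D P (?G)"
      by (intro cls_functor_functor D \<Phi> \<Psi>)+
  next
    fix f assume f: "f \<in> Arr D"
    then have "cl (TCmp (\<sigma> (Trg D f)) (Farr \<Phi> f)) = cl (TCmp (Farr \<Psi> f) (\<sigma> (Src D f)))"
      by (intro r) (unfold nat_rels_def, blast)
    with f show "?s (Trg D f) \<cdot>\<^bsub>P\<^esub> Farr (?F) f =
        Farr (?G) f \<cdot>\<^bsub>P\<^esub> ?s (Src D f)"
      using \<Phi>(1) \<Psi>(1) by (simp add: cls_Cmp formal_functor_def)
  next
    have "cl (TCmp (\<sigma> (Unt D)) (Fzero \<Phi>)) = cl (Fzero \<Psi>)"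
      by (intro r) (unfold nat_rels_def, blast)
    then show "?s (Unt D) \<cdot>\<^bsub>P\<^esub> Fzero (?F) = Fzero (?G)"
      using \<Phi>(1) \<Psi>(1) by (simp add: cls_Cmp formal_functor_def)
  next
    fix x y assume xy: "x \<in> Obj D" "y \<in> Obj D"
    then have "cl (TCmp (\<sigma> (x \<otimes>\<^bsub>D\<^esub> y)) (Ftwo \<Phi> x y)) = cl (TCmp (Ftwo \<Psi> x y) (tten S (\<sigma> x) (\<sigma> y)))"
      by (intro r) (unfold nat_rels_def, blast)
    with xy show "?s (x \<otimes>\<^bsub>D\<^esub> y) \<cdot>\<^bsub>P\<^esub> Ftwo (?F) x y =
      Ftwo (?G) x y \<cdot>\<^bsub>P\<^esub> (?s x \<boxtimes>\<^bsub>P\<^esub> ?s y)"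
      using \<Phi>(1) \<Psi>(1) by (simp add: cls_Cmp cls_ATen formal_functor_def)
  qed auto
qed

end

section \<open>The tensor product\<close>

lemma tensor_sig_simps [simp]:
  "gobj (tensor_sig A B) = Obj A \<times> Obj B" "gsrc (tensor_sig A B) = tgen_src A B" "gtrg (tensor_sig A B) = tgen_trg A B"
  "Alpha b \<in> garr (tensor_sig A B) \<longleftrightarrow> b \<in> Obj B" "Beta a \<in> garr (tensor_sig A B) \<longleftrightarrow> a \<in> Obj A"
  "Gamma a a' b \<in> garr (tensor_sig A B) \<longleftrightarrow> a \<in> Obj A \<and> a' \<in> Obj A \<and> b \<in> Obj B"
  "Delta a b b' \<in> garr (tensor_sig A B) \<longleftrightarrow> a \<in> Obj A \<and> b \<in> Obj B \<and> b' \<in> Obj B"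
  "ArrL f b \<in> garr (tensor_sig A B) \<longleftrightarrow> f \<in> Arr A \<and> b \<in> Obj B"
  "ArrR a g \<in> garr (tensor_sig A B) \<longleftrightarrow> a \<in> Obj A \<and> g \<in> Arr B"
  by (auto simp: tensor_sig_def)

lemma formal_left_simps [simp]:
  "Fobj (formal_left a) b = WGen (a, b)" "Farr (formal_left a) g = TGen (ArrR a g)"
  "Fzero (formal_left a) = TGen (Beta a)" "Ftwo (formal_left a) b b' = TGen (Delta a b b')"
  by (simp_all add: formal_left_def)

lemma formal_right_simps [simp]:
  "Fobj (formal_right b) a = WGen (a, b)" "Farr (formal_right b) f = TGen (ArrL f b)"
  "Fzero (formal_right b) = TGen (Alpha b)" "Ftwo (formal_right b) a a' = TGen (Gamma a a' b)"
  by (simp_all add: formal_right_def)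

locale tensor = A: sym_mon_cat A + B: sym_mon_cat B
  for A :: "('o, 'a) smc" and B :: "('p, 'b) smc"
begin

abbreviation "Sg \<equiv> tensor_sig A B"
abbreviation "Rl \<equiv> tensor_rels A B"

text \<open>The relations are inspected twice, for their typing and for their validity in a model;
  the eight groups are separated once here.\<close>

lemma tensor_rel_cases [consumes 1]:
  assumes "(p, q) \<in> Rl"
  obtains (left) a where "a \<in> Obj A" "(p, q) \<in> functor_rels Sg B (formal_left a)"
  | (right) b where "b \<in> Obj B" "(p, q) \<in> functor_rels Sg A (formal_right b)"
  | (arrL) f where "f \<in> Arr A" "(p, q) \<in> nat_rels Sg B (formal_left (Src A f)) (formal_left (Trg A f)) (\<lambda>b. TGen (ArrL f b))"
  | (arrR) g where "g \<in> Arr B" "(p, q) \<in> nat_rels Sg A (formal_right (Src B g)) (formal_right (Trg B g)) (\<lambda>a. TGen (ArrR a g))"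
  | (alpha) b b' where "b \<in> Obj B" "b' \<in> Obj B" "p = TCmp (TGen (Alpha (b \<otimes>\<^bsub>B\<^esub> b'))) (TRun WUnit)"
      "q = TCmp (TGen (Delta (Unt A) b b')) (tten Sg (TGen (Alpha b)) (TGen (Alpha b')))"
  | (beta) a a' where "a \<in> Obj A" "a' \<in> Obj A" "p = TCmp (TGen (Beta (a \<otimes>\<^bsub>A\<^esub> a'))) (TRun WUnit)"
      "q = TCmp (TGen (Gamma a a' (Unt B))) (tten Sg (TGen (Beta a)) (TGen (Beta a')))"
  | (unit) "p = TGen (Beta (Unt A))" "q = TGen (Alpha (Unt B))"
  | (middle) a a' b b' where "a \<in> Obj A" "a' \<in> Obj A" "b \<in> Obj B" "b' \<in> Obj B"
      "p = TCmp (TGen (Gamma a a' (b \<otimes>\<^bsub>B\<^esub> b'))) (tten Sg (TGen (Delta a b b')) (TGen (Delta a' b b')))"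
      "q = TCmp (TGen (Delta (a \<otimes>\<^bsub>A\<^esub> a') b b')) (TCmp (tten Sg (TGen (Gamma a a' b)) (TGen (Gamma a a' b')))
           (tinterchange (WGen (a, b)) (WGen (a, b')) (WGen (a', b)) (WGen (a', b'))))"
  using assms unfolding tensor_rels_def Let_def
  apply (elim UnE)
  subgoal by (elim UN_E) (rule left)
  subgoal by (elim UN_E) (rule right)
  subgoal by (elim UN_E) (rule arrL)
  subgoal by (elim UN_E) (rule arrR)
  subgoal by (elim CollectE exE conjE Pair_inject) (rule alpha[rotated 2], assumption+)
  subgoal by (elim CollectE exE conjE Pair_inject) (rule beta[rotated 2], assumption+)
  subgoal by (elim singletonE Pair_inject) (rule unit)
  subgoal by (elim CollectE exE conjE Pair_inject) (rule middle[rotated 4], assumption+)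
  done

lemma gen_cases [consumes 1]:
  assumes "e \<in> garr Sg"
  obtains (Alpha) b where "e = Alpha b" "b \<in> Obj B" | (Beta) a where "e = Beta a" "a \<in> Obj A"
  | (Gamma) a a' b where "e = Gamma a a' b" "a \<in> Obj A" "a' \<in> Obj A" "b \<in> Obj B"
  | (Delta) a b b' where "e = Delta a b b'" "a \<in> Obj A" "b \<in> Obj B" "b' \<in> Obj B"
  | (ArrL) f b where "e = ArrL f b" "f \<in> Arr A" "b \<in> Obj B"
  | (ArrR) a g where "e = ArrR a g" "a \<in> Obj A" "g \<in> Arr B"
  using assms by (cases e) auto

sublocale presentation Sg Rl
proof
  show "gsrc Sg e \<in> words Sg \<and> gtrg Sg e \<in> words Sg" if "e \<in> garr Sg" for e
    using that by (cases rule: gen_cases) auto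
next
  fix p q assume "(p, q) \<in> Rl"
  then show "wf_trm Sg p \<and> wf_trm Sg q \<and> tsrc Sg p = tsrc Sg q \<and> ttrg Sg p = ttrg Sg q"
  proof (cases rule: tensor_rel_cases)
    case (left a)
    then show ?thesis unfolding functor_rels_def by (auto simp: tten_def)
  next
    case (right b)
    then show ?thesis unfolding functor_rels_def by (auto simp: tten_def)
  qed (auto simp: nat_rels_def tten_def)
qed

lemma tensor_smc_eq: "tensor_smc A B = P"
  by (simp add: tensor_smc_def)

lemma formal_functor_left: "a \<in> Obj A \<Longrightarrow> formal_functor Sg B (formal_left a)"
  and formal_functor_right: "b \<in> Obj B \<Longrightarrow> formal_functor Sg A (formal_right b)"
  by (auto simp: formal_functor_def)

lemma rels_subset:
  "a \<in> Obj A \<Longrightarrow> functor_rels Sg B (formal_left a) \<subseteq> Rl"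
  "b \<in> Obj B \<Longrightarrow> functor_rels Sg A (formal_right b) \<subseteq> Rl"
  "f \<in> Arr A \<Longrightarrow> nat_rels Sg B (formal_left (Src A f)) (formal_left (Trg A f)) (\<lambda>b. TGen (ArrL f b)) \<subseteq> Rl"
  "g \<in> Arr B \<Longrightarrow> nat_rels Sg A (formal_right (Src B g)) (formal_right (Trg B g)) (\<lambda>a. TGen (ArrR a g)) \<subseteq> Rl"
  unfolding tensor_rels_def Let_def by blast+

text \<open>The functor - \<otimes> b of condition (iii), which is the value at b of the dual of
  \<open>eta\<close>.\<close>

definition eta_right where "eta_right b = cls_functor Sg Rl A (formal_right b)"

lemma eta_obj_eq: "eta_obj A B a = cls_functor Sg Rl B (formal_left a)"
  by (simp add: eta_obj_def cls_functor_def)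

lemma eta_simps [simp]:
  "b \<in> Obj B \<Longrightarrow> Fobj (eta_obj A B a) b = WGen (a, b)" "g \<in> Arr B \<Longrightarrow> Farr (eta_obj A B a) g = cl (TGen (ArrR a g))"
  "Fzero (eta_obj A B a) = cl (TGen (Beta a))"
  "b \<in> Obj B \<Longrightarrow> b' \<in> Obj B \<Longrightarrow> Ftwo (eta_obj A B a) b b' = cl (TGen (Delta a b b'))"
  "a \<in> Obj A \<Longrightarrow> Fobj (eta_right b) a = WGen (a, b)" "f \<in> Arr A \<Longrightarrow> Farr (eta_right b) f = cl (TGen (ArrL f b))"
  "Fzero (eta_right b) = cl (TGen (Alpha b))"
  "a \<in> Obj A \<Longrightarrow> a' \<in> Obj A \<Longrightarrow> Ftwo (eta_right b) a a' = cl (TGen (Gamma a a' b))"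
  by (simp_all add: eta_obj_eq eta_right_def)

lemma eta_obj_functor: "a \<in> Obj A \<Longrightarrow> sm_functor B P (eta_obj A B a)"
  unfolding eta_obj_eq by (intro cls_functor_functor rels_subset formal_functor_left B.sym_mon_cat_axioms)

lemma eta_right_functor: "b \<in> Obj B \<Longrightarrow> sm_functor A P (eta_right b)"
  unfolding eta_right_def by (intro cls_functor_functor rels_subset formal_functor_right A.sym_mon_cat_axioms)

lemma arrL_nat: "f \<in> Arr A \<Longrightarrow> mon_nat B P (eta_obj A B (Src A f)) (eta_obj A B (Trg A f)) (\<lambda>b\<in>Obj B. cl (TGen (ArrL f b)))"
  unfolding eta_obj_eq
  by (intro cls_functor_nat rels_subset formal_functor_left B.sym_mon_cat_axioms) auto

lemma arrR_nat: "g \<in> Arr B \<Longrightarrow> mon_nat A P (eta_right (Src B g)) (eta_right (Trg B g)) (\<lambda>a\<in>Obj A. cl (TGen (ArrR a g)))"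
  unfolding eta_right_def
  by (intro cls_functor_nat rels_subset formal_functor_right A.sym_mon_cat_axioms) auto

lemma cls_units:
  "b \<in> Obj B \<Longrightarrow> b' \<in> Obj B \<Longrightarrow> cl (TGen (Alpha (b \<otimes>\<^bsub>B\<^esub> b'))) \<cdot>\<^bsub>P\<^esub> Run P WUnit =
    cl (TGen (Delta (Unt A) b b')) \<cdot>\<^bsub>P\<^esub> (cl (TGen (Alpha b)) \<boxtimes>\<^bsub>P\<^esub> cl (TGen (Alpha b')))"
  "a \<in> Obj A \<Longrightarrow> a' \<in> Obj A \<Longrightarrow> cl (TGen (Beta (a \<otimes>\<^bsub>A\<^esub> a'))) \<cdot>\<^bsub>P\<^esub> Run P WUnit =
    cl (TGen (Gamma a a' (Unt B))) \<cdot>\<^bsub>P\<^esub> (cl (TGen (Beta a)) \<boxtimes>\<^bsub>P\<^esub> cl (TGen (Beta a')))"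
  "cl (TGen (Beta (Unt A))) = cl (TGen (Alpha (Unt B)))"
proof -
  show "cl (TGen (Beta (Unt A))) = cl (TGen (Alpha (Unt B)))"
    by (rule cls_rel) (simp add: tensor_rels_def Let_def)
  assume bb: "b \<in> Obj B" "b' \<in> Obj B"
  have "cl (TCmp (TGen (Alpha (b \<otimes>\<^bsub>B\<^esub> b'))) (TRun WUnit)) =
     cl (TCmp (TGen (Delta (Unt A) b b')) (tten Sg (TGen (Alpha b)) (TGen (Alpha b'))))"
    by (rule cls_rel) (use bb in \<open>unfold tensor_rels_def Let_def, blast\<close>)
  with bb show "cl (TGen (Alpha (b \<otimes>\<^bsub>B\<^esub> b'))) \<cdot>\<^bsub>P\<^esub> Run P WUnit =
    cl (TGen (Delta (Unt A) b b')) \<cdot>\<^bsub>P\<^esub> (cl (TGen (Alpha b)) \<boxtimes>\<^bsub>P\<^esub> cl (TGen (Alpha b')))"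
    by (simp add: cls_ATen cls_Cmp)
next
  assume aa: "a \<in> Obj A" "a' \<in> Obj A"
  have "cl (TCmp (TGen (Beta (a \<otimes>\<^bsub>A\<^esub> a'))) (TRun WUnit)) =
     cl (TCmp (TGen (Gamma a a' (Unt B))) (tten Sg (TGen (Beta a)) (TGen (Beta a'))))"
    by (rule cls_rel) (use aa in \<open>unfold tensor_rels_def Let_def, blast\<close>)
  with aa show "cl (TGen (Beta (a \<otimes>\<^bsub>A\<^esub> a'))) \<cdot>\<^bsub>P\<^esub> Run P WUnit =
    cl (TGen (Gamma a a' (Unt B))) \<cdot>\<^bsub>P\<^esub> (cl (TGen (Beta a)) \<boxtimes>\<^bsub>P\<^esub> cl (TGen (Beta a')))"
    by (simp add: cls_ATen cls_Cmp)
qed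

lemma cls_middle:
  assumes [simp]: "a \<in> Obj A" "a' \<in> Obj A" "b \<in> Obj B" "b' \<in> Obj B"
  shows "cl (TGen (Gamma a a' (b \<otimes>\<^bsub>B\<^esub> b'))) \<cdot>\<^bsub>P\<^esub> (cl (TGen (Delta a b b')) \<boxtimes>\<^bsub>P\<^esub> cl (TGen (Delta a' b b'))) =
    cl (TGen (Delta (a \<otimes>\<^bsub>A\<^esub> a') b b')) \<cdot>\<^bsub>P\<^esub> ((cl (TGen (Gamma a a' b)) \<boxtimes>\<^bsub>P\<^esub> cl (TGen (Gamma a a' b'))) \<cdot>\<^bsub>P\<^esub>
      interchange P (WGen (a, b)) (WGen (a, b')) (WGen (a', b)) (WGen (a', b')))"
proof -
  have "cl (TCmp (TGen (Gamma a a' (b \<otimes>\<^bsub>B\<^esub> b'))) (tten Sg (TGen (Delta a b b')) (TGen (Delta a' b b')))) =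
    cl (TCmp (TGen (Delta (a \<otimes>\<^bsub>A\<^esub> a') b b')) (TCmp (tten Sg (TGen (Gamma a a' b)) (TGen (Gamma a a' b')))
           (tinterchange (WGen (a, b)) (WGen (a, b')) (WGen (a', b)) (WGen (a', b')))))"
    by (rule cls_rel) (use assms in \<open>unfold tensor_rels_def Let_def, blast\<close>)
  then show ?thesis
    by (simp add: cls_ATen cls_Cmp cls_interchange)
qed

text \<open>
  Naturality of \<open>\<alpha>\<close> and \<open>\<gamma>\<close> in \<open>b\<close> is the monoidality of the transformations \<open>(a \<otimes> g)\<^sub>a\<close>; naturality of
  \<open>\<beta>\<close> and \<open>\<delta>\<close> in \<open>a\<close> is the monoidality of the transformations \<open>(f \<otimes> b)\<^sub>b\<close>.
\<close>

lemma alpha_nat: "mon_nat B P (const_unit B P) (eta_obj A B (Unt A)) (\<lambda>b\<in>Obj B. cl (TGen (Alpha b)))"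
    (is "mon_nat B P ?F ?G ?s")
proof (rule mon_natI)
  show "sm_functor B P (?F)" "sm_functor B P ?G"
    by (auto intro!: eta_obj_functor smc_pair.const_functor smc_pair.intro B.sym_mon_cat_axioms P.sym_mon_cat_axioms)
next
  fix g assume "g \<in> Arr B"
  then show "?s (Trg B g) \<cdot>\<^bsub>P\<^esub> Farr (?F) g =
      Farr ?G g \<cdot>\<^bsub>P\<^esub> ?s (Src B g)"
    using mon_nat.monoidal_zero[OF arrR_nat[of g]] P.Cmp_Idn[of "cl (TGen (Alpha (Trg B g)))" WUnit] by simp
next
  show "?s (Unt B) \<cdot>\<^bsub>P\<^esub> Fzero (?F) = Fzero ?G"
    using cls_units(3) P.Cmp_Idn[of "cl (TGen (Alpha (Unt B)))" WUnit] by simp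
next
  fix x y assume "x \<in> Obj B" "y \<in> Obj B"
  then show "?s (x \<otimes>\<^bsub>B\<^esub> y) \<cdot>\<^bsub>P\<^esub> Ftwo (?F) x y =
      Ftwo ?G x y \<cdot>\<^bsub>P\<^esub> (?s x \<boxtimes>\<^bsub>P\<^esub> ?s y)"
    using cls_units(1)[of x y] by simp
qed auto

lemma beta_nat: "mon_nat A P (const_unit A P) (eta_right (Unt B)) (\<lambda>a\<in>Obj A. cl (TGen (Beta a)))"
    (is "mon_nat A P ?F ?G ?s")
proof (rule mon_natI)
  show "sm_functor A P (?F)" "sm_functor A P ?G"
    by (auto intro!: eta_right_functor smc_pair.const_functor smc_pair.intro A.sym_mon_cat_axioms P.sym_mon_cat_axioms)
next
  fix f assume "f \<in> Arr A"
  then show "?s (Trg A f) \<cdot>\<^bsub>P\<^esub> Farr (?F) f =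
      Farr ?G f \<cdot>\<^bsub>P\<^esub> ?s (Src A f)"
    using mon_nat.monoidal_zero[OF arrL_nat[of f]] P.Cmp_Idn[of "cl (TGen (Beta (Trg A f)))" WUnit] by simp
next
  show "?s (Unt A) \<cdot>\<^bsub>P\<^esub> Fzero (?F) = Fzero ?G"
    using cls_units(3) P.Cmp_Idn[of "cl (TGen (Alpha (Unt B)))" WUnit] by simp
next
  fix x y assume "x \<in> Obj A" "y \<in> Obj A"
  then show "?s (x \<otimes>\<^bsub>A\<^esub> y) \<cdot>\<^bsub>P\<^esub> Ftwo (?F) x y =
      Ftwo ?G x y \<cdot>\<^bsub>P\<^esub> (?s x \<boxtimes>\<^bsub>P\<^esub> ?s y)"
    using cls_units(2)[of x y] by simp
qed auto

lemma gamma_nat: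
  assumes [simp]: "a \<in> Obj A" "a' \<in> Obj A"
  shows "mon_nat B P (box B P (eta_obj A B a) (eta_obj A B a')) (eta_obj A B (a \<otimes>\<^bsub>A\<^esub> a'))
    (\<lambda>b\<in>Obj B. cl (TGen (Gamma a a' b)))" (is "mon_nat B P ?F ?G ?\<sigma>")
proof (rule mon_natI)
  show "sm_functor B P ?F" "sm_functor B P ?G"
    by (auto intro!: eta_obj_functor smc_pair.box_functor smc_pair.intro B.sym_mon_cat_axioms P.sym_mon_cat_axioms)
next
  fix g assume "g \<in> Arr B"
  then show "?\<sigma> (Trg B g) \<cdot>\<^bsub>P\<^esub> Farr ?F g = Farr ?G g \<cdot>\<^bsub>P\<^esub> ?\<sigma> (Src B g)"
    using mon_nat.monoidal_two[OF arrR_nat[of g], of a a'] by simp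
next
  have "(cl (TGen (Gamma a a' (Unt B))) \<cdot>\<^bsub>P\<^esub> (cl (TGen (Beta a)) \<boxtimes>\<^bsub>P\<^esub> cl (TGen (Beta a')))) \<cdot>\<^bsub>P\<^esub> inv_arrow P (Run P WUnit) =
      cl (TGen (Beta (a \<otimes>\<^bsub>A\<^esub> a')))"
    using cls_units(2)[of a a', symmetric] P.Run_iso[of WUnit] P.Cmp_Idn[of "cl (TGen (Beta (a \<otimes>\<^bsub>A\<^esub> a')))" WUnit]
      P.inv_arrow_simps[of "Run P WUnit"] by (simp add: P.comp_assoc)
  then show "?\<sigma> (Unt B) \<cdot>\<^bsub>P\<^esub> Fzero ?F = Fzero ?G"
    using P.Run_iso[of WUnit] P.inv_arrow_simps[of "Run P WUnit"] by (simp add: P.comp_assoc)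
next
  fix x y assume [simp]: "x \<in> Obj B" "y \<in> Obj B"
  let ?i = "interchange P (WGen (a, x)) (WGen (a, y)) (WGen (a', x)) (WGen (a', y))"
  let ?j = "interchange P (WGen (a, x)) (WGen (a', x)) (WGen (a, y)) (WGen (a', y))"
  note [simp] = P.interchange_simps[simplified]
  \<comment> \<open>Relation (vi) has the interchange next to the \<open>Gamma\<close> arrows, while
    monoidality has one next to the \<open>Delta\<close> arrows. The relation introduces
    \<open>?i\<close>, which cancels \<open>?j\<close>.\<close>
  have "?\<sigma> (x \<otimes>\<^bsub>B\<^esub> y) \<cdot>\<^bsub>P\<^esub> Ftwo ?F x y =
      (cl (TGen (Gamma a a' (x \<otimes>\<^bsub>B\<^esub> y))) \<cdot>\<^bsub>P\<^esub> (cl (TGen (Delta a x y)) \<boxtimes>\<^bsub>P\<^esub> cl (TGen (Delta a' x y)))) \<cdot>\<^bsub>P\<^esub> ?j"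
    by (simp add: P.comp_assoc)
  also have "\<dots> = cl (TGen (Delta (a \<otimes>\<^bsub>A\<^esub> a') x y)) \<cdot>\<^bsub>P\<^esub> ((cl (TGen (Gamma a a' x)) \<boxtimes>\<^bsub>P\<^esub> cl (TGen (Gamma a a' y))) \<cdot>\<^bsub>P\<^esub> (?i \<cdot>\<^bsub>P\<^esub> ?j))"
    unfolding cls_middle[OF assms \<open>x \<in> Obj B\<close> \<open>y \<in> Obj B\<close>] by (simp add: P.comp_assoc)
  also have "\<dots> = Ftwo ?G x y \<cdot>\<^bsub>P\<^esub> (?\<sigma> x \<boxtimes>\<^bsub>P\<^esub> ?\<sigma> y)"
    using P.interchange_involution[of "WGen (a, x)" "WGen (a', x)" "WGen (a, y)" "WGen (a', y)"]
      P.Cmp_Idn[of "cl (TGen (Gamma a a' x)) \<boxtimes>\<^bsub>P\<^esub> cl (TGen (Gamma a a' y))" "WTen (WTen (WGen (a, x)) (WGen (a', x))) (WTen (WGen (a, y)) (WGen (a', y)))"]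
    by simp
  finally show "?\<sigma> (x \<otimes>\<^bsub>B\<^esub> y) \<cdot>\<^bsub>P\<^esub> Ftwo ?F x y = Ftwo ?G x y \<cdot>\<^bsub>P\<^esub> (?\<sigma> x \<boxtimes>\<^bsub>P\<^esub> ?\<sigma> y)" .
qed auto

lemma delta_nat:
  assumes [simp]: "b \<in> Obj B" "b' \<in> Obj B"
  shows "mon_nat A P (box A P (eta_right b) (eta_right b')) (eta_right (b \<otimes>\<^bsub>B\<^esub> b'))
    (\<lambda>a\<in>Obj A. cl (TGen (Delta a b b')))" (is "mon_nat A P ?F ?G ?\<sigma>")
proof (rule mon_natI)
  show "sm_functor A P ?F" "sm_functor A P ?G"
    by (auto intro!: eta_right_functor smc_pair.box_functor smc_pair.intro A.sym_mon_cat_axioms P.sym_mon_cat_axioms)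
next
  fix f assume "f \<in> Arr A"
  then show "?\<sigma> (Trg A f) \<cdot>\<^bsub>P\<^esub> Farr ?F f = Farr ?G f \<cdot>\<^bsub>P\<^esub> ?\<sigma> (Src A f)"
    using mon_nat.monoidal_two[OF arrL_nat[of f], of b b'] by simp
next
  have "(cl (TGen (Delta (Unt A) b b')) \<cdot>\<^bsub>P\<^esub> (cl (TGen (Alpha b)) \<boxtimes>\<^bsub>P\<^esub> cl (TGen (Alpha b')))) \<cdot>\<^bsub>P\<^esub> inv_arrow P (Run P WUnit) =
      cl (TGen (Alpha (b \<otimes>\<^bsub>B\<^esub> b')))"
    using cls_units(1)[of b b', symmetric] P.Run_iso[of WUnit] P.Cmp_Idn[of "cl (TGen (Alpha (b \<otimes>\<^bsub>B\<^esub> b')))" WUnit]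
      P.inv_arrow_simps[of "Run P WUnit"] by (simp add: P.comp_assoc)
  then show "?\<sigma> (Unt A) \<cdot>\<^bsub>P\<^esub> Fzero ?F = Fzero ?G"
    using P.Run_iso[of WUnit] P.inv_arrow_simps[of "Run P WUnit"] by (simp add: P.comp_assoc)
next
  fix x y assume [simp]: "x \<in> Obj A" "y \<in> Obj A"
  show "?\<sigma> (x \<otimes>\<^bsub>A\<^esub> y) \<cdot>\<^bsub>P\<^esub> Ftwo ?F x y = Ftwo ?G x y \<cdot>\<^bsub>P\<^esub> (?\<sigma> x \<boxtimes>\<^bsub>P\<^esub> ?\<sigma> y)"
    using cls_middle[of x y b b'] by (simp add: P.comp_assoc)
qed auto

end

section \<open>Strict functors out of the tensor product\<close>

text \<open>If the formal data evaluate to an actual functor \<open>H\<close>, the relations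
  evaluate to the axioms of \<open>H\<close>. It is the counterpart of
  \<open>cls_functor_functor\<close> inside a model.\<close>

lemma functor_rels_val:
  assumes "sm_functor D C H" and formal: "formal_functor S D \<Phi>"
    and val: "\<And>x. x \<in> Obj D \<Longrightarrow> word_val C go (Fobj \<Phi> x) = Fobj H x"
      "\<And>f. f \<in> Arr D \<Longrightarrow> trm_val C go ga (Farr \<Phi> f) = Farr H f"
      "trm_val C go ga (Fzero \<Phi>) = Fzero H"
      "\<And>x y. x \<in> Obj D \<Longrightarrow> y \<in> Obj D \<Longrightarrow> trm_val C go ga (Ftwo \<Phi> x y) = Ftwo H x y"
    and pq: "(p, q) \<in> functor_rels S D \<Phi>"
  shows "trm_val C go ga p = trm_val C go ga q"
proof -
  interpret H: sm_functor D C H by fact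
  have [simp]: "f \<in> Arr D \<Longrightarrow> tsrc S (Farr \<Phi> f) = Fobj \<Phi> (Src D f)"
    "f \<in> Arr D \<Longrightarrow> ttrg S (Farr \<Phi> f) = Fobj \<Phi> (Trg D f)" for f
    using formal by (auto simp: formal_functor_def)
  show ?thesis
    using pq unfolding functor_rels_def
    by (elim UnE CollectE exE conjE Pair_inject)
      (simp_all add: val tten_def H.B.ten_comp H.Farr_comp H.Ftwo_nat H.assoc_right
        H.right_unit_right H.left_unit_right H.F_sym)
qed

lemma nat_rels_val:
  assumes "mon_nat D C H K \<tau>"
    and val: "\<And>x. x \<in> Obj D \<Longrightarrow> word_val C go (Fobj \<Phi> x) = Fobj H x"
      "\<And>x. x \<in> Obj D \<Longrightarrow> word_val C go (Fobj \<Psi> x) = Fobj K x"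
      "\<And>f. f \<in> Arr D \<Longrightarrow> trm_val C go ga (Farr \<Phi> f) = Farr H f"
      "\<And>f. f \<in> Arr D \<Longrightarrow> trm_val C go ga (Farr \<Psi> f) = Farr K f"
      "trm_val C go ga (Fzero \<Phi>) = Fzero H" "trm_val C go ga (Fzero \<Psi>) = Fzero K"
      "\<And>x y. x \<in> Obj D \<Longrightarrow> y \<in> Obj D \<Longrightarrow> trm_val C go ga (Ftwo \<Phi> x y) = Ftwo H x y"
      "\<And>x y. x \<in> Obj D \<Longrightarrow> y \<in> Obj D \<Longrightarrow> trm_val C go ga (Ftwo \<Psi> x y) = Ftwo K x y"
      "\<And>x. x \<in> Obj D \<Longrightarrow> trm_val C go ga (\<sigma> x) = \<tau> x"
      "\<And>x. x \<in> Obj D \<Longrightarrow> tsrc S (\<sigma> x) = Fobj \<Phi> x \<and> ttrg S (\<sigma> x) = Fobj \<Psi> x"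
    and pq: "(p, q) \<in> nat_rels S D \<Phi> \<Psi> \<sigma>"
  shows "trm_val C go ga p = trm_val C go ga q"
proof -
  interpret mon_nat D C H K \<tau> by fact
  show ?thesis
    using pq unfolding nat_rels_def
    by (elim UnE CollectE exE conjE Pair_inject singletonE)
      (simp_all add: val tten_def F.B.ten_comp naturality monoidal_zero monoidal_two)
qed

text \<open>\<open>G\<close> is given on the dual side, as a functor from \<open>B\<close>, because
  for B the unit such functors come from freeness; the functor on the tensor product is
  \<open>En\<close> of its dual.\<close>

locale hom_functor = tensor A B + C: sym_mon_cat C + G: sm_functor B "hom_smc A C" G
  for A :: "('o, 'a) smc" and B :: "('p, 'b) smc" and C :: "('q, 'c) smc" and G
begin

lemma G_functor: "b \<in> Obj B \<Longrightarrow> sm_functor A C (Fobj G b)"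
  using G.Fobj_Obj by simp

lemma G_components [simp]:
  "g \<in> Arr B \<Longrightarrow> Nsrc (Farr G g) = Fobj G (Src B g)" "g \<in> Arr B \<Longrightarrow> Ntrg (Farr G g) = Fobj G (Trg B g)"
  "Nsrc (Fzero G) = const_unit A C" "Ntrg (Fzero G) = Fobj G (Unt B)"
  "b \<in> Obj B \<Longrightarrow> b' \<in> Obj B \<Longrightarrow> Nsrc (Ftwo G b b') = box A C (Fobj G b) (Fobj G b')"
  "b \<in> Obj B \<Longrightarrow> b' \<in> Obj B \<Longrightarrow> Ntrg (Ftwo G b b') = Fobj G (b \<otimes>\<^bsub>B\<^esub> b')"
  using G.Farr_simps G.Fzero_simps G.Ftwo_simps by simp_all

lemma G_nat:
  "g \<in> Arr B \<Longrightarrow> mon_nat A C (Fobj G (Src B g)) (Fobj G (Trg B g)) (Nmap (Farr G g))"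
  "mon_nat A C (const_unit A C) (Fobj G (Unt B)) (Nmap (Fzero G))"
  "b \<in> Obj B \<Longrightarrow> b' \<in> Obj B \<Longrightarrow>
    mon_nat A C (box A C (Fobj G b) (Fobj G b')) (Fobj G (b \<otimes>\<^bsub>B\<^esub> b')) (Nmap (Ftwo G b b'))"
  using hom_smc_ArrD(1)[of "Farr G g" A C] hom_smc_ArrD(1)[of "Fzero G" A C] hom_smc_ArrD(1)[of "Ftwo G b b'" A C]
  by simp_all

lemma dual_obj_simps:
  "b \<in> Obj B \<Longrightarrow> Fobj (dual_obj B A G a) b = Fobj (Fobj G b) a"
  "g \<in> Arr B \<Longrightarrow> Farr (dual_obj B A G a) g = Nmap (Farr G g) a"
  "Fzero (dual_obj B A G a) = Nmap (Fzero G) a"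
  "b \<in> Obj B \<Longrightarrow> b' \<in> Obj B \<Longrightarrow> Ftwo (dual_obj B A G a) b b' = Nmap (Ftwo G b b') a"
  by (simp_all add: dual_obj_def)

text \<open>Each axiom is the corresponding axiom of \<open>G\<close>, an equation of
  transformations, evaluated at \<open>a\<close>.\<close>

lemma dual_obj_functor:
  assumes [simp]: "a \<in> Obj A"
  shows "sm_functor B C (dual_obj B A G a)"
proof -
  let ?D = "dual_obj B A G a"
  note [simp] = dual_obj_simps sm_functor.Fobj_Obj[OF G_functor]
    mon_nat.comp_simps[OF G_nat(1)] mon_nat.comp_simps[OF G_nat(2)] mon_nat.comp_simps[OF G_nat(3)]
  note at = arg_cong[of _ _ "\<lambda>t. Nmap t a"]
  show ?thesis
  proof (rule sm_functorI)
    show "sym_mon_cat B" "sym_mon_cat C" by unfold_locales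
  next
    fix x assume "x \<in> Obj B"
    then show "Farr (?D) (Idn B x) = Idn C (Fobj (?D) x)"
      using at[OF G.Farr_Idn[of x]] by simp
  next
    fix f g assume "f \<in> Arr B" "g \<in> Arr B" "Src B g = Trg B f"
    then show "Farr (?D) (g \<cdot>\<^bsub>B\<^esub> f) = Farr (?D) g \<cdot>\<^bsub>C\<^esub> Farr (?D) f"
      using at[OF G.Farr_comp[of f g]] by simp
  next
    fix f g assume "f \<in> Arr B" "g \<in> Arr B"
    then show "Ftwo (?D) (Trg B f) (Trg B g) \<cdot>\<^bsub>C\<^esub>
        (Farr (?D) f \<boxtimes>\<^bsub>C\<^esub> Farr (?D) g) =
      Farr (?D) (f \<boxtimes>\<^bsub>B\<^esub> g) \<cdot>\<^bsub>C\<^esub> Ftwo (?D) (Src B f) (Src B g)"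
      using at[OF G.Ftwo_nat[of f g "Trg B f" "Trg B g"]] by simp
  next
    fix x y z assume "x \<in> Obj B" "y \<in> Obj B" "z \<in> Obj B"
    then show "Farr (?D) (Ass B x y z) \<cdot>\<^bsub>C\<^esub> (Ftwo (?D) x (y \<otimes>\<^bsub>B\<^esub> z) \<cdot>\<^bsub>C\<^esub>
          (Idn C (Fobj (?D) x) \<boxtimes>\<^bsub>C\<^esub> Ftwo (?D) y z)) =
        Ftwo (?D) (x \<otimes>\<^bsub>B\<^esub> y) z \<cdot>\<^bsub>C\<^esub> ((Ftwo (?D) x y \<boxtimes>\<^bsub>C\<^esub>
          Idn C (Fobj (?D) z)) \<cdot>\<^bsub>C\<^esub>
          Ass C (Fobj (?D) x) (Fobj (?D) y) (Fobj (?D) z))"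
      using at[OF G.assoc_right[of x y z]] by simp
  next
    fix x assume "x \<in> Obj B"
    then show "Farr (?D) (Run B x) \<cdot>\<^bsub>C\<^esub> (Ftwo (?D) x (Unt B) \<cdot>\<^bsub>C\<^esub>
          (Idn C (Fobj (?D) x) \<boxtimes>\<^bsub>C\<^esub> Fzero (?D))) =
        Run C (Fobj (?D) x)"
      "Farr (?D) (Lun B x) \<cdot>\<^bsub>C\<^esub> (Ftwo (?D) (Unt B) x \<cdot>\<^bsub>C\<^esub>
          (Fzero (?D) \<boxtimes>\<^bsub>C\<^esub> Idn C (Fobj (?D) x))) =
        Lun C (Fobj (?D) x)"
      using at[OF G.right_unit_right[of x]] at[OF G.left_unit_right[of x]] by simp_all
  next
    fix x y assume "x \<in> Obj B" "y \<in> Obj B"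
    then show "Farr (?D) (Swp B x y) \<cdot>\<^bsub>C\<^esub> Ftwo (?D) x y =
        Ftwo (?D) y x \<cdot>\<^bsub>C\<^esub> Swp C (Fobj (?D) x) (Fobj (?D) y)"
      using at[OF G.F_sym[of x y]] by simp
  qed (auto, auto simp: dual_obj_def)
qed

text \<open>Duality exchanges the variables: naturality and monoidality in b come from naturality in
  \<open>f\<close> of the transformations that \<open>G\<close> consists of.\<close>

lemma dual_obj_nat:
  assumes [simp]: "f \<in> Arr A"
  shows "mon_nat B C (dual_obj B A G (Src A f)) (dual_obj B A G (Trg A f)) (\<lambda>b\<in>Obj B. Farr (Fobj G b) f)"
proof -
  let ?D = "dual_obj B A G (Src A f)"
  let ?E = "dual_obj B A G (Trg A f)"
  let ?s = "\<lambda>b\<in>Obj B. Farr (Fobj G b) f"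
  note [simp] = dual_obj_simps sm_functor.Farr_simps[OF G_functor]
  show ?thesis
  proof (rule mon_natI)
    fix g assume "g \<in> Arr B"
    then show "?s (Trg B g) \<cdot>\<^bsub>C\<^esub> Farr (?D) g =
        Farr (?E) g \<cdot>\<^bsub>C\<^esub> ?s (Src B g)"
      using mon_nat.naturality[OF G_nat(1)[of g], of f] by simp
  next
    show "?s (Unt B) \<cdot>\<^bsub>C\<^esub> Fzero (?D) = Fzero (?E)"
      using mon_nat.naturality[OF G_nat(2), of f] mon_nat.comp_simps[OF G_nat(2), of "Trg A f"] by simp
  next
    fix x y assume "x \<in> Obj B" "y \<in> Obj B"
    then show "?s (x \<otimes>\<^bsub>B\<^esub> y) \<cdot>\<^bsub>C\<^esub> Ftwo (?D) x y =
        Ftwo (?E) x y \<cdot>\<^bsub>C\<^esub>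
        (?s x \<boxtimes>\<^bsub>C\<^esub> ?s y)"
      using mon_nat.naturality[OF G_nat(3)[of x y], of f] by simp
  qed (auto intro: dual_obj_functor)
qed

abbreviation "go \<equiv> \<lambda>(a, b). Fobj (Fobj (dual B A C G) a) b"
abbreviation "ga \<equiv> en_gen (dual B A C G)"

lemma go_simp: "a \<in> Obj A \<Longrightarrow> b \<in> Obj B \<Longrightarrow> Fobj (Fobj (dual B A C G) a) b = Fobj (Fobj G b) a"
  by (simp add: dual_def dual_obj_simps)

lemma ga_simps:
  "b \<in> Obj B \<Longrightarrow> ga (Alpha b) = Fzero (Fobj G b)"
  "a \<in> Obj A \<Longrightarrow> ga (Beta a) = Nmap (Fzero G) a"
  "a \<in> Obj A \<Longrightarrow> a' \<in> Obj A \<Longrightarrow> b \<in> Obj B \<Longrightarrow> ga (Gamma a a' b) = Ftwo (Fobj G b) a a'"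
  "a \<in> Obj A \<Longrightarrow> b \<in> Obj B \<Longrightarrow> b' \<in> Obj B \<Longrightarrow> ga (Delta a b b') = Nmap (Ftwo G b b') a"
  "f \<in> Arr A \<Longrightarrow> b \<in> Obj B \<Longrightarrow> ga (ArrL f b) = Farr (Fobj G b) f"
  "a \<in> Obj A \<Longrightarrow> g \<in> Arr B \<Longrightarrow> ga (ArrR a g) = Nmap (Farr G g) a"
  by (simp_all add: dual_def dual_obj_simps)

text \<open>Conditions (ii) to (vi) become facts about \<open>G\<close>: (iii) says that its values
  are functors, (ii) that it is one itself after evaluation at a, (iv) that arrows of either
  category act by transformations, and (v) and (vi) that its structure maps are monoidal.\<close>

sublocale En: presentation_model Sg Rl C go ga
proof
  note [simp] = go_simp ga_simps sm_functor.Fobj_Obj[OF G_functor] sm_functor.Farr_simps[OF G_functor]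
    sm_functor.Fzero_simps[OF G_functor] sm_functor.Ftwo_simps[OF G_functor]
    mon_nat.comp_simps[OF G_nat(1)] mon_nat.comp_simps[OF G_nat(2)] mon_nat.comp_simps[OF G_nat(3)]
  note [simp del] = en_gen.simps
  show "go x \<in> Obj C" if "x \<in> gobj Sg" for x
    using that by auto
  show "ga e \<in> Arr C \<and> Src C (ga e) = word_val C go (gsrc Sg e) \<and> Trg C (ga e) = word_val C go (gtrg Sg e)"
    if "e \<in> garr Sg" for e
    using that by (cases rule: gen_cases) auto
  fix p q assume "(p, q) \<in> Rl"
  then show "trm_val C go ga p = trm_val C go ga q"
  proof (cases rule: tensor_rel_cases)
    case (left a)
    then show ?thesis
      by (intro functor_rels_val[OF dual_obj_functor[of a] formal_functor_left[of a]]) (auto simp: dual_obj_simps)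
  next
    case (right b)
    then show ?thesis
      by (intro functor_rels_val[OF G_functor[of b] formal_functor_right[of b]]) auto
  next
    case (arrL f)
    then show ?thesis
      by (intro nat_rels_val[OF dual_obj_nat[of f], of go
          "formal_left (Src A f)" "formal_left (Trg A f)" ga "\<lambda>b. TGen (ArrL f b)" Sg]) (auto simp: dual_obj_simps)
  next
    case (arrR g)
    then show ?thesis
      by (intro nat_rels_val[OF G_nat(1)[of g], of go
          "formal_right (Src B g)" "formal_right (Trg B g)" ga "\<lambda>a. TGen (ArrR a g)" Sg]) auto
  next
    case (alpha b b')
    \<comment> \<open>The zero map of a pointwise tensor ends in the inverse of \<open>Run\<close>;
      composing with \<open>Run\<close> removes it.\<close>
    have "Fzero (Fobj G (b \<otimes>\<^bsub>B\<^esub> b')) \<cdot>\<^bsub>C\<^esub> Run C (Unt C) =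
        (Nmap (Ftwo G b b') (Unt A) \<cdot>\<^bsub>C\<^esub> ((Fzero (Fobj G b) \<boxtimes>\<^bsub>C\<^esub> Fzero (Fobj G b')) \<cdot>\<^bsub>C\<^esub> inv_arrow C (Run C (Unt C)))) \<cdot>\<^bsub>C\<^esub> Run C (Unt C)"
      using mon_nat.monoidal_zero[OF G_nat(3)[OF alpha(1,2)]] by simp
    with alpha show ?thesis
      by (simp add: tten_def C.ten_comp C.comp_assoc)
  next
    case (beta a a')
    then show ?thesis
      using mon_nat.monoidal_two[OF G_nat(2), of a a'] by (simp add: tten_def C.ten_comp)
  next
    case unit
    then show ?thesis
      using mon_nat.monoidal_zero[OF G_nat(2)] by simp
  next
    case (middle a a' b b')
    then show ?thesis
      using mon_nat.monoidal_two[OF G_nat(3)[of b b'], of a a']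
      by (simp add: tten_def C.ten_comp C.trm_val_tinterchange C.comp_assoc)
  qed
qed

lemma En_dual_eq: "En A B C (dual B A C G) = En.F"
  by (simp add: En_def)

theorem En_dual_functor: "sm_functor (tensor_smc A B) C (En A B C (dual B A C G))"
  unfolding En_dual_eq tensor_smc_eq by (rule En.strict_ext_functor)

end

section \<open>Post-composition\<close>

context sm_functor
begin

abbreviation ftwo_left where
  "ftwo_left a b c \<equiv> Ftwo F (a \<otimes>\<^bsub>A\<^esub> b) c \<cdot>\<^bsub>B\<^esub> (Ftwo F a b \<boxtimes>\<^bsub>B\<^esub> Idn B (Fobj F c))"

abbreviation ftwo_right where
  "ftwo_right a b c \<equiv> Ftwo F a (b \<otimes>\<^bsub>A\<^esub> c) \<cdot>\<^bsub>B\<^esub> (Idn B (Fobj F a) \<boxtimes>\<^bsub>B\<^esub> Ftwo F b c)"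

text \<open>The middle of an interchange acts on three factors: the symmetry axiom in the last two
  factors, between two instances of the associativity axiom.\<close>

lemma ftwo_middle_swap:
  assumes [simp]: "w \<in> Obj A" "x \<in> Obj A" "y \<in> Obj A"
  shows "Farr F (Ass A w y x \<cdot>\<^bsub>A\<^esub> ((Idn A w \<boxtimes>\<^bsub>A\<^esub> Swp A x y) \<cdot>\<^bsub>A\<^esub> inv_arrow A (Ass A w x y))) \<cdot>\<^bsub>B\<^esub> ftwo_left w x y =
    ftwo_left w y x \<cdot>\<^bsub>B\<^esub> (Ass B (Fobj F w) (Fobj F y) (Fobj F x) \<cdot>\<^bsub>B\<^esub>
      ((Idn B (Fobj F w) \<boxtimes>\<^bsub>B\<^esub> Swp B (Fobj F x) (Fobj F y)) \<cdot>\<^bsub>B\<^esub> inv_arrow B (Ass B (Fobj F w) (Fobj F x) (Fobj F y))))"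
proof -
  let ?w = "Fobj F w" and ?x = "Fobj F x" and ?y = "Fobj F y"
  have left: "Farr F (inv_arrow A (Ass A w x y)) \<cdot>\<^bsub>B\<^esub> ftwo_left w x y =
      ftwo_right w x y \<cdot>\<^bsub>B\<^esub> inv_arrow B (Ass B ?w ?x ?y)"
    unfolding Farr_inv[OF A.Ass_iso[OF assms]]
    by (rule B.inv_conj) (simp_all add: assoc_right B.comp_assoc)
  have swap: "Farr F (Idn A w \<boxtimes>\<^bsub>A\<^esub> Swp A x y) \<cdot>\<^bsub>B\<^esub> ftwo_right w x y =
      ftwo_right w y x \<cdot>\<^bsub>B\<^esub> (Idn B ?w \<boxtimes>\<^bsub>B\<^esub> Swp B ?x ?y)"
    using B.reassoc[OF Ftwo_nat[of "Idn A w" "Swp A x y" w "y \<otimes>\<^bsub>A\<^esub> x", symmetric], of "Idn B ?w \<boxtimes>\<^bsub>B\<^esub> Ftwo F x y"]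
    by (simp add: B.comp_assoc B.ten_comp F_sym)
  have "Farr F (Ass A w y x \<cdot>\<^bsub>A\<^esub> ((Idn A w \<boxtimes>\<^bsub>A\<^esub> Swp A x y) \<cdot>\<^bsub>A\<^esub> inv_arrow A (Ass A w x y))) \<cdot>\<^bsub>B\<^esub> ftwo_left w x y =
      Farr F (Ass A w y x) \<cdot>\<^bsub>B\<^esub> (Farr F (Idn A w \<boxtimes>\<^bsub>A\<^esub> Swp A x y) \<cdot>\<^bsub>B\<^esub> (Farr F (inv_arrow A (Ass A w x y)) \<cdot>\<^bsub>B\<^esub> ftwo_left w x y))"
    by (simp add: Farr_comp B.comp_assoc)
  also have "\<dots> = Farr F (Ass A w y x) \<cdot>\<^bsub>B\<^esub> ((Farr F (Idn A w \<boxtimes>\<^bsub>A\<^esub> Swp A x y) \<cdot>\<^bsub>B\<^esub> ftwo_right w x y) \<cdot>\<^bsub>B\<^esub> inv_arrow B (Ass B ?w ?x ?y))"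
    unfolding left by (simp add: B.comp_assoc)
  also have "\<dots> = (Farr F (Ass A w y x) \<cdot>\<^bsub>B\<^esub> ftwo_right w y x) \<cdot>\<^bsub>B\<^esub>
      ((Idn B ?w \<boxtimes>\<^bsub>B\<^esub> Swp B ?x ?y) \<cdot>\<^bsub>B\<^esub> inv_arrow B (Ass B ?w ?x ?y))"
    unfolding swap by (simp add: B.comp_assoc)
  finally show ?thesis
    by (simp add: assoc_right B.comp_assoc)
qed

text \<open>Passes from the fourfold structure map bracketed in pairs to the one bracketed to the
  left, where \<open>ftwo_middle_swap\<close> can act on the first three factors.\<close>

lemma ftwo_four:
  assumes [simp]: "a \<in> Obj A" "b \<in> Obj A" "c \<in> Obj A" "d \<in> Obj A"
  shows "Farr F (Ass A (a \<otimes>\<^bsub>A\<^esub> b) c d) \<cdot>\<^bsub>B\<^esub> (Ftwo F (a \<otimes>\<^bsub>A\<^esub> b) (c \<otimes>\<^bsub>A\<^esub> d) \<cdot>\<^bsub>B\<^esub> (Ftwo F a b \<boxtimes>\<^bsub>B\<^esub> Ftwo F c d)) =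
    Ftwo F ((a \<otimes>\<^bsub>A\<^esub> b) \<otimes>\<^bsub>A\<^esub> c) d \<cdot>\<^bsub>B\<^esub> ((ftwo_left a b c \<boxtimes>\<^bsub>B\<^esub> Idn B (Fobj F d)) \<cdot>\<^bsub>B\<^esub>
      Ass B (Fobj F a \<otimes>\<^bsub>B\<^esub> Fobj F b) (Fobj F c) (Fobj F d))"
proof -
  let ?I = "\<lambda>x. Idn B (Fobj F x)"
  have "Farr F (Ass A (a \<otimes>\<^bsub>A\<^esub> b) c d) \<cdot>\<^bsub>B\<^esub> (Ftwo F (a \<otimes>\<^bsub>A\<^esub> b) (c \<otimes>\<^bsub>A\<^esub> d) \<cdot>\<^bsub>B\<^esub> (Ftwo F a b \<boxtimes>\<^bsub>B\<^esub> Ftwo F c d)) =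
      (Farr F (Ass A (a \<otimes>\<^bsub>A\<^esub> b) c d) \<cdot>\<^bsub>B\<^esub> ftwo_right (a \<otimes>\<^bsub>A\<^esub> b) c d) \<cdot>\<^bsub>B\<^esub> (Ftwo F a b \<boxtimes>\<^bsub>B\<^esub> (?I c \<boxtimes>\<^bsub>B\<^esub> ?I d))"
    by (simp add: B.comp_assoc B.ten_comp)
  also have "\<dots> = Ftwo F ((a \<otimes>\<^bsub>A\<^esub> b) \<otimes>\<^bsub>A\<^esub> c) d \<cdot>\<^bsub>B\<^esub> ((Ftwo F (a \<otimes>\<^bsub>A\<^esub> b) c \<boxtimes>\<^bsub>B\<^esub> ?I d) \<cdot>\<^bsub>B\<^esub>
      (Ass B (Fobj F (a \<otimes>\<^bsub>A\<^esub> b)) (Fobj F c) (Fobj F d) \<cdot>\<^bsub>B\<^esub> (Ftwo F a b \<boxtimes>\<^bsub>B\<^esub> (?I c \<boxtimes>\<^bsub>B\<^esub> ?I d))))"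
    by (simp add: assoc_right B.comp_assoc del: B.ATen_Idn)
  also have "\<dots> = Ftwo F ((a \<otimes>\<^bsub>A\<^esub> b) \<otimes>\<^bsub>A\<^esub> c) d \<cdot>\<^bsub>B\<^esub> ((ftwo_left a b c \<boxtimes>\<^bsub>B\<^esub> Idn B (Fobj F d)) \<cdot>\<^bsub>B\<^esub>
      Ass B (Fobj F a \<otimes>\<^bsub>B\<^esub> Fobj F b) (Fobj F c) (Fobj F d))"
    by (simp add: B.Ass_nat B.ten_comp2 del: B.ATen_Idn)
  finally show ?thesis .
qed

text \<open>An interchange is an exchange within the first three factors, between two associators.
  Composing with the image of the last associator brings both sides to the left bracketing by
  \<open>ftwo_four\<close>, where \<open>ftwo_middle_swap\<close> applies. This is what makes the
  second structure map of post-composition monoidal.\<close>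

theorem Ftwo_interchange:
  assumes [simp]: "w \<in> Obj A" "x \<in> Obj A" "y \<in> Obj A" "z \<in> Obj A"
  shows "Ftwo F (w \<otimes>\<^bsub>A\<^esub> y) (x \<otimes>\<^bsub>A\<^esub> z) \<cdot>\<^bsub>B\<^esub> ((Ftwo F w y \<boxtimes>\<^bsub>B\<^esub> Ftwo F x z) \<cdot>\<^bsub>B\<^esub>
      interchange B (Fobj F w) (Fobj F x) (Fobj F y) (Fobj F z)) =
    Farr F (interchange A w x y z) \<cdot>\<^bsub>B\<^esub> (Ftwo F (w \<otimes>\<^bsub>A\<^esub> x) (y \<otimes>\<^bsub>A\<^esub> z) \<cdot>\<^bsub>B\<^esub> (Ftwo F w x \<boxtimes>\<^bsub>B\<^esub> Ftwo F y z))"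
    (is "?l = ?r")
proof (rule B.iso_mono[of "Farr F (Ass A (w \<otimes>\<^bsub>A\<^esub> y) x z)"])
  let ?w = "Fobj F w" and ?x = "Fobj F x" and ?y = "Fobj F y" and ?z = "Fobj F z"
  define m where "m = Ass A w y x \<cdot>\<^bsub>A\<^esub> ((Idn A w \<boxtimes>\<^bsub>A\<^esub> Swp A x y) \<cdot>\<^bsub>A\<^esub> inv_arrow A (Ass A w x y))"
  define m' where "m' = Ass B ?w ?y ?x \<cdot>\<^bsub>B\<^esub> ((Idn B ?w \<boxtimes>\<^bsub>B\<^esub> Swp B ?x ?y) \<cdot>\<^bsub>B\<^esub> inv_arrow B (Ass B ?w ?x ?y))"
  have m [simp]: "m \<in> Arr A" "Src A m = (w \<otimes>\<^bsub>A\<^esub> x) \<otimes>\<^bsub>A\<^esub> y" "Trg A m = (w \<otimes>\<^bsub>A\<^esub> y) \<otimes>\<^bsub>A\<^esub> x"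
    "m' \<in> Arr B" "Src B m' = (?w \<otimes>\<^bsub>B\<^esub> ?x) \<otimes>\<^bsub>B\<^esub> ?y" "Trg B m' = (?w \<otimes>\<^bsub>B\<^esub> ?y) \<otimes>\<^bsub>B\<^esub> ?x"
    by (simp_all add: m_def m'_def)
  have i: "Ass A (w \<otimes>\<^bsub>A\<^esub> y) x z \<cdot>\<^bsub>A\<^esub> interchange A w x y z = (m \<boxtimes>\<^bsub>A\<^esub> Idn A z) \<cdot>\<^bsub>A\<^esub> Ass A (w \<otimes>\<^bsub>A\<^esub> x) y z"
    by (simp add: A.interchange_right m_def A.ten_comp2 A.comp_assoc)
  have i': "Ass B (?w \<otimes>\<^bsub>B\<^esub> ?y) ?x ?z \<cdot>\<^bsub>B\<^esub> interchange B ?w ?x ?y ?z = (m' \<boxtimes>\<^bsub>B\<^esub> Idn B ?z) \<cdot>\<^bsub>B\<^esub> Ass B (?w \<otimes>\<^bsub>B\<^esub> ?x) ?y ?z"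
    by (simp add: B.interchange_right m'_def B.ten_comp2 B.comp_assoc)
  have mm: "Farr F m \<cdot>\<^bsub>B\<^esub> ftwo_left w x y = ftwo_left w y x \<cdot>\<^bsub>B\<^esub> m'"
    unfolding m_def m'_def by (rule ftwo_middle_swap) simp_all
  have "Farr F (Ass A (w \<otimes>\<^bsub>A\<^esub> y) x z) \<cdot>\<^bsub>B\<^esub> ?l =
      (Farr F (Ass A (w \<otimes>\<^bsub>A\<^esub> y) x z) \<cdot>\<^bsub>B\<^esub> (Ftwo F (w \<otimes>\<^bsub>A\<^esub> y) (x \<otimes>\<^bsub>A\<^esub> z) \<cdot>\<^bsub>B\<^esub> (Ftwo F w y \<boxtimes>\<^bsub>B\<^esub> Ftwo F x z))) \<cdot>\<^bsub>B\<^esub>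
      interchange B ?w ?x ?y ?z"
    by (simp add: B.comp_assoc)
  also have "\<dots> = Ftwo F ((w \<otimes>\<^bsub>A\<^esub> y) \<otimes>\<^bsub>A\<^esub> x) z \<cdot>\<^bsub>B\<^esub> ((ftwo_left w y x \<boxtimes>\<^bsub>B\<^esub> Idn B ?z) \<cdot>\<^bsub>B\<^esub>
      (Ass B (?w \<otimes>\<^bsub>B\<^esub> ?y) ?x ?z \<cdot>\<^bsub>B\<^esub> interchange B ?w ?x ?y ?z))"
    by (subst ftwo_four) (simp_all add: B.comp_assoc)
  also have "\<dots> = Ftwo F ((w \<otimes>\<^bsub>A\<^esub> y) \<otimes>\<^bsub>A\<^esub> x) z \<cdot>\<^bsub>B\<^esub> (((Farr F m \<cdot>\<^bsub>B\<^esub> ftwo_left w x y) \<boxtimes>\<^bsub>B\<^esub> Idn B ?z) \<cdot>\<^bsub>B\<^esub> Ass B (?w \<otimes>\<^bsub>B\<^esub> ?x) ?y ?z)"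
    unfolding i' mm by (simp add: B.ten_comp2)
  also have "\<dots> = (Ftwo F ((w \<otimes>\<^bsub>A\<^esub> y) \<otimes>\<^bsub>A\<^esub> x) z \<cdot>\<^bsub>B\<^esub> (Farr F m \<boxtimes>\<^bsub>B\<^esub> Farr F (Idn A z))) \<cdot>\<^bsub>B\<^esub>
      ((ftwo_left w x y \<boxtimes>\<^bsub>B\<^esub> Idn B ?z) \<cdot>\<^bsub>B\<^esub> Ass B (?w \<otimes>\<^bsub>B\<^esub> ?x) ?y ?z)"
    by (simp add: B.ten_comp2 B.comp_assoc)
  also have "\<dots> = Farr F (m \<boxtimes>\<^bsub>A\<^esub> Idn A z) \<cdot>\<^bsub>B\<^esub> (Ftwo F ((w \<otimes>\<^bsub>A\<^esub> x) \<otimes>\<^bsub>A\<^esub> y) z \<cdot>\<^bsub>B\<^esub>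
      ((ftwo_left w x y \<boxtimes>\<^bsub>B\<^esub> Idn B ?z) \<cdot>\<^bsub>B\<^esub> Ass B (?w \<otimes>\<^bsub>B\<^esub> ?x) ?y ?z))"
    by (subst Ftwo_nat) (simp_all add: B.comp_assoc)
  also have "\<dots> = Farr F (m \<boxtimes>\<^bsub>A\<^esub> Idn A z) \<cdot>\<^bsub>B\<^esub> (Farr F (Ass A (w \<otimes>\<^bsub>A\<^esub> x) y z) \<cdot>\<^bsub>B\<^esub>
      (Ftwo F (w \<otimes>\<^bsub>A\<^esub> x) (y \<otimes>\<^bsub>A\<^esub> z) \<cdot>\<^bsub>B\<^esub> (Ftwo F w x \<boxtimes>\<^bsub>B\<^esub> Ftwo F y z)))"
    by (subst ftwo_four) simp_all
  also have "\<dots> = Farr F ((m \<boxtimes>\<^bsub>A\<^esub> Idn A z) \<cdot>\<^bsub>A\<^esub> Ass A (w \<otimes>\<^bsub>A\<^esub> x) y z) \<cdot>\<^bsub>B\<^esub>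
      (Ftwo F (w \<otimes>\<^bsub>A\<^esub> x) (y \<otimes>\<^bsub>A\<^esub> z) \<cdot>\<^bsub>B\<^esub> (Ftwo F w x \<boxtimes>\<^bsub>B\<^esub> Ftwo F y z))"
    by (simp add: Farr_comp B.comp_assoc)
  also have "\<dots> = Farr F (Ass A (w \<otimes>\<^bsub>A\<^esub> y) x z) \<cdot>\<^bsub>B\<^esub> ?r"
    unfolding i[symmetric] by (simp add: Farr_comp B.comp_assoc)
  finally show "Farr F (Ass A (w \<otimes>\<^bsub>A\<^esub> y) x z) \<cdot>\<^bsub>B\<^esub> ?l = Farr F (Ass A (w \<otimes>\<^bsub>A\<^esub> y) x z) \<cdot>\<^bsub>B\<^esub> ?r" .
qed simp_all

text \<open>Unit companion of \<open>Ftwo_interchange\<close>: composed with the image of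
  \<open>Run\<close>, it reduces to the right unit axiom.\<close>

lemma Fzero_Run:
  "Ftwo F (Unt A) (Unt A) \<cdot>\<^bsub>B\<^esub> ((Fzero F \<boxtimes>\<^bsub>B\<^esub> Fzero F) \<cdot>\<^bsub>B\<^esub> inv_arrow B (Run B (Unt B))) =
    Farr F (inv_arrow A (Run A (Unt A))) \<cdot>\<^bsub>B\<^esub> Fzero F"
proof (rule B.iso_mono[of "Farr F (Run A (Unt A))"])
  have "Fzero F \<boxtimes>\<^bsub>B\<^esub> Fzero F = (Idn B (Fobj F (Unt A)) \<boxtimes>\<^bsub>B\<^esub> Fzero F) \<cdot>\<^bsub>B\<^esub> (Fzero F \<boxtimes>\<^bsub>B\<^esub> Idn B (Unt B))"
    by (simp add: B.ten_comp)
  then have "Farr F (Run A (Unt A)) \<cdot>\<^bsub>B\<^esub> (Ftwo F (Unt A) (Unt A) \<cdot>\<^bsub>B\<^esub> ((Fzero F \<boxtimes>\<^bsub>B\<^esub> Fzero F) \<cdot>\<^bsub>B\<^esub> inv_arrow B (Run B (Unt B)))) =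
      (Farr F (Run A (Unt A)) \<cdot>\<^bsub>B\<^esub> (Ftwo F (Unt A) (Unt A) \<cdot>\<^bsub>B\<^esub> (Idn B (Fobj F (Unt A)) \<boxtimes>\<^bsub>B\<^esub> Fzero F))) \<cdot>\<^bsub>B\<^esub>
      ((Fzero F \<boxtimes>\<^bsub>B\<^esub> Idn B (Unt B)) \<cdot>\<^bsub>B\<^esub> inv_arrow B (Run B (Unt B)))"
    by (simp add: B.comp_assoc)
  also have "\<dots> = Farr F (Run A (Unt A)) \<cdot>\<^bsub>B\<^esub> (Farr F (inv_arrow A (Run A (Unt A))) \<cdot>\<^bsub>B\<^esub> Fzero F)"
    by (simp add: right_unit_right B.reassoc[OF B.Run_nat] B.comp_assoc Farr_inv)
  finally show "Farr F (Run A (Unt A)) \<cdot>\<^bsub>B\<^esub> (Ftwo F (Unt A) (Unt A) \<cdot>\<^bsub>B\<^esub> ((Fzero F \<boxtimes>\<^bsub>B\<^esub> Fzero F) \<cdot>\<^bsub>B\<^esub> inv_arrow B (Run B (Unt B)))) =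
    Farr F (Run A (Unt A)) \<cdot>\<^bsub>B\<^esub> (Farr F (inv_arrow A (Run A (Unt A))) \<cdot>\<^bsub>B\<^esub> Fzero F)" .
qed simp_all

end

section \<open>Post-composition with a lax functor, as a functor between internal homs\<close>

definition post_comp ::
  "('o, 'a) smc \<Rightarrow> ('p, 'b) smc \<Rightarrow> ('q, 'c) smc \<Rightarrow> ('p, 'b, 'q, 'c) smf \<Rightarrow>
   (('o, 'a, 'p, 'b) smf, ('o, 'a, 'p, 'b) smt, ('o, 'a, 'q, 'c) smf, ('o, 'a, 'q, 'c) smt) smf" where
  "post_comp A B C H = \<lparr>
     Fobj = (\<lambda>F\<in>Obj (hom_smc A B). smf_comp A C H F),
     Farr = (\<lambda>\<sigma>\<in>Arr (hom_smc A B). mk_smt (smf_comp A C H (Nsrc \<sigma>)) (smf_comp A C H (Ntrg \<sigma>))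
       (\<lambda>x\<in>Obj A. Farr H (Nmap \<sigma> x))),
     Fzero = mk_smt (const_unit A C) (smf_comp A C H (const_unit A B)) (\<lambda>x\<in>Obj A. Fzero H),
     Ftwo = (\<lambda>F\<in>Obj (hom_smc A B). \<lambda>G\<in>Obj (hom_smc A B).
       mk_smt (box A C (smf_comp A C H F) (smf_comp A C H G)) (smf_comp A C H (box A B F G))
         (\<lambda>x\<in>Obj A. Ftwo H (Fobj F x) (Fobj G x)))\<rparr>"

lemma post_comp_simps [simp]:
  "sm_functor A B F \<Longrightarrow> Fobj (post_comp A B C H) F = smf_comp A C H F"
  "\<sigma> \<in> Arr (hom_smc A B) \<Longrightarrow> Farr (post_comp A B C H) \<sigma> =
    mk_smt (smf_comp A C H (Nsrc \<sigma>)) (smf_comp A C H (Ntrg \<sigma>)) (\<lambda>x\<in>Obj A. Farr H (Nmap \<sigma> x))"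
  "Fzero (post_comp A B C H) = mk_smt (const_unit A C) (smf_comp A C H (const_unit A B)) (\<lambda>x\<in>Obj A. Fzero H)"
  "sm_functor A B F \<Longrightarrow> sm_functor A B G \<Longrightarrow> Ftwo (post_comp A B C H) F G =
    mk_smt (box A C (smf_comp A C H F) (smf_comp A C H G)) (smf_comp A C H (box A B F G))
         (\<lambda>x\<in>Obj A. Ftwo H (Fobj F x) (Fobj G x))"
  by (simp_all add: post_comp_def)

context sm_functor
begin

context
  fixes D :: "('r, 'd) smc"
  assumes D: "sym_mon_cat D"
begin

interpretation D: sym_mon_cat D by (rule D)
interpretation DA: smc_pair D A by unfold_locales
interpretation DB: smc_pair D B by unfold_locales
interpretation HA: sym_mon_cat "hom_smc D A" by (rule DA.hom_smc_sym_mon_cat)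
interpretation HB: sym_mon_cat "hom_smc D B" by (rule DB.hom_smc_sym_mon_cat)

lemma comp_functor: "sm_functor D A G \<Longrightarrow> sm_functor D B (smf_comp D B F G)"
  by (rule smf_comp_functor[OF _ sm_functor_axioms])

lemma post_whisker:
  assumes "mon_nat D A G H \<sigma>"
  shows "mon_nat D B (smf_comp D B F G) (smf_comp D B F H) (\<lambda>x\<in>Obj D. Farr F (\<sigma> x))"
proof -
  let ?s = "\<lambda>x\<in>Obj D. Farr F (\<sigma> x)"
  let ?K = "smf_comp D B F G"
  let ?L = "smf_comp D B F H"
  interpret \<sigma>: mon_nat D A G H \<sigma> by fact
  show ?thesis
  proof (rule mon_natI)
    show "sm_functor D B (?K)" "sm_functor D B (?L)"
      by (intro comp_functor \<sigma>.F.sm_functor_axioms \<sigma>.G.sm_functor_axioms)+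
  next
    show "?s (Unt D) \<cdot>\<^bsub>B\<^esub> Fzero (?K) = Fzero (?L)"
      by (simp flip: \<sigma>.monoidal_zero) (simp add: Farr_comp B.comp_assoc)
  next
    fix x y assume "x \<in> Obj D" "y \<in> Obj D"
    moreover from this have "Farr F (\<sigma> (x \<otimes>\<^bsub>D\<^esub> y)) \<cdot>\<^bsub>B\<^esub> Farr F (Ftwo G x y) = Farr F (Ftwo H x y) \<cdot>\<^bsub>B\<^esub> Farr F (\<sigma> x \<boxtimes>\<^bsub>A\<^esub> \<sigma> y)"
      by (simp add: \<sigma>.monoidal_two flip: Farr_comp)
    ultimately show "?s (x \<otimes>\<^bsub>D\<^esub> y) \<cdot>\<^bsub>B\<^esub> Ftwo (?K) x y =
        Ftwo (?L) x y \<cdot>\<^bsub>B\<^esub> (?s x \<boxtimes>\<^bsub>B\<^esub> ?s y)"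
      by (simp add: B.comp_assoc Ftwo_nat B.reassoc[of "Farr F (\<sigma> (x \<otimes>\<^bsub>D\<^esub> y))"])
  qed (auto simp: \<sigma>.naturality simp flip: Farr_comp)
qed

lemma post_unit: "mon_nat D B (const_unit D B) (smf_comp D B F (const_unit D A)) (\<lambda>x\<in>Obj D. Fzero F)"
    (is "mon_nat D B ?F ?G ?s")
proof (rule mon_natI)
  show "sm_functor D B ?F" "sm_functor D B ?G"
    by (auto intro: comp_functor DA.const_functor DB.const_functor)
next
  fix x y assume [simp]: "x \<in> Obj D" "y \<in> Obj D"
  have "Fzero F \<cdot>\<^bsub>B\<^esub> Run B (Unt B) = Run B (Fobj F (Unt A)) \<cdot>\<^bsub>B\<^esub> (Fzero F \<boxtimes>\<^bsub>B\<^esub> Idn B (Unt B))"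
    by (simp add: B.Run_nat)
  also have "\<dots> = Farr F (Run A (Unt A)) \<cdot>\<^bsub>B\<^esub> (Ftwo F (Unt A) (Unt A) \<cdot>\<^bsub>B\<^esub> (Fzero F \<boxtimes>\<^bsub>B\<^esub> Fzero F))"
    using right_unit_right[of "Unt A", symmetric] by (simp add: B.comp_assoc B.ten_comp)
  finally show "?s (x \<otimes>\<^bsub>D\<^esub> y) \<cdot>\<^bsub>B\<^esub> Ftwo ?F x y =
      Ftwo ?G x y \<cdot>\<^bsub>B\<^esub> (?s x \<boxtimes>\<^bsub>B\<^esub> ?s y)"
    by (simp add: B.comp_assoc)
qed auto

lemma post_box:
  assumes "sm_functor D A G" "sm_functor D A H"
  shows "mon_nat D B (box D B (smf_comp D B F G) (smf_comp D B F H)) (smf_comp D B F (box D A G H))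
         (\<lambda>x\<in>Obj D. Ftwo F (Fobj G x) (Fobj H x))"
proof -
  let ?s = "\<lambda>x\<in>Obj D. Ftwo F (Fobj G x) (Fobj H x)"
  let ?K = "box D B (smf_comp D B F G) (smf_comp D B F H)"
  let ?L = "smf_comp D B F (box D A G H)"
  interpret G: sm_functor D A G by fact
  interpret H: sm_functor D A H by fact
  show ?thesis
  proof (rule mon_natI)
    show "sm_functor D B (?K)" "sm_functor D B (?L)"
      by (intro comp_functor DB.box_functor DA.box_functor assms)+
  next
    have "(Farr F (Fzero G) \<cdot>\<^bsub>B\<^esub> Fzero F) \<boxtimes>\<^bsub>B\<^esub> (Farr F (Fzero H) \<cdot>\<^bsub>B\<^esub> Fzero F) =
        (Farr F (Fzero G) \<boxtimes>\<^bsub>B\<^esub> Farr F (Fzero H)) \<cdot>\<^bsub>B\<^esub> (Fzero F \<boxtimes>\<^bsub>B\<^esub> Fzero F)"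
      by (simp add: B.ten_comp)
    then show "?s (Unt D) \<cdot>\<^bsub>B\<^esub> Fzero (?K) =
        Fzero (?L)"
      by (simp add: B.comp_assoc B.reassoc[OF Ftwo_nat] Fzero_Run Farr_comp)
  next
    fix x y assume [simp]: "x \<in> Obj D" "y \<in> Obj D"
    have "(Farr F (Ftwo G x y) \<cdot>\<^bsub>B\<^esub> Ftwo F (Fobj G x) (Fobj G y)) \<boxtimes>\<^bsub>B\<^esub> (Farr F (Ftwo H x y) \<cdot>\<^bsub>B\<^esub> Ftwo F (Fobj H x) (Fobj H y)) =
        (Farr F (Ftwo G x y) \<boxtimes>\<^bsub>B\<^esub> Farr F (Ftwo H x y)) \<cdot>\<^bsub>B\<^esub> (Ftwo F (Fobj G x) (Fobj G y) \<boxtimes>\<^bsub>B\<^esub> Ftwo F (Fobj H x) (Fobj H y))"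
      by (simp add: B.ten_comp)
    then show "?s (x \<otimes>\<^bsub>D\<^esub> y) \<cdot>\<^bsub>B\<^esub>
        Ftwo (?K) x y =
      Ftwo (?L) x y \<cdot>\<^bsub>B\<^esub>
        (?s x \<boxtimes>\<^bsub>B\<^esub> ?s y)"
      by (simp add: B.comp_assoc B.reassoc[OF Ftwo_nat] Ftwo_interchange Farr_comp)
  qed (auto simp: Ftwo_nat)
qed

text \<open>Pointwise the equations are the axioms of \<open>F\<close> at the values of the functors
  involved. That the structure maps are arrows of the internal hom is the content of
  \<open>post_unit\<close> and \<open>post_box\<close>.\<close>

theorem post_comp_functor: "sm_functor (hom_smc D A) (hom_smc D B) (post_comp D A B F)"
  (is "sm_functor ?HA ?HB ?F")
proof (rule sm_functorI)
  note [simp] = hom_smc_ArrD sm_functor.Fobj_Obj DA.box_functor DA.const_functor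
  show "sym_mon_cat ?HA" "sym_mon_cat ?HB" by unfold_locales
  show "Fobj ?F \<in> Obj ?HA \<rightarrow>\<^sub>E Obj ?HB"
    by (auto simp: post_comp_def comp_functor)
  show "Farr ?F \<in> extensional (Arr ?HA)"
    "Ftwo ?F \<in> extensional (Obj ?HA)"
    by (simp_all add: post_comp_def)
  show "Ftwo ?F x \<in> extensional (Obj ?HA)" if "x \<in> Obj ?HA" for x
    using that by (simp add: post_comp_def)
  fix f assume f: "f \<in> Arr ?HA"
  then show "Farr ?F f \<in> Arr ?HB \<and>
      Src ?HB (Farr ?F f) = Fobj ?F (Src ?HA f) \<and>
      Trg ?HB (Farr ?F f) = Fobj ?F (Trg ?HA f)"
    by (simp add: post_whisker)
next
  note [simp] = hom_smc_ArrD sm_functor.Fobj_Obj DA.box_functor DA.const_functor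
  fix f g assume fg: "f \<in> Arr ?HA" "g \<in> Arr ?HA"
  then show "Ftwo ?F (Trg ?HA f) (Trg ?HA g) \<cdot>\<^bsub>?HB\<^esub>
      (Farr ?F f \<boxtimes>\<^bsub>?HB\<^esub> Farr ?F g) =
    Farr ?F (f \<boxtimes>\<^bsub>?HA\<^esub> g) \<cdot>\<^bsub>?HB\<^esub>
      Ftwo ?F (Src ?HA f) (Src ?HA g)"
    using HA.ATen_simps(1)[OF fg] by (auto simp: Ftwo_nat intro!: restrict_ext)
  assume "Src ?HA g = Trg ?HA f"
  with fg show "Farr ?F (g \<cdot>\<^bsub>?HA\<^esub> f) =
      Farr ?F g \<cdot>\<^bsub>?HB\<^esub> Farr ?F f"
    using HA.Cmp_simps(1)[OF fg] by (auto simp: Farr_comp intro!: restrict_ext)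
qed (use HA.Ass_simps(1) HA.Run_simps(1) HA.Lun_simps(1) HA.Swp_simps(1) in
  \<open>auto simp: sm_functor.Fobj_Obj DA.box_functor DA.const_functor DA.mon_nat_Idn post_unit post_box
    assoc_right right_unit_right left_unit_right F_sym intro!: restrict_ext\<close>)

end

end

section \<open>The canonical arrows\<close>

lemma smf_comp_assoc:
  assumes "sm_functor A B F" "sm_functor B C G" "sm_functor C D H"
  shows "smf_comp A D (smf_comp B D H G) F = smf_comp A D H (smf_comp A C G F)"
proof -
  interpret F: sm_functor A B F by fact
  interpret G: sm_functor B C G by fact
  interpret H: sm_functor C D H by fact
  show ?thesis
    by (auto simp: smf_comp_def H.Farr_comp H.B.comp_assoc intro!: restrict_ext)
qed

lemma smf_comp_id:
  assumes "sm_functor A B F"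
  shows "smf_comp A B F (smf_id A) = F" "smf_comp A B (smf_id B) F = F"
proof -
  interpret F: sm_functor A B F by fact
  have e: "Fobj F \<in> extensional (Obj A)" "Farr F \<in> extensional (Arr A)" "Ftwo F \<in> extensional (Obj A)"
    "\<And>x. x \<in> Obj A \<Longrightarrow> Ftwo F x \<in> extensional (Obj A)"
    using F.Fobj_type F.Farr_type F.Ftwo_type by (auto simp: PiE_def)
  \<comment> \<open>\<open>Ftwo\<close> is extensional in both arguments, so extensionality is
    applied twice.\<close>
  have two: "h = Ftwo F" if "h \<in> extensional (Obj A)"
    "\<And>x. x \<in> Obj A \<Longrightarrow> h x \<in> extensional (Obj A)"
    "\<And>x y. x \<in> Obj A \<Longrightarrow> y \<in> Obj A \<Longrightarrow> h x y = Ftwo F x y" for h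
    by (rule extensionalityI[OF that(1) e(3)], rule extensionalityI[OF that(2) e(4)]) (use that(3) in auto)
  show "smf_comp A B F (smf_id A) = F" "smf_comp A B (smf_id B) F = F"
    by (rule smf.equality; simp add: smf_comp_def extensionalityI[OF _ e(1)] extensionalityI[OF _ e(2)] two)+
qed

context tensor
begin

text \<open>The dual of \<open>eta\<close>. Its functor axioms, evaluated at an object a, are those
  of a \<otimes> -.\<close>

definition eta_dual where
  "eta_dual = \<lparr>
     Fobj = (\<lambda>b\<in>Obj B. eta_right b),
     Farr = (\<lambda>g\<in>Arr B. mk_smt (eta_right (Src B g)) (eta_right (Trg B g)) (\<lambda>a\<in>Obj A. cl (TGen (ArrR a g)))),
     Fzero = mk_smt (const_unit A P) (eta_right (Unt B)) (\<lambda>a\<in>Obj A. cl (TGen (Beta a))),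
     Ftwo = (\<lambda>b\<in>Obj B. \<lambda>b'\<in>Obj B. mk_smt (box A P (eta_right b) (eta_right b')) (eta_right (b \<otimes>\<^bsub>B\<^esub> b'))
       (\<lambda>a\<in>Obj A. cl (TGen (Delta a b b'))))\<rparr>"

lemma eta_dual_simps [simp]:
  "b \<in> Obj B \<Longrightarrow> Fobj eta_dual b = eta_right b"
  "g \<in> Arr B \<Longrightarrow> Farr eta_dual g = mk_smt (eta_right (Src B g)) (eta_right (Trg B g)) (\<lambda>a\<in>Obj A. cl (TGen (ArrR a g)))"
  "Fzero eta_dual = mk_smt (const_unit A P) (eta_right (Unt B)) (\<lambda>a\<in>Obj A. cl (TGen (Beta a)))"
  "b \<in> Obj B \<Longrightarrow> b' \<in> Obj B \<Longrightarrow> Ftwo eta_dual b b' =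
    mk_smt (box A P (eta_right b) (eta_right b')) (eta_right (b \<otimes>\<^bsub>B\<^esub> b')) (\<lambda>a\<in>Obj A. cl (TGen (Delta a b b')))"
  by (simp_all add: eta_dual_def)

theorem eta_dual_functor: "sm_functor B (hom_smc A P) eta_dual"
  (is "sm_functor B ?H _")
proof (rule sm_functorI)
  interpret AP: smc_pair A P by unfold_locales
  show "sym_mon_cat B" by unfold_locales
  show "sym_mon_cat ?H" by (rule AP.hom_smc_sym_mon_cat)
  note E = sm_functor.Farr_Idn[OF eta_obj_functor] sm_functor.Farr_comp[OF eta_obj_functor]
    sm_functor.Ftwo_nat[OF eta_obj_functor] sm_functor.assoc_right[OF eta_obj_functor]
    sm_functor.right_unit_right[OF eta_obj_functor] sm_functor.left_unit_right[OF eta_obj_functor]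
    sm_functor.F_sym[OF eta_obj_functor]
  show "Fobj eta_dual \<in> Obj B \<rightarrow>\<^sub>E Obj ?H"
    by (auto simp: eta_dual_def eta_right_functor)
  show "Farr eta_dual \<in> extensional (Arr B)" "Ftwo eta_dual \<in> extensional (Obj B)"
    by (simp_all add: eta_dual_def)
  show "Ftwo eta_dual x \<in> extensional (Obj B)" if "x \<in> Obj B" for x
    using that by (simp add: eta_dual_def)
  show "Farr eta_dual (Idn B x) = Idn ?H (Fobj eta_dual x)" if "x \<in> Obj B" for x
    using that E(1) by (auto intro!: restrict_ext)
  show "Farr eta_dual (g \<cdot>\<^bsub>B\<^esub> f) = Farr eta_dual g \<cdot>\<^bsub>?H\<^esub> Farr eta_dual f"
    if "f \<in> Arr B" "g \<in> Arr B" "Src B g = Trg B f" for f g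
    using that E(2)[of _ f g] by (auto intro!: restrict_ext)
  show "Ftwo eta_dual (Trg B f) (Trg B g) \<cdot>\<^bsub>?H\<^esub> (Farr eta_dual f \<boxtimes>\<^bsub>?H\<^esub> Farr eta_dual g) =
      Farr eta_dual (f \<boxtimes>\<^bsub>B\<^esub> g) \<cdot>\<^bsub>?H\<^esub> Ftwo eta_dual (Src B f) (Src B g)"
    if "f \<in> Arr B" "g \<in> Arr B" for f g
    using that E(3)[of _ f g "Trg B f" "Trg B g"] by (auto intro!: restrict_ext)
  show "Farr eta_dual (Ass B x y z) \<cdot>\<^bsub>?H\<^esub> (Ftwo eta_dual x (y \<otimes>\<^bsub>B\<^esub> z) \<cdot>\<^bsub>?H\<^esub>
      (Idn ?H (Fobj eta_dual x) \<boxtimes>\<^bsub>?H\<^esub> Ftwo eta_dual y z)) =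
    Ftwo eta_dual (x \<otimes>\<^bsub>B\<^esub> y) z \<cdot>\<^bsub>?H\<^esub> ((Ftwo eta_dual x y \<boxtimes>\<^bsub>?H\<^esub>
      Idn ?H (Fobj eta_dual z)) \<cdot>\<^bsub>?H\<^esub>
      Ass ?H (Fobj eta_dual x) (Fobj eta_dual y) (Fobj eta_dual z))"
    if "x \<in> Obj B" "y \<in> Obj B" "z \<in> Obj B" for x y z
    using that E(4)[of _ x y z] by (auto intro!: restrict_ext)
  show "Farr eta_dual (Run B x) \<cdot>\<^bsub>?H\<^esub> (Ftwo eta_dual x (Unt B) \<cdot>\<^bsub>?H\<^esub>
      (Idn ?H (Fobj eta_dual x) \<boxtimes>\<^bsub>?H\<^esub> Fzero eta_dual)) = Run ?H (Fobj eta_dual x)"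
    "Farr eta_dual (Lun B x) \<cdot>\<^bsub>?H\<^esub> (Ftwo eta_dual (Unt B) x \<cdot>\<^bsub>?H\<^esub>
      (Fzero eta_dual \<boxtimes>\<^bsub>?H\<^esub> Idn ?H (Fobj eta_dual x))) = Lun ?H (Fobj eta_dual x)"
    if "x \<in> Obj B" for x
    using that E(5)[of _ x] E(6)[of _ x] by (auto intro!: restrict_ext)
  show "Farr eta_dual (Swp B x y) \<cdot>\<^bsub>?H\<^esub> Ftwo eta_dual x y =
      Ftwo eta_dual y x \<cdot>\<^bsub>?H\<^esub> Swp ?H (Fobj eta_dual x) (Fobj eta_dual y)"
    if "x \<in> Obj B" "y \<in> Obj B" for x y
    using that E(7)[of _ x y] by (auto intro!: restrict_ext)
qed (auto simp: arrR_nat beta_nat delta_nat)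

text \<open>Evaluation is strict, so composing with it only adds identities to the structure maps.
  At \<open>star\<close> this identifies R' with - \<otimes> \<open>star\<close>.\<close>

lemma ev_eta_eq:
  assumes [simp]: "b \<in> Obj B"
  shows "smf_comp A P (ev_at B P b) (eta A B) = eta_right b"
proof -
  have [simp]: "f \<in> Arr A \<Longrightarrow> mon_nat B P (eta_obj A B (Src A f)) (eta_obj A B (Trg A f)) (\<lambda>b\<in>Obj B. cl (TGen (ArrL f b)))" for f
    by (rule arrL_nat)
  have [simp]: "a \<in> Obj A \<Longrightarrow> sm_functor B P (eta_obj A B a)" for a
    by (rule eta_obj_functor)
  note [simp] = alpha_nat gamma_nat
  have [simp]: "a \<in> Obj A \<Longrightarrow> a' \<in> Obj A \<Longrightarrow>
      cl (TGen (Gamma a a' b)) \<cdot>\<^bsub>P\<^esub> cl (TId (WTen (WGen (a, b)) (WGen (a', b)))) = cl (TGen (Gamma a a' b))" for a a'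
    using P.Cmp_Idn[of "cl (TGen (Gamma a a' b))"] by simp
  have [simp]: "cl (TGen (Alpha b)) \<cdot>\<^bsub>P\<^esub> cl (TId WUnit) = cl (TGen (Alpha b))"
    using P.Cmp_Idn[of "cl (TGen (Alpha b))"] by simp
  have ev: "sm_functor B P F \<Longrightarrow> Fobj (ev_at B P b) F = Fobj F b"
    "\<sigma> \<in> Arr (hom_smc B P) \<Longrightarrow> Farr (ev_at B P b) \<sigma> = Nmap \<sigma> b"
    "Fzero (ev_at B P b) = Idn P (Unt P)"
    "sm_functor B P F \<Longrightarrow> sm_functor B P G \<Longrightarrow> Ftwo (ev_at B P b) F G = Idn P (Fobj F b \<otimes>\<^bsub>P\<^esub> Fobj G b)" for F G \<sigma>
    by (simp_all add: ev_at_def)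
  have eta: "a \<in> Obj A \<Longrightarrow> Fobj (eta A B) a = eta_obj A B a"
    "f \<in> Arr A \<Longrightarrow> Farr (eta A B) f = mk_smt (eta_obj A B (Src A f)) (eta_obj A B (Trg A f)) (\<lambda>b\<in>Obj B. cl (TGen (ArrL f b)))"
    "Fzero (eta A B) = mk_smt (const_unit B P) (eta_obj A B (Unt A)) (\<lambda>b\<in>Obj B. cl (TGen (Alpha b)))"
    "a \<in> Obj A \<Longrightarrow> a' \<in> Obj A \<Longrightarrow> Ftwo (eta A B) a a' = mk_smt (box B P (eta_obj A B a) (eta_obj A B a'))
      (eta_obj A B (a \<otimes>\<^bsub>A\<^esub> a')) (\<lambda>b\<in>Obj B. cl (TGen (Gamma a a' b)))" for a a' f
    by (simp_all add: eta_def tensor_smc_eq)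
  show ?thesis
    by (rule smf.equality; simp add: smf_comp_def eta_right_def cls_functor_def)
      (simp_all add: ev eta cong: restrict_cong)
qed

end

text \<open>The components of \<open>\<kappa>\<close> serve on the letters, and
  \<open>word_nat_mon_nat\<close> extends them to words. Each \<open>\<kappa> b\<close> is a
  monoidal transformation in the A variable, which covers \<open>Alpha\<close>, \<open>Gamma\<close>
  and \<open>ArrL\<close>; \<open>\<kappa>\<close> itself is one in the B variable, which covers
  \<open>Beta\<close>, \<open>Delta\<close> and \<open>ArrR\<close>.\<close>

theorem (in hom_functor) En_dual_nat:
  assumes H: "sm_functor P C H"
    and \<kappa>: "mon_nat B (hom_smc A C) G (smf_comp B (hom_smc A C) (post_comp A P C H) eta_dual) \<kappa>"
  shows "\<exists>\<sigma>. mon_nat P C (En A B C (dual B A C G)) H \<sigma>"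
proof -
  interpret H: sm_functor P C H by (rule H)
  define K where "K = smf_comp B (hom_smc A C) (post_comp A P C H) eta_dual"
  interpret \<kappa>: mon_nat B "hom_smc A C" G K \<kappa> unfolding K_def by (rule \<kappa>)
  interpret AP: smc_pair A P by unfold_locales
  have [simp]: "b \<in> Obj B \<Longrightarrow> sm_functor A P (eta_right b)" for b
    by (rule eta_right_functor)
  note [simp] = arrR_nat beta_nat delta_nat AP.const_functor AP.box_functor
  have K_simps [simp]: "b \<in> Obj B \<Longrightarrow> Fobj K b = smf_comp A C H (eta_right b)"
    "g \<in> Arr B \<Longrightarrow> a \<in> Obj A \<Longrightarrow> Nmap (Farr K g) a = Farr H (cl (TGen (ArrR a g)))"
    "a \<in> Obj A \<Longrightarrow> Nmap (Fzero K) a = Farr H (cl (TGen (Beta a))) \<cdot>\<^bsub>C\<^esub> Fzero H"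
    "b \<in> Obj B \<Longrightarrow> b' \<in> Obj B \<Longrightarrow> a \<in> Obj A \<Longrightarrow> Nmap (Ftwo K b b') a =
      Farr H (cl (TGen (Delta a b b'))) \<cdot>\<^bsub>C\<^esub> Ftwo H (WGen (a, b)) (WGen (a, b'))" for a b b' g
    by (simp_all add: K_def)
  have \<kappa>b: "mon_nat A C (Fobj G b) (smf_comp A C H (eta_right b)) (Nmap (\<kappa> b))" if "b \<in> Obj B" for b
    using \<kappa>.comp_simps[OF that] hom_smc_ArrD(1)[of "\<kappa> b" A C] that by simp
  have [simp]: "Nmap (\<kappa> b) a \<in> Arr C" "Src C (Nmap (\<kappa> b) a) = Fobj (Fobj G b) a"
    "Trg C (Nmap (\<kappa> b) a) = Fobj H (WGen (a, b))" if "a \<in> Obj A" "b \<in> Obj B" for a b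
    using mon_nat.comp_simps[OF \<kappa>b, of b a] that by simp_all
  have H_simps [simp]: "Fzero H \<in> Arr C" "Src C (Fzero H) = Unt C" "Trg C (Fzero H) = Fobj H WUnit"
    "X \<in> words Sg \<Longrightarrow> Y \<in> words Sg \<Longrightarrow> Ftwo H X Y \<in> Arr C"
    "X \<in> words Sg \<Longrightarrow> Y \<in> words Sg \<Longrightarrow> Src C (Ftwo H X Y) = Fobj H X \<otimes>\<^bsub>C\<^esub> Fobj H Y"
    "X \<in> words Sg \<Longrightarrow> Y \<in> words Sg \<Longrightarrow> Trg C (Ftwo H X Y) = Fobj H (WTen X Y)" for X Y
    using H.Fzero_simps H.Ftwo_simps[of X Y] by simp_all
  note at = arg_cong[of _ _ "\<lambda>t. Nmap t a" for a]
  let ?s = "\<lambda>(a, b). Nmap (\<kappa> b) a"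
  have "mon_nat P C En.F H (\<lambda>X\<in>words Sg. word_nat C H ?s X)"
  proof (rule En.word_nat_mon_nat[OF H])
    fix x assume "x \<in> gobj Sg"
    then show "?s x \<in> Arr C \<and> Src C (?s x) = go x \<and> Trg C (?s x) = Fobj H (WGen x)"
      by (auto simp: go_simp)
  next
    fix e assume "e \<in> garr Sg"
    then show "word_nat C H ?s (gtrg Sg e) \<cdot>\<^bsub>C\<^esub> ga e = Farr H (cl (TGen e)) \<cdot>\<^bsub>C\<^esub> word_nat C H ?s (gsrc Sg e)"
    proof (cases rule: gen_cases)
      case (Alpha b)
      then show ?thesis
        using mon_nat.monoidal_zero[OF \<kappa>b, of b] by (simp add: ga_simps del: en_gen.simps)
    next
      case (Beta a)
      then show ?thesis
        using at[OF \<kappa>.monoidal_zero, of a] by (simp add: ga_simps del: en_gen.simps)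
    next
      case (Gamma a a' b)
      then show ?thesis
        using mon_nat.monoidal_two[OF \<kappa>b, of b a a'] by (simp add: ga_simps C.comp_assoc del: en_gen.simps)
    next
      case (Delta a b b')
      then show ?thesis
        using at[OF \<kappa>.monoidal_two[of b b'], of a] by (simp add: ga_simps C.comp_assoc del: en_gen.simps)
    next
      case (ArrL f b)
      then show ?thesis
        using mon_nat.naturality[OF \<kappa>b, of b f] by (simp add: ga_simps del: en_gen.simps)
    next
      case (ArrR a g)
      then show ?thesis
        using at[OF \<kappa>.naturality[of g "Trg B g"], of a] by (simp add: ga_simps del: en_gen.simps)
    qed
  qed
  then show ?thesis
    unfolding En_dual_eq by blast
qed

section \<open>The unit\<close>

interpretation U: presentation unit_sig "{}"
  by unfold_locales (auto simp: unit_sig_def)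

lemma unit_smc_eq: "unit_smc = U.P"
  by (simp add: unit_smc_def)

lemma unit_sym_mon_cat: "sym_mon_cat unit_smc"
  unfolding unit_smc_eq by (rule U.presented_sym_mon_cat)

lemma star_Obj [simp]: "star \<in> Obj unit_smc"
  by (simp add: unit_smc_eq star_def) (simp add: unit_sig_def)

lemma unit_model:
  assumes "sym_mon_cat X" "x \<in> Obj X"
  shows "presentation_model unit_sig {} X (\<lambda>_. x) (\<lambda>_. undefined)"
proof -
  interpret sym_mon_cat X by fact
  show ?thesis
    using assms(2) by unfold_locales (auto simp: unit_sig_def)
qed

lemma strict_at_functor: "sym_mon_cat X \<Longrightarrow> x \<in> Obj X \<Longrightarrow> sm_functor unit_smc X (strict_at X x)"
  unfolding strict_at_def unit_smc_eq by (rule presentation_model.strict_ext_functor[OF unit_model])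

lemma strict_at_star: "Fobj (strict_at X x) star = x"
  by (simp add: strict_at_def strict_ext_def star_def) (simp add: unit_sig_def)

text \<open>Freeness of the unit against lax functors: the identity at \<open>star\<close> extends
  by \<open>word_nat_mon_nat\<close>, whose condition on generating arrows is empty here.\<close>

lemma strict_at_nat:
  assumes "sm_functor unit_smc X G"
  shows "\<exists>\<kappa>. mon_nat unit_smc X (strict_at X (Fobj G star)) G \<kappa>"
proof -
  interpret G: sm_functor unit_smc X G by fact
  interpret presentation_model unit_sig "{}" X "\<lambda>_. Fobj G star" "\<lambda>_. undefined"
    by (rule unit_model) (auto simp: G.B.sym_mon_cat_axioms)
  have "mon_nat U.P X F G (\<lambda>w\<in>words unit_sig. word_nat X G (\<lambda>_. Idn X (Fobj G star)) w)"
  proof (rule word_nat_mon_nat)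
    show "sm_functor U.P X G"
      using assms by (simp add: unit_smc_eq)
    show "Idn X (Fobj G star) \<in> Arr X \<and> Src X (Idn X (Fobj G star)) = Fobj G star \<and>
        Trg X (Idn X (Fobj G star)) = Fobj G (WGen x)" for x
      by (simp add: star_def[symmetric])
  qed (auto simp: unit_sig_def)
  then show ?thesis
    unfolding strict_at_def unit_smc_eq by blast
qed

theorem lemma19p17:
  fixes A :: "('o, 'a) smc"
  assumes "sym_mon_cat A"
  shows "sm_functor A (tensor_smc A unit_smc) (R'_can A) \<and>
    sm_functor (tensor_smc A unit_smc) A (R_can A) \<and>
    smf_comp A A (R_can A) (R'_can A) = smf_id A \<and>
    (\<exists>F \<sigma> \<tau>. sm_functor (tensor_smc A unit_smc) (tensor_smc A unit_smc) F \<and>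
      mon_nat (tensor_smc A unit_smc) (tensor_smc A unit_smc)
        F (smf_id (tensor_smc A unit_smc)) \<sigma> \<and>
      mon_nat (tensor_smc A unit_smc) (tensor_smc A unit_smc)
        F (smf_comp (tensor_smc A unit_smc) (tensor_smc A unit_smc) (R'_can A) (R_can A)) \<tau>)"
proof -
  interpret A: sym_mon_cat A by fact
  interpret U: sym_mon_cat unit_smc by (rule unit_sym_mon_cat)
  interpret tensor A unit_smc by unfold_locales
  interpret AA: smc_pair A A by unfold_locales
  interpret AP: smc_pair A P by unfold_locales
  let ?R' = "R'_can A" and ?R = "R_can A"
  have R'_eq: "?R' = eta_right star"
    by (simp add: R'_can_def tensor_smc_eq ev_eta_eq)
  have R': "sm_functor A P ?R'"
    unfolding R'_eq by (rule eta_right_functor) simp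
  have "sm_functor unit_smc (hom_smc A A) (v_can A)"
    unfolding v_can_def by (rule strict_at_functor) (auto simp: AA.hom_smc_sym_mon_cat smf_id_functor assms)
  then interpret v: hom_functor A unit_smc A "v_can A"
    by (intro hom_functor.intro tensor_axioms assms)
  have R: "sm_functor P A ?R"
    unfolding R_can_def tensor_smc_eq[symmetric] by (rule v.En_dual_functor)
  have v_star: "Fobj (v_can A) star = smf_id A"
    by (simp add: v_can_def strict_at_star)
  \<comment> \<open>The values are read off at \<open>star\<close>, where \<open>v_can A\<close> is
    the identity functor; the structure maps of \<open>R_can A\<close> are identities by
    strictness.\<close>
  have R_simps: "f \<in> Arr A \<Longrightarrow> Farr ?R (cl (TGen (ArrL f star))) = f"
    "Farr ?R (cl (TGen (Alpha star))) = Idn A (Unt A)" "Fzero ?R = Idn A (Unt A)"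
    "a \<in> Obj A \<Longrightarrow> Fobj ?R (WGen (a, star)) = a"
    "a \<in> Obj A \<Longrightarrow> a' \<in> Obj A \<Longrightarrow> Farr ?R (cl (TGen (Gamma a a' star))) = Idn A (a \<otimes>\<^bsub>A\<^esub> a')"
    "a \<in> Obj A \<Longrightarrow> a' \<in> Obj A \<Longrightarrow> Ftwo ?R (WGen (a, star)) (WGen (a', star)) = Idn A (a \<otimes>\<^bsub>A\<^esub> a')" for a a' f
    by (simp_all add: R_can_def v.En_dual_eq v.go_simp v.ga_simps v_star del: en_gen.simps)
  have id: "smf_comp A A ?R ?R' = smf_id A"
    unfolding R'_eq by (auto simp: smf_comp_def smf_id_def R_simps intro!: restrict_ext)
  have RR': "sm_functor P P (smf_comp P P ?R' ?R)"
    by (rule smf_comp_functor[OF R R'])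
  \<comment> \<open>The functor called w in the overview.\<close>
  let ?v = "strict_at (hom_smc A P) ?R'"
  interpret v': hom_functor A unit_smc P ?v
    by (intro hom_functor.intro tensor_axioms P.sym_mon_cat_axioms strict_at_functor AP.hom_smc_sym_mon_cat)
      (simp add: R')
  let ?F = "En A unit_smc P (dual unit_smc A P ?v)"
  have F: "\<exists>\<sigma>. mon_nat P P ?F H \<sigma>" if H: "sm_functor P P H" and "smf_comp A P H ?R' = ?R'" for H
  proof -
    \<comment> \<open>\<open>?K\<close> sends \<open>star\<close> to H o R', which is R' by
      assumption; hence \<open>strict_at_nat\<close> compares \<open>?v\<close> with it.\<close>
    let ?K = "smf_comp unit_smc (hom_smc A P) (post_comp A P P H) eta_dual"
    have K: "sm_functor unit_smc (hom_smc A P) ?K"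
      by (rule smf_comp_functor[OF eta_dual_functor sm_functor.post_comp_functor[OF H assms]])
    have "Fobj ?K star = ?R'"
      using that eta_right_functor[of star] by (simp add: R'_eq)
    with strict_at_nat[OF K] obtain \<kappa> where "mon_nat unit_smc (hom_smc A P) ?v ?K \<kappa>"
      by auto
    then show ?thesis
      by (rule v'.En_dual_nat[OF H])
  qed
  \<comment> \<open>Here R o R' = 1 is used: (R' o R) o R' reduces to R'.\<close>
  have "smf_comp A P (smf_comp P P ?R' ?R) ?R' = ?R'"
    by (simp add: smf_comp_assoc[OF R' R R'] id smf_comp_id[OF R'])
  then obtain \<tau> where "mon_nat P P ?F (smf_comp P P ?R' ?R) \<tau>"
    using F[OF RR'] by blast
  moreover obtain \<sigma> where "mon_nat P P ?F (smf_id P) \<sigma>"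
    using F[OF smf_id_functor[OF P.sym_mon_cat_axioms] smf_comp_id(2)[OF R']] by blast
  moreover have "sm_functor P P ?F"
    using v'.En_dual_functor by (simp add: tensor_smc_eq)
  ultimately show ?thesis
    unfolding tensor_smc_eq using R' R id by blast
qed

end
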